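(* There is a universal constant $c>0$ such that for every $d\ge 1$, every $d$-dimensional lattice $\Lambda\subset\mathbb{R}^d$ and every convex body $C\subset\mathbb{R}^d$ the following hold. (1) If $C$ is lattice reduced with respect to $\Lambda$, then the width directions of $C$ (the vectors $y\in\Lambda^\star\setminus\{0\}$ with $\max_{a,b\in C}y\cdot(a-b)=\mathrm{wdt}_\Lambda(C)$) span a linear space of dimension at least $c\log d$. (2) If $C$ is lattice complete with respect to $\Lambda$, then the vectors $v\in\Lambda\setminus\{0\}$ for which there exists a lattice segment in $C$ parallel to $v$ of lattice length $\mathrm{diam}_\Lambda(C)$ span a linear space of dimension at least $c\log d$. In both statements the order of magnitude $\log d$ is best possible.
   Context: A convex body is a compact convex set in $\mathbb{R}^d$ with non-empty interior. A lattice $\Lambda\subset\mathbb{R}^d$ is a discrete subgroup; it is $d$-dimensional if it spans $\mathbb{R}^d$. The dual lattice is $\Lambda^\star=\{y: x\cdot y\in\mathbb{Z}\ \forall x\in\Lambda\}$. The lattice width is $\mathrm{wdt}_\Lambda(C)=\min_{y\in\Lambda^\star\setminus\{0\}}\max_{a,b\in C} y\cdot(a-b)$. A segment $[a,b]$ is a lattice segment if $b-a$ is parallel to a nonzero vector of $\Lambda$; its lattice length is $|b-a|/|v|$ where $v$ is the generator of $\Lambda\cap\mathrm{span}\{b-a\}$ that is a positive multiple of $b-a$. The lattice diameter $\mathrm{diam}_\Lambda(C)$ is the maximum lattice length of a lattice segment in $C$. $C$ is lattice reduced if no convex body $C'\subsetneq C$ has the same lattice width; lattice complete if no convex body $C'\supsetneq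 C$ has the same lattice diameter. *)

theory Defs
  imports "HOL-Analysis.Analysis" "HOL-Library.Function_Algebras"
begin

text \<open>Points of R^d are modelled as functions nat => real vanishing from index d on;
  vector addition/subtraction are pointwise (Function_Algebras), scalar multiplication is fscale.
  The topology on nat => real is the library product topology (Function_Topology), which on the
  coordinate subspace Edim d agrees with the Euclidean topology.\<close>

definition fscale :: "real \<Rightarrow> (nat \<Rightarrow> real) \<Rightarrow> (nat \<Rightarrow> real)" where
  "fscale r f = (\<lambda>i. r * f i)"

interpretation fvec: vector_space fscale
  by unfold_locales (auto simp: fscale_def plus_fun_def algebra_simps)

definition Edim :: "nat \<Rightarrow> (nat \<Rightarrow> real) set" where
  "Edim d = {x. \<forall>i\<ge>d. x i = 0}"

definition ip :: "nat \<Rightarrow> (nat \<Rightarrow> real) \<Rightarrow> (nat \<Rightarrow> real) \<Rightarrow> real" where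
  "ip d x y = (\<Sum>i<d. x i * y i)"

definition enorm :: "nat \<Rightarrow> (nat \<Rightarrow> real) \<Rightarrow> real" where
  "enorm d x = sqrt (ip d x x)"

definition convex_set :: "(nat \<Rightarrow> real) set \<Rightarrow> bool" where
  "convex_set C \<longleftrightarrow> (\<forall>x\<in>C. \<forall>y\<in>C. \<forall>t::real. 0 \<le> t \<and> t \<le> 1 \<longrightarrow>
      fscale (1 - t) x + fscale t y \<in> C)"

definition convex_body :: "nat \<Rightarrow> (nat \<Rightarrow> real) set \<Rightarrow> bool" where
  "convex_body d C \<longleftrightarrow> C \<subseteq> Edim d \<and> compact C \<and> convex_set C \<and>
     (\<exists>x\<in>C. \<exists>r>0. \<forall>y\<in>Edim d. enorm d (y - x) < r \<longrightarrow> y \<in> C)"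

definition lattice :: "nat \<Rightarrow> (nat \<Rightarrow> real) set \<Rightarrow> bool" where
  "lattice d L \<longleftrightarrow> L \<subseteq> Edim d \<and> 0 \<in> L \<and> (\<forall>x\<in>L. \<forall>y\<in>L. x - y \<in> L) \<and>
     (\<forall>x\<in>L. \<not> x islimpt L) \<and> fvec.span L = Edim d"

definition dual_lattice :: "nat \<Rightarrow> (nat \<Rightarrow> real) set \<Rightarrow> (nat \<Rightarrow> real) set" where
  "dual_lattice d L = {y \<in> Edim d. \<forall>x\<in>L. ip d x y \<in> \<int>}"

definition width_dir :: "nat \<Rightarrow> (nat \<Rightarrow> real) set \<Rightarrow> (nat \<Rightarrow> real) \<Rightarrow> real" where
  "width_dir d C y = Sup {ip d y (a - b) | a b. a \<in> C \<and> b \<in> C}"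

definition lattice_width :: "nat \<Rightarrow> (nat \<Rightarrow> real) set \<Rightarrow> (nat \<Rightarrow> real) set \<Rightarrow> real" where
  "lattice_width d L C = Inf (width_dir d C ` (dual_lattice d L - {0}))"

definition width_directions :: "nat \<Rightarrow> (nat \<Rightarrow> real) set \<Rightarrow> (nat \<Rightarrow> real) set \<Rightarrow> (nat \<Rightarrow> real) set" where
  "width_directions d L C =
     {y \<in> dual_lattice d L - {0}. width_dir d C y = lattice_width d L C}"

definition lattice_segment :: "(nat \<Rightarrow> real) set \<Rightarrow> (nat \<Rightarrow> real) \<Rightarrow> (nat \<Rightarrow> real) \<Rightarrow> bool" where
  "lattice_segment L a b \<longleftrightarrow> a \<noteq> b \<and> (\<exists>v\<in>L. v \<noteq> 0 \<and> (\<exists>s. b - a = fscale s v))"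

definition pos_generator :: "(nat \<Rightarrow> real) set \<Rightarrow> (nat \<Rightarrow> real) \<Rightarrow> (nat \<Rightarrow> real)" where
  "pos_generator L w = (THE v. (\<exists>s>0. v = fscale s w) \<and>
       L \<inter> fvec.span {w} = {fscale (of_int k) v | k. True})"

definition lattice_length :: "nat \<Rightarrow> (nat \<Rightarrow> real) set \<Rightarrow> (nat \<Rightarrow> real) \<Rightarrow> (nat \<Rightarrow> real) \<Rightarrow> real" where
  "lattice_length d L a b = enorm d (b - a) / enorm d (pos_generator L (b - a))"

definition segment_in :: "(nat \<Rightarrow> real) \<Rightarrow> (nat \<Rightarrow> real) \<Rightarrow> (nat \<Rightarrow> real) set \<Rightarrow> bool" where
  "segment_in a b C \<longleftrightarrow> (\<forall>t::real. 0 \<le> t \<and> t \<le> 1 \<longrightarrow> a + fscale t (b - a) \<in> C)"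

definition lattice_diam :: "nat \<Rightarrow> (nat \<Rightarrow> real) set \<Rightarrow> (nat \<Rightarrow> real) set \<Rightarrow> real" where
  "lattice_diam d L C = Sup {lattice_length d L a b | a b.
       lattice_segment L a b \<and> segment_in a b C}"

definition diam_directions :: "nat \<Rightarrow> (nat \<Rightarrow> real) set \<Rightarrow> (nat \<Rightarrow> real) set \<Rightarrow> (nat \<Rightarrow> real) set" where
  "diam_directions d L C = {v \<in> L - {0}. \<exists>a b. lattice_segment L a b \<and> segment_in a b C \<and>
       (\<exists>s. b - a = fscale s v) \<and> lattice_length d L a b = lattice_diam d L C}"

definition lattice_reduced :: "nat \<Rightarrow> (nat \<Rightarrow> real) set \<Rightarrow> (nat \<Rightarrow> real) set \<Rightarrow> bool" where
  "lattice_reduced d L C \<longleftrightarrow> convex_body d C \<and>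
     \<not> (\<exists>C'. convex_body d C' \<and> C' \<subset> C \<and> lattice_width d L C' = lattice_width d L C)"

definition lattice_complete :: "nat \<Rightarrow> (nat \<Rightarrow> real) set \<Rightarrow> (nat \<Rightarrow> real) set \<Rightarrow> bool" where
  "lattice_complete d L C \<longleftrightarrow> convex_body d C \<and>
     \<not> (\<exists>C'. convex_body d C' \<and> C \<subset> C' \<and> lattice_diam d L C' = lattice_diam d L C)"

end

theory Submission
  imports Defs
begin

text \<open>Lower bounds. Two extremal vectors (width or primitive diameter directions) that are congruent
  modulo 3 would produce a lattice vector beating the extremal value, so there are at most
  3^k of them, where k is the dimension of their span. On the other hand there must be many of them.
  If fewer than d/2 width directions occur, some nonzero functional f is constant on a choice of
  maximisers and minimisers; moving C slightly towards the slice of C on which f takes this constant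
  value keeps the lattice width, contradicting reducedness. If fewer than d diameter directions occur,
  some nonzero z is orthogonal to functionals supporting C - C at the endpoints of the corresponding
  vectors, and C + [0, \<epsilon> z] has the same lattice diameter, contradicting completeness.

  Sharpness. In the lattice \<int>^k there are the 2^k - 1 vectors y_S = 1_S (S a nonempty subset of the
  k coordinates), which up to sign are the facet vectors of the Voronoi cell of A_k^*. The dual
  functionals u_S satisfy u_S(y_S) = 1 and |u_T(y_S)| < 1 for T distinct from S, and every nonzero
  integer vector x has |u_S(x)| \<ge> 1 for some S. If 2^k > d, the u_S extend to functionals spanning the
  dual of R^d. Their symmetric convex hull is reduced and its polar is complete with respect to
  lattices that are \<int>^k in the first k coordinates and very fine, respectively very sparse, in the
  others, and all extremal directions lie in the first k coordinates.\<close>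

section \<open>Coordinates, convex bodies and compactness\<close>

text \<open>Why modulo 3: if s - t = 3g, subadditivity pushes the value of g to 2/3 of the minimal
  width (dually, a chord to 3/2 of the diameter). Modulo 2 it would give equality only, and v and -v
  are always congruent modulo 2. In both lower bounds a perturbation of C has to respect infinitely
  many lattice vectors at once; discreteness leaves a positive gap between the extremal value and
  all others, and the perturbation is chosen to fit into that gap. For sharpness let Q(x, y) = (k+1)
  sum x_i y_i - (sum x_i)(sum y_i). On the first k coordinates u_S is Q(y_S, .) / Q(y_S, y_S), and
  the points with |u_S| < 1 for all S form the interior of twice the Voronoi cell of Q. A nonzero
  lattice vector cannot lie there, since lattice translates of the cell have disjoint interiors.
  Strictness for T distinct from S says that y_S / 2 is in the relative interior of its own facet;
  this makes extremal points unique and the bodies rigid. Passing to R^d changes only the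
  functionals: the y_S stay in the first k coordinates, so all pairings are preserved. The k
  singletons span these coordinates, and every other set can carry one new coordinate.\<close>

lemma fscale_apply [simp]: "fscale r f i = r * f i"
  by (simp add: fscale_def)

lemma sum_fun_eval: "(sum f A) i = (\<Sum>a\<in>A. (f a i :: real))"
  by (induction A rule: infinite_finite_induct) auto

lemma fscale_one [simp]: "fscale 1 x = x"
  and fscale_fscale [simp]: "fscale r (fscale s x) = fscale (r * s) x"
  and fscale_zero_left [simp]: "fscale 0 x = 0"
  and fscale_zero_right [simp]: "fscale r 0 = 0"
  by (auto simp: fun_eq_iff)

lemma fscale_eq_0_iff [simp]: "fscale r x = 0 \<longleftrightarrow> r = 0 \<or> x = 0"
  by (auto simp: fun_eq_iff)

lemma ip_simps:
  "ip d (x + y) z = ip d x z + ip d y z" "ip d z (x + y) = ip d z x + ip d z y"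
  "ip d (x - y) z = ip d x z - ip d y z" "ip d z (x - y) = ip d z x - ip d z y"
  "ip d (fscale r x) z = r * ip d x z" "ip d z (fscale r x) = r * ip d z x"
  "ip d 0 z = 0" "ip d z 0 = 0" "ip d (- x) z = - ip d x z" "ip d z (- x) = - ip d z x"
  by (auto simp: ip_def algebra_simps sum.distrib sum_subtractf sum_distrib_left sum_negf)

lemma ip_commute: "ip d x y = ip d y x"
  by (simp add: ip_def mult.commute)

lemma ip_sum_left:
  fixes f :: "'a \<Rightarrow> nat \<Rightarrow> real"
  shows "ip d (sum f A) z = (\<Sum>a\<in>A. ip d (f a) z)"
  unfolding ip_def sum_fun_eval by (simp add: sum_distrib_right sum.swap[of _ A])

lemma Edim_0 [simp]: "0 \<in> Edim d"
  and Edim_add: "x \<in> Edim d \<Longrightarrow> y \<in> Edim d \<Longrightarrow> x + y \<in> Edim d"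
  and Edim_diff: "x \<in> Edim d \<Longrightarrow> y \<in> Edim d \<Longrightarrow> x - y \<in> Edim d"
  and Edim_scale: "x \<in> Edim d \<Longrightarrow> fscale r x \<in> Edim d"
  by (auto simp: Edim_def)

lemma subspace_Edim: "fvec.subspace (Edim d)"
  by (auto simp: fvec.subspace_def Edim_add Edim_scale)

lemma Edim_sum: "(\<And>a. a \<in> A \<Longrightarrow> f a \<in> Edim d) \<Longrightarrow> sum f A \<in> Edim d"
  by (simp add: fvec.subspace_sum subspace_Edim)

lemma Edim_eqI:
  assumes "x \<in> Edim d" "y \<in> Edim d" "\<And>i. i < d \<Longrightarrow> x i = y i"
  shows "x = y"
proof
  show "x i = y i" for i using assms by (cases "i < d") (auto simp: Edim_def)
qed

lemma Edim_nonzero: "x \<in> Edim d \<Longrightarrow> x \<noteq> 0 \<Longrightarrow> \<exists>i<d. x i \<noteq> 0"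
  by (metis Edim_eqI Edim_0 zero_fun_apply)

lemma ip_self_nonneg: "ip d x x \<ge> 0"
  by (simp add: ip_def sum_nonneg)

lemma ip_self_pos: "x \<in> Edim d \<Longrightarrow> x \<noteq> 0 \<Longrightarrow> ip d x x > 0"
  using Edim_nonzero[of x d] by (auto simp: ip_def intro!: sum_pos2)

definition uvec :: "nat \<Rightarrow> nat \<Rightarrow> real" where
  "uvec i = (\<lambda>j. if j = i then 1 else 0)"

lemma uvec_apply: "uvec i j = (if j = i then 1 else 0)"
  by (simp add: uvec_def)

lemma uvec_Edim: "i < d \<Longrightarrow> uvec i \<in> Edim d"
  by (auto simp: uvec_def Edim_def)

lemma ip_uvec: "i < d \<Longrightarrow> ip d x (uvec i) = x i"
  by (simp add: ip_def uvec_def mult_delta_right)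

lemma Edim_sum_uvec:
  assumes "x \<in> Edim d" shows "(\<Sum>i<d. fscale (x i) (uvec i)) = x"
proof
  fix j
  have "(\<Sum>i<d. fscale (x i) (uvec i)) j = (\<Sum>i<d. if j = i then x i else 0)"
    unfolding sum_fun_eval by (intro sum.cong refl) (simp add: uvec_def)
  also have "\<dots> = x j" using assms by (simp add: Edim_def)
  finally show "(\<Sum>i<d. fscale (x i) (uvec i)) j = x j" .
qed

lemma span_uvec: "fvec.span (uvec ` {..<d}) = Edim d"
proof
  show "fvec.span (uvec ` {..<d}) \<subseteq> Edim d"
    by (rule fvec.span_minimal) (auto simp: subspace_Edim uvec_Edim)
  show "Edim d \<subseteq> fvec.span (uvec ` {..<d})"
  proof
    fix x assume "x \<in> Edim d"
    moreover have "(\<Sum>i<d. fscale (x i) (uvec i)) \<in> fvec.span (uvec ` {..<d})"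
      by (auto intro!: fvec.span_sum fvec.span_scale intro: fvec.span_base)
    ultimately show "x \<in> fvec.span (uvec ` {..<d})"
      using Edim_sum_uvec by metis
  qed
qed

lemma independent_Edim_finite: "fvec.independent B \<Longrightarrow> B \<subseteq> Edim d \<Longrightarrow> finite B"
  using fvec.independent_span_bound[of "uvec ` {..<d}" B] by (auto simp: span_uvec)

lemma dim_Edim_le: "V \<subseteq> Edim d \<Longrightarrow> fvec.dim V \<le> d"
  using fvec.dim_le_card[of V "uvec ` {..<d}"] card_image_le[of "{..<d}" uvec]
  by (auto simp: span_uvec)

lemma enorm_L2: "enorm d x = L2_set x {..<d}"
  by (simp add: enorm_def ip_def L2_set_def power2_eq_square)

lemma enorm_ge: "i < d \<Longrightarrow> \<bar>x i\<bar> \<le> enorm d x"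
  using member_le_L2_set[of "{..<d}" i "\<lambda>i. \<bar>x i\<bar>"] by (simp add: enorm_L2 L2_set_def)

text \<open>Dividing by d + 1 instead of d keeps the sum of d terms strictly below r, also for d =
  0.\<close>

lemma enorm_lt:
  assumes "\<And>i. i < d \<Longrightarrow> \<bar>x i\<bar> < r / (real d + 1)" "r > 0"
  shows "enorm d x < r"
proof -
  have "enorm d x \<le> (\<Sum>i<d. \<bar>x i\<bar>)"
    unfolding enorm_L2 by (rule L2_set_le_sum_abs)
  also have "\<dots> \<le> (\<Sum>i<d. r / (real d + 1))"
    by (rule sum_mono) (use assms in force)
  also have "\<dots> < r" using assms(2) by (simp add: field_simps)
  finally show ?thesis .
qed

lemma enorm_scale: "enorm d (fscale s x) = \<bar>s\<bar> * enorm d x"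
  by (simp add: enorm_def ip_simps real_sqrt_mult)

lemma enorm_pos: "x \<in> Edim d \<Longrightarrow> x \<noteq> 0 \<Longrightarrow> enorm d x > 0"
  by (simp add: enorm_def ip_self_pos)

text \<open>Equivalence of the Euclidean and the maximum norm: interior points can be tested with
  cubes, so later arguments work coordinate by coordinate.\<close>

lemma convex_body_iff:
  "convex_body d C \<longleftrightarrow> C \<subseteq> Edim d \<and> compact C \<and> convex_set C \<and>
     (\<exists>x\<in>C. \<exists>r>0. \<forall>y\<in>Edim d. (\<forall>i<d. \<bar>y i - x i\<bar> < r) \<longrightarrow> y \<in> C)"
proof -
  have "(\<exists>r>0. \<forall>y\<in>Edim d. enorm d (y - x) < r \<longrightarrow> y \<in> C) \<longleftrightarrow>
    (\<exists>r>0. \<forall>y\<in>Edim d. (\<forall>i<d. \<bar>y i - x i\<bar> < r) \<longrightarrow> y \<in> C)" (is "?L \<longleftrightarrow> ?R") for x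
  proof
    assume ?L
    then obtain r where r: "r > 0" "\<And>y. y \<in> Edim d \<Longrightarrow> enorm d (y - x) < r \<Longrightarrow> y \<in> C" by blast
    show ?R
    proof (intro exI[of _ "r / (real d + 1)"] conjI ballI impI)
      show "r / (real d + 1) > 0" using r by simp
      fix y assume "y \<in> Edim d" "\<forall>i<d. \<bar>y i - x i\<bar> < r / (real d + 1)"
      then show "y \<in> C" using r enorm_lt[of d "y - x" r] by auto
    qed
  next
    assume ?R
    then obtain r where r: "r > 0" "\<And>y. y \<in> Edim d \<Longrightarrow> (\<forall>i<d. \<bar>y i - x i\<bar> < r) \<Longrightarrow> y \<in> C" by blast
    show ?L
    proof (intro exI[of _ r] conjI ballI impI)
      fix y assume "y \<in> Edim d" "enorm d (y - x) < r"
      moreover from this have "\<bar>y i - x i\<bar> < r" if "i < d" for i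
        using enorm_ge[OF that, of "y - x"] by simp
      ultimately show "y \<in> C" using r(2) by blast
    qed (fact r)
  qed
  then show ?thesis unfolding convex_body_def by simp
qed

lemma convex_setD:
  "convex_set C \<Longrightarrow> x \<in> C \<Longrightarrow> y \<in> C \<Longrightarrow> 0 \<le> t \<Longrightarrow> t \<le> 1 \<Longrightarrow> fscale (1 - t) x + fscale t y \<in> C"
  by (auto simp: convex_set_def)

section \<open>Continuity and compactness in the product topology\<close>

lemma continuous_on_ip:
  assumes "continuous_on S f" "continuous_on S g"
  shows "continuous_on S (\<lambda>x. ip d (f x) (g x))"
  unfolding ip_def
  by (intro continuous_on_sum continuous_on_mult assms[THEN continuous_on_product_then_coordinatewise])

lemma continuous_on_fscale:
  assumes "continuous_on S f" "continuous_on S g"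
  shows "continuous_on S (\<lambda>x. fscale (f x) (g x))"
  unfolding fscale_def
  by (rule continuous_on_coordinatewise_then_product)
     (intro continuous_on_mult assms assms(2)[THEN continuous_on_product_then_coordinatewise])

lemma continuous_on_fun_add:
  fixes f g :: "'a::topological_space \<Rightarrow> nat \<Rightarrow> real"
  assumes "continuous_on S f" "continuous_on S g"
  shows "continuous_on S (\<lambda>x. f x + g x)"
  by (rule continuous_on_coordinatewise_then_product, unfold plus_fun_apply)
     (intro continuous_on_add assms[THEN continuous_on_product_then_coordinatewise])

lemma continuous_on_fun_diff:
  fixes f g :: "'a::topological_space \<Rightarrow> nat \<Rightarrow> real"
  assumes "continuous_on S f" "continuous_on S g"
  shows "continuous_on S (\<lambda>x. f x - g x)"
  by (rule continuous_on_coordinatewise_then_product, unfold minus_apply)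
     (intro continuous_on_diff assms[THEN continuous_on_product_then_coordinatewise])

lemmas continuous_on_vec = continuous_on_ip continuous_on_fscale continuous_on_fun_add
  continuous_on_fun_diff continuous_on_const continuous_on_id continuous_on_fst continuous_on_snd

text \<open>Tychonoff's theorem. The index type is arbitrary because boxes are needed both for
  points and for coefficient functions of linear combinations.\<close>

lemma compact_fun_box:
  fixes l u :: "'a \<Rightarrow> real"
  shows "compact {f. \<forall>i. f i \<in> {l i..u i}}"
proof -
  have "compactin (product_topology (\<lambda>i. euclidean) UNIV) (Pi\<^sub>E UNIV (\<lambda>i. {l i..u i}))"
    by (auto simp: compactin_PiE)
  moreover have "Pi\<^sub>E UNIV (\<lambda>i. {l i..u i}) = {f. \<forall>i. f i \<in> {l i..u i}}"
    by (auto simp: PiE_UNIV_domain)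
  ultimately show ?thesis by (simp add: euclidean_product_topology)
qed

lemma compact_Edim_box: "compact {x \<in> Edim d. \<forall>i<d. \<bar>x i\<bar> \<le> R}"
proof -
  have "{x \<in> Edim d. \<forall>i<d. \<bar>x i\<bar> \<le> R} =
      {f. \<forall>i. f i \<in> {(if i < d then -R else 0)..(if i < d then R else 0)}}"
    by (force simp: Edim_def abs_le_iff not_less split: if_splits)
  then show ?thesis by (simp only: compact_fun_box)
qed

lemma compact_bounded_coord:
  fixes C :: "(nat \<Rightarrow> real) set"
  assumes "compact C"
  shows "\<exists>R>0. \<forall>x\<in>C. \<forall>i<d. \<bar>x i\<bar> \<le> R"
proof -
  have "\<exists>R>0. \<forall>x\<in>C. \<bar>x i\<bar> \<le> R" for i
  proof -
    have "compact ((\<lambda>x. x i) ` C)"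
      by (intro compact_continuous_image assms continuous_on_id[THEN continuous_on_product_then_coordinatewise])
    then have "bounded ((\<lambda>x. x i) ` C)" by (rule compact_imp_bounded)
    then show ?thesis unfolding bounded_pos by auto
  qed
  then obtain R where R: "\<And>i. R i > 0" "\<And>i x. x \<in> C \<Longrightarrow> \<bar>x i\<bar> \<le> R i" by metis
  show ?thesis
  proof (intro exI[of _ "1 + (\<Sum>i<d. R i)"] conjI ballI allI impI)
    show "0 < 1 + (\<Sum>i<d. R i)" using R(1) by (simp add: sum_nonneg add_pos_nonneg less_imp_le)
    fix x i assume "x \<in> C" "i < d"
    then have "R i \<le> (\<Sum>i<d. R i)" using R(1) by (intro member_le_sum) (auto intro: less_imp_le)
    then show "\<bar>x i\<bar> \<le> 1 + (\<Sum>i<d. R i)" using R(2)[OF \<open>x \<in> C\<close>, of i] by linarith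
  qed
qed

text \<open>The Minkowski combination (1 - e) C + e P is the shrunken body of the reducedness
  argument; e < 1 preserves an interior point.\<close>

lemma convex_mix_body:
  assumes C: "convex_body d C" and P: "compact P" "convex_set P" "P \<subseteq> C" "P \<noteq> {}"
    and e: "0 \<le> e" "e < 1"
  defines "C' \<equiv> {fscale (1 - e) x + fscale e p | x p. x \<in> C \<and> p \<in> P}"
  shows "convex_body d C'" "C' \<subseteq> C"
proof -
  have cvC: "convex_set C" and CE: "C \<subseteq> Edim d" and cC: "compact C"
    using C by (auto simp: convex_body_def)
  obtain x0 r where x0: "x0 \<in> C" "r > 0"
    and b: "\<And>y. y \<in> Edim d \<Longrightarrow> \<forall>i<d. \<bar>y i - x0 i\<bar> < r \<Longrightarrow> y \<in> C"
    using C unfolding convex_body_iff by blast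
  obtain p0 where p0: "p0 \<in> P" using P by blast
  show sub: "C' \<subseteq> C"
    using convex_setD[OF cvC] P(3) e by (auto simp: C'_def)
  show "convex_body d C'"
    unfolding convex_body_iff
  proof (intro conjI)
    show "C' \<subseteq> Edim d" using sub CE by auto
    have "C' = (\<lambda>z. fscale (1 - e) (fst z) + fscale e (snd z)) ` (C \<times> P)"
      unfolding C'_def image_def by force
    moreover have "compact \<dots>"
      by (intro compact_continuous_image compact_Times cC P continuous_on_vec)
    ultimately show "compact C'" by simp
    show "convex_set C'"
      unfolding convex_set_def
    proof (intro ballI allI impI)
      fix u v t assume "u \<in> C'" "v \<in> C'" and t: "0 \<le> t \<and> (t::real) \<le> 1"
      then obtain x p y q where u: "u = fscale (1 - e) x + fscale e p" "x \<in> C" "p \<in> P"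
        and v: "v = fscale (1 - e) y + fscale e q" "y \<in> C" "q \<in> P"
        by (auto simp: C'_def)
      have "fscale (1 - t) u + fscale t v =
          fscale (1 - e) (fscale (1 - t) x + fscale t y) + fscale e (fscale (1 - t) p + fscale t q)"
        by (auto simp: u v fun_eq_iff algebra_simps)
      moreover have "fscale (1 - t) x + fscale t y \<in> C" "fscale (1 - t) p + fscale t q \<in> P"
        using convex_setD[OF cvC] convex_setD[OF P(2)] u v t by auto
      ultimately show "fscale (1 - t) u + fscale t v \<in> C'" unfolding C'_def by blast
    qed
    show "\<exists>x\<in>C'. \<exists>r>0. \<forall>y\<in>Edim d. (\<forall>i<d. \<bar>y i - x i\<bar> < r) \<longrightarrow> y \<in> C'"
    proof (intro bexI[of _ "fscale (1 - e) x0 + fscale e p0"] exI[of _ "(1 - e) * r"] conjI ballI impI)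
      show "fscale (1 - e) x0 + fscale e p0 \<in> C'" using x0 p0 by (auto simp: C'_def)
      show "(1 - e) * r > 0" using e x0 by simp
      fix y assume y: "y \<in> Edim d" and "\<forall>i<d. \<bar>y i - (fscale (1 - e) x0 + fscale e p0) i\<bar> < (1 - e) * r"
      then have near: "\<bar>(y i - e * p0 i) - (1 - e) * x0 i\<bar> < (1 - e) * r" if "i < d" for i
        using that by (simp add: algebra_simps)
      \<comment> \<open>Solving y = (1 - e) z + e p0 for z turns the cube of radius (1 - e) r around
        the mixed centre into the cube of radius r around x0.\<close>
      define z where "z = fscale (1 / (1 - e)) (y - fscale e p0)"
      have "p0 \<in> Edim d" using p0 P CE by auto
      then have zE: "z \<in> Edim d" using y by (simp add: z_def Edim_scale Edim_diff)
      have "\<bar>z i - x0 i\<bar> < r" if "i < d" for i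
      proof -
        have "z i - x0 i = ((y i - e * p0 i) - (1 - e) * x0 i) / (1 - e)"
          using e by (simp add: z_def diff_divide_distrib)
        then have "\<bar>z i - x0 i\<bar> = \<bar>(y i - e * p0 i) - (1 - e) * x0 i\<bar> / (1 - e)"
          using e by (simp only: abs_divide)
        then show ?thesis using near[OF that] e by (simp only: pos_divide_less_eq mult.commute)
      qed
      then have "z \<in> C" using b zE by blast
      moreover have "y = fscale (1 - e) z + fscale e p0"
        using e by (simp add: z_def)
      ultimately show "y \<in> C'" using p0 unfolding C'_def by blast
    qed
  qed
qed

section \<open>Lattices and their duals\<close>

lemma subgroup_fscale_int:
  assumes "0 \<in> G" and diff: "\<And>x y. x \<in> G \<Longrightarrow> y \<in> G \<Longrightarrow> x - y \<in> G" and "x \<in> G"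
  shows "fscale (of_int k) x \<in> G"
proof -
  have neg: "- y \<in> G" if "y \<in> G" for y
    using diff[OF assms(1) that] by simp
  have nat: "fscale (of_nat n) x \<in> G" for n
  proof (induction n)
    case (Suc n)
    have "fscale (of_nat (Suc n)) x = fscale (of_nat n) x - (- x)"
      by (simp add: fun_eq_iff algebra_simps)
    then show ?case by (simp only: diff[OF Suc neg[OF assms(3)]])
  qed (simp only: of_nat_0 fscale_zero_left assms(1))
  show ?thesis
  proof (cases k rule: int_cases2)
    case (nonneg n) then show ?thesis using nat[of n] by simp
  next
    case (nonpos n)
    then have "fscale (of_int k) x = - fscale (of_nat n) x" by (simp add: fun_eq_iff)
    then show ?thesis using neg[OF nat[of n]] by simp
  qed
qed

lemma subgroup_add:
  fixes G :: "(nat \<Rightarrow> real) set"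
  assumes "0 \<in> G" "\<And>x y. x \<in> G \<Longrightarrow> y \<in> G \<Longrightarrow> x - y \<in> G" "x \<in> G" "y \<in> G"
  shows "x + y \<in> G"
proof -
  have "x - (0 - y) \<in> G" using assms by blast
  then show ?thesis by simp
qed

text \<open>For a discrete group G of rank k this is the bound |G/3G| \<le> 3^k. With a fundamental
  domain Q of the sublattice spanned by a basis B \<subseteq> D, the map (s, q) \<mapsto> s + 3q embeds
  S \<times> Q into G/3\<int>B, which has |Q| 3^k elements.\<close>

lemma card_incongruent_mod_3_le:
  assumes GE: "G \<subseteq> Edim d" and G0: "0 \<in> G"
    and diff: "\<And>x y. x \<in> G \<Longrightarrow> y \<in> G \<Longrightarrow> x - y \<in> G"
    and fin: "\<And>R. finite {g \<in> G. \<forall>i<d. \<bar>g i\<bar> \<le> R}"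
    and DG: "D \<subseteq> G" and S: "S \<subseteq> G" "S \<subseteq> fvec.span D" "finite S"
    and inc: "\<And>s t g. s \<in> S \<Longrightarrow> t \<in> S \<Longrightarrow> g \<in> G \<Longrightarrow> s - t = fscale 3 g \<Longrightarrow> s = t"
  shows "card S \<le> 3 ^ fvec.dim D"
proof -
  obtain B where B: "B \<subseteq> D" "fvec.independent B" "D \<subseteq> fvec.span B" "card B = fvec.dim D"
    using fvec.basis_exists by blast
  have finB: "finite B" using independent_Edim_finite[OF B(2)] B DG GE by blast
  have BG: "B \<subseteq> G" using B DG by blast
  have spanDB: "fvec.span D \<subseteq> fvec.span B"
    using B(3) by (rule fvec.span_minimal) (rule fvec.subspace_span)
  have add: "x + y \<in> G" if "x \<in> G" "y \<in> G" for x y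
    using G0 diff that by (rule subgroup_add)
  have scale_int: "fscale (of_int k) x \<in> G" if "x \<in> G" for k x
    using G0 diff that by (rule subgroup_fscale_int)
  define rep where "rep = fvec.representation B"
  define comb where "comb k = (\<Sum>b\<in>B. fscale (real_of_int (k b)) b)" for k
  have combG: "comb k \<in> G" for k
  proof -
    have "(\<Sum>b\<in>F. fscale (real_of_int (k b)) b) \<in> G" if "F \<subseteq> G" for F
      using that
    proof (induction F rule: infinite_finite_induct)
      case (insert x F)
      have "fscale (real_of_int (k x)) x \<in> G"
        using insert.prems by (intro scale_int) simp
      moreover have "(\<Sum>b\<in>F. fscale (real_of_int (k b)) b) \<in> G"
        using insert.IH insert.prems by blast
      ultimately show ?case unfolding sum.insert[OF insert.hyps] by (rule add)
    qed (use G0 in \<open>simp_all only: sum.infinite sum.empty not_False_eq_True\<close>)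
    then show ?thesis unfolding comb_def using BG .
  qed
  have comb_span: "comb k \<in> fvec.span B" for k
    unfolding comb_def by (intro fvec.span_sum fvec.span_scale) (rule fvec.span_base)
  have rep_comb: "rep (comb k) b = of_int (k b)" if "b \<in> B" for k b
  proof -
    have "rep (comb k) b = (\<Sum>x\<in>B. rep (fscale (real_of_int (k x)) x) b)"
      unfolding rep_def comb_def
      by (subst fvec.representation_sum[OF B(2)]) (auto intro: fvec.span_scale fvec.span_base)
    also have "\<dots> = (\<Sum>x\<in>B. if b = x then of_int (k x) else 0)"
    proof (intro sum.cong refl)
      fix x assume x: "x \<in> B"
      show "rep (fscale (real_of_int (k x)) x) b = (if b = x then of_int (k x) else 0)"
        unfolding rep_def fvec.representation_scale[OF B(2) fvec.span_base[OF x]]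
          fvec.representation_basis[OF B(2) x] by simp
    qed
    also have "\<dots> = of_int (k b)" using finB that by simp
    finally show ?thesis .
  qed
  \<comment> \<open>B need not generate all of G in its span, so no lattice basis has to be
    constructed; Q represents the cosets, and its cardinality cancels at the end.\<close>
  define Q where "Q = {g \<in> G \<inter> fvec.span B. \<forall>b\<in>B. 0 \<le> rep g b \<and> rep g b < 1}"
  have finQ: "finite Q"
  proof (rule finite_subset[OF _ fin])
    show "Q \<subseteq> {g \<in> G. \<forall>i<d. \<bar>g i\<bar> \<le> (\<Sum>j<d. \<Sum>b\<in>B. \<bar>b j\<bar>)}"
    proof (intro subsetI CollectI conjI allI impI)
      fix g i assume g: "g \<in> Q" and "i < d"
      have "g = (\<Sum>b\<in>B. fscale (rep g b) b)"
        using fvec.sum_representation_eq[OF B(2) _ finB order_refl] g by (simp add: rep_def Q_def)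
      then have "g i = (\<Sum>b\<in>B. fscale (rep g b) b) i" by simp
      also have "\<dots> = (\<Sum>b\<in>B. rep g b * b i)" unfolding sum_fun_eval by simp
      finally have "\<bar>g i\<bar> \<le> (\<Sum>b\<in>B. \<bar>rep g b * b i\<bar>)" by (simp only: sum_abs)
      also have "\<dots> \<le> (\<Sum>b\<in>B. \<bar>b i\<bar>)"
      proof (rule sum_mono)
        fix b assume "b \<in> B"
        then have "\<bar>rep g b\<bar> \<le> 1" using g by (auto simp: Q_def)
        then have "\<bar>rep g b\<bar> * \<bar>b i\<bar> \<le> 1 * \<bar>b i\<bar>" by (rule mult_right_mono) simp
        then show "\<bar>rep g b * b i\<bar> \<le> \<bar>b i\<bar>" by (simp add: abs_mult)
      qed
      also have "\<dots> \<le> (\<Sum>j<d. \<Sum>b\<in>B. \<bar>b j\<bar>)"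
        using \<open>i < d\<close> by (intro member_le_sum[of i _ "\<lambda>i. \<Sum>b\<in>B. \<bar>b i\<bar>"]) (auto intro: sum_nonneg)
      finally show "\<bar>g i\<bar> \<le> (\<Sum>j<d. \<Sum>b\<in>B. \<bar>b j\<bar>)" .
    qed (auto simp: Q_def)
  qed
  have Q0: "0 \<in> Q"
    using G0 by (auto simp: Q_def rep_def fvec.representation_zero fvec.span_zero)
  define fl where "fl g b = \<lfloor>rep g b\<rfloor>" for g b
  define P where "P = B \<rightarrow>\<^sub>E {0..<3::int}"
  \<comment> \<open>The first component reduces g into Q by removing the integer parts of its
    coordinates, the second keeps these integer parts modulo 3. Equal images make s and s' congruent
    modulo 3, hence equal, and then q and q' differ by an integer combination of B.\<close>
  define \<Phi> where "\<Phi> = (\<lambda>(s, q). let g = s + fscale 3 q in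
      (g - comb (fl g), restrict (\<lambda>b. fl g b mod 3) B))"
  have in_span: "s + fscale 3 q \<in> fvec.span B" and in_G: "s + fscale 3 q \<in> G"
    if "s \<in> S" "q \<in> Q" for s q
  proof -
    show "s + fscale 3 q \<in> fvec.span B"
      using that S spanDB by (intro fvec.span_add fvec.span_scale) (auto simp: Q_def)
    have "fscale (of_int 3) q \<in> G" using that by (intro scale_int) (auto simp: Q_def)
    then show "s + fscale 3 q \<in> G" using that S by (intro add) auto
  qed
  have "\<Phi> (s, q) \<in> Q \<times> P" if sq: "s \<in> S" "q \<in> Q" for s q
  proof -
    define g where "g = s + fscale 3 q"
    have g: "g \<in> G" "g \<in> fvec.span B" using in_span[OF sq] in_G[OF sq] by (auto simp: g_def)
    have "rep (g - comb (fl g)) b = rep g b - of_int (fl g b)" if "b \<in> B" for b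
      using rep_comb[OF that, of "fl g"] fvec.representation_diff[OF B(2) comb_span g(2)]
      by (simp add: rep_def)
    moreover have "x - of_int \<lfloor>x\<rfloor> < 1" for x :: real by linarith
    ultimately have "g - comb (fl g) \<in> Q"
      unfolding Q_def using g combG comb_span
      by (auto intro: diff fvec.span_diff simp: fl_def)
    moreover have "restrict (\<lambda>b. fl g b mod 3) B \<in> P" by (auto simp: P_def)
    ultimately show ?thesis by (simp add: \<Phi>_def g_def Let_def)
  qed
  then have "\<Phi> ` (S \<times> Q) \<subseteq> Q \<times> P" by blast
  moreover have "inj_on \<Phi> (S \<times> Q)"
  proof (rule inj_onI, clarify)
    fix s q s' q' assume sq: "s \<in> S" "q \<in> Q" "s' \<in> S" "q' \<in> Q" and eq: "\<Phi> (s, q) = \<Phi> (s', q')"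
    define g where "g = s + fscale 3 q"
    define g' where "g' = s' + fscale 3 q'"
    have e1: "g - comb (fl g) = g' - comb (fl g')"
      and e2: "restrict (\<lambda>b. fl g b mod 3) B = restrict (\<lambda>b. fl g' b mod 3) B"
      using eq by (simp_all add: \<Phi>_def g_def g'_def Let_def)
    define m where "m b = (fl g b - fl g' b) div 3" for b
    have m: "fl g b = fl g' b + 3 * m b" if "b \<in> B" for b
    proof -
      have "fl g b mod 3 = fl g' b mod 3" using fun_cong[OF e2, of b] that by simp
      then show ?thesis unfolding m_def by presburger
    qed
    have "comb (fl g) = (\<Sum>b\<in>B. fscale (of_int (fl g' b)) b + fscale 3 (fscale (of_int (m b)) b))"
      unfolding comb_def by (intro sum.cong refl) (simp add: m fun_eq_iff algebra_simps)
    also have "\<dots> = comb (fl g') + fscale 3 (comb m)"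
      by (simp only: sum.distrib comb_def fvec.scale_sum_right)
    finally have "g = g' + fscale 3 (comb m)" using e1 by (simp add: algebra_simps)
    then have e: "s - s' = fscale 3 (q' - q + comb m)"
      by (simp add: g_def g'_def fun_eq_iff algebra_simps)
    have qG: "q \<in> G" "q' \<in> G" and qs: "q \<in> fvec.span B" "q' \<in> fvec.span B"
      using sq by (auto simp: Q_def)
    have ss: "s = s'" using inc[OF sq(1) sq(3) _ e] add[OF diff[OF qG(2,1)] combG] by blast
    have "q' - q + comb m = 0"
      using e unfolding ss diff_self by (metis fscale_eq_0_iff zero_neq_numeral)
    then have qq: "q - q' = comb m" by (simp add: algebra_simps)
    \<comment> \<open>Coordinates of points of Q lie in [0, 1), so an integral difference
      vanishes.\<close>
    have "m b = 0" if "b \<in> B" for b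
    proof -
      have "rep q b - rep q' b = of_int (m b)"
        using rep_comb[OF that, of m] fvec.representation_diff[OF B(2) qs(2,1)] qq by (simp add: rep_def)
      moreover have "\<bar>rep q b - rep q' b\<bar> < 1" using sq that by (force simp: Q_def)
      ultimately show ?thesis by linarith
    qed
    then have "comb m = 0" by (simp add: comb_def)
    then show "s = s' \<and> q = q'" using ss qq by simp
  qed
  moreover have "finite (Q \<times> P)" using finQ finB by (auto simp: P_def intro: finite_PiE)
  ultimately have "card (S \<times> Q) \<le> card (Q \<times> P)" by (metis card_inj_on_le)
  moreover have "card P = 3 ^ card B" using finB by (simp add: P_def card_PiE)
  ultimately have "card Q * card S \<le> card Q * 3 ^ card B" by (simp add: card_cartesian_product mult.commute)
  moreover have "card Q > 0" using finQ Q0 by (auto simp: card_gt_0_iff)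
  ultimately show ?thesis using B(4) by simp
qed

text \<open>A dual vector is determined by its integer products with the finitely many vectors of
  \<open>L\<close> that express the unit vectors, and a bound on its coordinates bounds these
  integers.\<close>

lemma finite_dual_lattice_bounded:
  assumes L: "fvec.span L = Edim d"
  shows "finite {y \<in> dual_lattice d L. \<forall>i<d. \<bar>y i\<bar> \<le> R}"
proof -
  have "\<exists>t r. finite t \<and> t \<subseteq> L \<and> uvec i = (\<Sum>a\<in>t. fscale (r a) a)" if "i < d" for i
    using uvec_Edim[OF that] unfolding L[symmetric] fvec.span_explicit by blast
  then obtain t r where t: "\<And>i. i < d \<Longrightarrow> finite (t i)" "\<And>i. i < d \<Longrightarrow> t i \<subseteq> L"
      "\<And>i. i < d \<Longrightarrow> uvec i = (\<Sum>a\<in>t i. fscale (r i a) a)"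
    by metis
  define F where "F = (\<Union>i<d. t i)"
  have F: "finite F" "F \<subseteq> L" using t by (auto simp: F_def)
  let ?Y = "{y \<in> dual_lattice d L. \<forall>i<d. \<bar>y i\<bar> \<le> R}"
  let ?f = "\<lambda>y. restrict (\<lambda>l. ip d l y) F"
  have "?f ` ?Y \<subseteq> (\<Pi>\<^sub>E l\<in>F. {k \<in> \<int>. \<bar>k\<bar> \<le> (\<Sum>i<d. \<bar>l i\<bar> * R)})"
  proof clarify
    fix y assume y: "y \<in> dual_lattice d L" "\<forall>i<d. \<bar>y i\<bar> \<le> R"
    have "\<bar>ip d l y\<bar> \<le> (\<Sum>i<d. \<bar>l i\<bar> * R)" for l
    proof -
      have "\<bar>ip d l y\<bar> \<le> (\<Sum>i<d. \<bar>l i * y i\<bar>)" unfolding ip_def by (rule sum_abs)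
      also have "\<dots> \<le> (\<Sum>i<d. \<bar>l i\<bar> * R)"
        by (intro sum_mono) (use y(2) in \<open>auto simp: abs_mult intro!: mult_left_mono\<close>)
      finally show ?thesis .
    qed
    then show "?f y \<in> (\<Pi>\<^sub>E l\<in>F. {k \<in> \<int>. \<bar>k\<bar> \<le> (\<Sum>i<d. \<bar>l i\<bar> * R)})"
      using F(2) y(1) by (auto simp: dual_lattice_def)
  qed
  moreover have "finite (\<Pi>\<^sub>E l\<in>F. {k \<in> \<int>. \<bar>k\<bar> \<le> (\<Sum>i<d. \<bar>l i\<bar> * R)})"
    using F by (intro finite_PiE finite_abs_int_segment)
  ultimately have "finite (?f ` ?Y)" by (rule finite_subset)
  moreover have "inj_on ?f ?Y"
  proof (rule inj_onI)
    fix y z assume y: "y \<in> ?Y" and z: "z \<in> ?Y" and eq: "?f y = ?f z"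
    have F_eq: "ip d l y = ip d l z" if "l \<in> F" for l using fun_cong[OF eq, of l] that by simp
    have "y i = z i" if "i < d" for i
    proof -
      have "ip d (uvec i) y = ip d (uvec i) z"
        unfolding t(3)[OF that] ip_sum_left ip_simps
        using F_eq that by (intro sum.cong) (auto simp: F_def)
      then show ?thesis using ip_uvec[OF that] by (simp add: ip_commute)
    qed
    then show "y = z" using y z by (intro Edim_eqI[of y d]) (auto simp: dual_lattice_def)
  qed
  ultimately show ?thesis by (rule finite_imageD)
qed

lemma latticeD:
  assumes "lattice d L"
  shows "L \<subseteq> Edim d" "0 \<in> L" "\<And>x y. x \<in> L \<Longrightarrow> y \<in> L \<Longrightarrow> x - y \<in> L" "fvec.span L = Edim d"
  using assms by (auto simp: lattice_def)

text \<open>Discreteness at 0 gives a cube of half-width \<epsilon> free of other lattice vectors.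
  Lattice vectors in the same cell of the \<epsilon>-grid differ by a vector of that cube, so each
  cell holds at most one.\<close>

lemma finite_lattice_bounded:
  assumes "lattice d L"
  shows "finite {g \<in> L. \<forall>i<d. \<bar>g i\<bar> \<le> R}"
proof -
  note L = latticeD[OF assms]
  have "\<not> 0 islimpt L" using assms by (auto simp: lattice_def)
  then obtain T where T: "0 \<in> T" "open T" "\<And>y. y \<in> L \<Longrightarrow> y \<in> T \<Longrightarrow> y = 0"
    unfolding islimpt_def by auto
  then obtain X where X: "(0::nat \<Rightarrow> real) \<in> Pi\<^sub>E UNIV X" "\<And>i. open (X i)" "Pi\<^sub>E UNIV X \<subseteq> T"
    using product_topology_open_contains_basis[of "\<lambda>i. euclidean" UNIV T 0]
    unfolding open_fun_def by auto
  have "\<exists>e>0. \<forall>t. \<bar>t\<bar> < e \<longrightarrow> t \<in> X i" for i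
  proof -
    have "0 \<in> X i" using X(1) by (auto dest: PiE_mem[where x = i])
    then obtain e where "e > 0" "ball 0 e \<subseteq> X i" using X(2) openE by blast
    then show ?thesis by (intro exI[of _ e]) (auto simp: dist_norm subset_iff)
  qed
  then obtain e where e: "\<And>i. e i > 0" "\<And>i t. \<bar>t\<bar> < e i \<Longrightarrow> t \<in> X i" by metis
  \<comment> \<open>Only the first d factors of the open box matter, since lattice vectors vanish
    elsewhere; the inserted 1 keeps \<open>Min\<close> meaningful for d = 0.\<close>
  define \<epsilon> where "\<epsilon> = Min (insert 1 (e ` {..<d}))"
  have eps: "\<epsilon> > 0" "\<And>i. i < d \<Longrightarrow> \<epsilon> \<le> e i" using e by (auto simp: \<epsilon>_def)
  have small: "g = 0" if "g \<in> L" "\<And>i. i < d \<Longrightarrow> \<bar>g i\<bar> < \<epsilon>" for g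
  proof -
    have "g i \<in> X i" for i
    proof (cases "i < d")
      case True then show ?thesis using e(2)[of "g i" i] that(2)[of i] eps(2)[of i] by linarith
    next
      case False
      then have "g i = 0" using that L by (auto simp: Edim_def)
      then show ?thesis using e by simp
    qed
    then have "g \<in> Pi\<^sub>E UNIV X" by (simp add: PiE_UNIV_domain)
    then show ?thesis using X(3) T(3) that by blast
  qed
  let ?S = "{g \<in> L. \<forall>i<d. \<bar>g i\<bar> \<le> R}"
  let ?f = "\<lambda>g. restrict (\<lambda>i. \<lfloor>g i / \<epsilon>\<rfloor>) {..<d}"
  have "?f ` ?S \<subseteq> (\<Pi>\<^sub>E i\<in>{..<d}. {\<lfloor>- R / \<epsilon>\<rfloor>..\<lfloor>R / \<epsilon>\<rfloor>})"
  proof clarify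
    fix g assume "\<forall>i<d. \<bar>g i\<bar> \<le> R"
    then have "- R \<le> g i" "g i \<le> R" if "i < d" for i
      using that by (auto simp: abs_le_iff minus_le_iff)
    then have "- R / \<epsilon> \<le> g i / \<epsilon>" "g i / \<epsilon> \<le> R / \<epsilon>" if "i < d" for i
      using that eps(1) divide_right_mono less_imp_le by blast+
    then show "?f g \<in> (\<Pi>\<^sub>E i\<in>{..<d}. {\<lfloor>- R / \<epsilon>\<rfloor>..\<lfloor>R / \<epsilon>\<rfloor>})"
      by (simp only: restrict_PiE_iff lessThan_iff atLeastAtMost_iff) (blast intro: floor_mono)
  qed
  then have "finite (?f ` ?S)" by (rule finite_subset) (auto intro: finite_PiE)
  moreover have "inj_on ?f ?S"
  proof (rule inj_onI)
    fix g h assume g: "g \<in> ?S" and h: "h \<in> ?S" and eq: "?f g = ?f h"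
    have "g - h = 0"
    proof (rule small)
      show "g - h \<in> L" using g h L by auto
      fix i assume "i < d"
      then have "\<lfloor>g i / \<epsilon>\<rfloor> = \<lfloor>h i / \<epsilon>\<rfloor>" using fun_cong[OF eq, of i] by simp
      then have "\<bar>g i / \<epsilon> - h i / \<epsilon>\<bar> < 1" by linarith
      then have "\<bar>(g i - h i) / \<epsilon>\<bar> < 1" by (simp add: diff_divide_distrib)
      then show "\<bar>(g - h) i\<bar> < \<epsilon>" using eps(1) by (simp add: abs_divide pos_divide_less_eq)
    qed
    then show "g = h" by simp
  qed
  ultimately show ?thesis by (rule finite_imageD)
qed

section \<open>Homogeneous linear systems and orthogonal vectors\<close>

lemma linear_system_nontrivial_solution:
  fixes a :: "'a \<Rightarrow> 'b \<Rightarrow> real"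
  assumes "finite F" "finite I" "card F < card I"
  shows "\<exists>x. (\<exists>i\<in>I. x i \<noteq> 0) \<and> (\<forall>j\<in>F. (\<Sum>i\<in>I. a j i * x i) = 0)"
  using assms
proof (induction F arbitrary: I a rule: finite_induct)
  case empty
  then have "I \<noteq> {}" by auto
  then show ?case by (intro exI[of _ "\<lambda>_. 1"]) auto
next
  case (insert j F)
  show ?case
  proof (cases "\<forall>i\<in>I. a j i = 0")
    case True
    then show ?thesis using insert.IH[of I a] insert by auto
  next
    case False
    then obtain p where p: "p \<in> I" "a j p \<noteq> 0" by blast
    \<comment> \<open>Gaussian elimination: equation j is solved for the unknown p and substituted
      into the other equations.\<close>
    define a' where "a' l i = a l i - a l p * a j i / a j p" for l i
    have "card F < card (I - {p})" using insert p by simp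
    then obtain x where x: "\<exists>i\<in>I - {p}. x i \<noteq> 0"
      and sol: "\<And>l. l \<in> F \<Longrightarrow> (\<Sum>i\<in>I - {p}. a' l i * x i) = 0"
      using insert.IH[of "I - {p}" a'] insert.prems by auto
    define s where "s = (\<Sum>i\<in>I - {p}. a j i * x i)"
    define y where "y = x(p := - s / a j p)"
    have split: "(\<Sum>i\<in>I. a l i * y i) = - a l p * s / a j p + (\<Sum>i\<in>I - {p}. a l i * x i)" for l
    proof -
      have "(\<Sum>i\<in>I. a l i * y i) = a l p * y p + (\<Sum>i\<in>I - {p}. a l i * y i)"
        using insert.prems(1) p(1) by (rule sum.remove)
      also have "(\<Sum>i\<in>I - {p}. a l i * y i) = (\<Sum>i\<in>I - {p}. a l i * x i)"
        by (intro sum.cong) (auto simp: y_def)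
      finally show ?thesis by (simp add: y_def)
    qed
    have "(\<Sum>i\<in>I. a l i * y i) = 0" if "l \<in> F" for l
    proof -
      have "(\<Sum>i\<in>I - {p}. a' l i * x i) = (\<Sum>i\<in>I - {p}. a l i * x i) - a l p / a j p * s"
        by (simp add: a'_def s_def left_diff_distrib sum_subtractf sum_distrib_left algebra_simps)
      then show ?thesis using split[of l] sol[OF that] by simp
    qed
    moreover have "(\<Sum>i\<in>I. a j i * y i) = 0" using split[of j] p(2) by (simp add: s_def)
    moreover have "\<exists>i\<in>I. y i \<noteq> 0" using x by (auto simp: y_def)
    ultimately show ?thesis by (intro exI[of _ y]) auto
  qed
qed

lemma exists_orthogonal:
  assumes "finite F" "card F < d"
  shows "\<exists>f\<in>Edim d. f \<noteq> 0 \<and> (\<forall>p\<in>F. ip d f p = 0)"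
proof -
  obtain x where x: "\<exists>i\<in>{..<d}. x i \<noteq> 0" "\<forall>j\<in>F. (\<Sum>i<d. j i * x i) = 0"
    using linear_system_nontrivial_solution[of F "{..<d}" "\<lambda>j i. j i"] assms by auto
  define f where "f i = (if i < d then x i else 0)" for i
  have "ip d f p = (\<Sum>i<d. p i * x i)" for p
    unfolding ip_def by (intro sum.cong) (auto simp: f_def)
  moreover have "f \<in> Edim d" by (auto simp: f_def Edim_def)
  moreover have "f \<noteq> 0" using x(1) by (auto simp: f_def fun_eq_iff)
  ultimately show ?thesis using x(2) by auto
qed

section \<open>Reduced bodies\<close>

lemma convex_body_cubeE:
  assumes "convex_body d C"
  obtains x r where "x \<in> C" "r > 0"
    "\<And>y. y \<in> Edim d \<Longrightarrow> (\<And>i. i < d \<Longrightarrow> \<bar>y i - x i\<bar> < r) \<Longrightarrow> y \<in> C"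
  using assms unfolding convex_body_iff by blast

lemma convex_bodyD:
  assumes "convex_body d C"
  shows "C \<subseteq> Edim d" "compact C" "convex_set C" "C \<noteq> {}"
  using assms by (auto simp: convex_body_def)

lemma
  assumes "compact C" "C \<noteq> {}"
  shows width_dir_attained: "\<exists>a\<in>C. \<exists>b\<in>C. width_dir d C y = ip d y (a - b)"
    and width_dir_upper': "x \<in> C \<Longrightarrow> z \<in> C \<Longrightarrow> ip d y (x - z) \<le> width_dir d C y"
proof -
  define S where "S = {ip d y (a - b) | a b. a \<in> C \<and> b \<in> C}"
  have "S = (\<lambda>z. ip d y (fst z - snd z)) ` (C \<times> C)"
    unfolding S_def by force
  moreover have "compact \<dots>"
    by (intro compact_continuous_image compact_Times assms continuous_on_vec)
  ultimately have "compact S" by simp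
  moreover have "S \<noteq> {}" using assms(2) by (auto simp: S_def)
  ultimately obtain s where s: "s \<in> S" "\<And>t. t \<in> S \<Longrightarrow> t \<le> s"
    using compact_attains_sup[of S] by auto
  then have w: "width_dir d C y = s"
    unfolding width_dir_def S_def[symmetric] by (intro cSup_eq_maximum)
  show "\<exists>a\<in>C. \<exists>b\<in>C. width_dir d C y = ip d y (a - b)"
    using s(1) unfolding w S_def by blast
  show "ip d y (x - z) \<le> width_dir d C y" if "x \<in> C" "z \<in> C"
    unfolding w using that by (intro s(2)) (auto simp: S_def)
qed

lemma width_dir_upper:
  assumes "compact C" "x \<in> C" "z \<in> C"
  shows "ip d y (x - z) \<le> width_dir d C y"
  using assms by (intro width_dir_upper') auto

lemma width_dir_nonneg:
  assumes "compact C" "C \<noteq> {}" shows "0 \<le> width_dir d C y"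
proof -
  obtain x where "x \<in> C" using assms by blast
  then show ?thesis using width_dir_upper[OF assms(1), of x x d y] by (simp add: ip_simps)
qed

lemma width_dir_mono:
  assumes "compact C" "compact C'" "C' \<noteq> {}" "C' \<subseteq> C"
  shows "width_dir d C' y \<le> width_dir d C y"
proof -
  obtain a b where "a \<in> C'" "b \<in> C'" "width_dir d C' y = ip d y (a - b)"
    using width_dir_attained[OF assms(2,3), of d y] by blast
  then show ?thesis using width_dir_upper[OF assms(1), of a b d y] assms(4) by auto
qed

lemma width_dir_zero: "compact C \<Longrightarrow> C \<noteq> {} \<Longrightarrow> width_dir d C 0 = 0"
  using width_dir_attained[of C d 0] by (auto simp: ip_simps(7))

lemma width_dir_diff_le:
  assumes "compact C" "C \<noteq> {}"
  shows "width_dir d C (s - t) \<le> width_dir d C s + width_dir d C t"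
proof -
  obtain a b where ab: "a \<in> C" "b \<in> C" "width_dir d C (s - t) = ip d (s - t) (a - b)"
    using width_dir_attained[OF assms, of d "s - t"] by blast
  then have "width_dir d C (s - t) = ip d s (a - b) + ip d t (b - a)" by (simp add: ip_simps)
  then show ?thesis
    using width_dir_upper[OF assms(1) ab(1,2), of d s] width_dir_upper[OF assms(1) ab(2,1), of d t]
    by linarith
qed

lemma width_dir_scale_ge:
  assumes "compact C" "C \<noteq> {}"
  shows "c * width_dir d C g \<le> width_dir d C (fscale c g)"
proof -
  obtain a b where ab: "a \<in> C" "b \<in> C" "width_dir d C g = ip d g (a - b)"
    using width_dir_attained[OF assms, of d g] by blast
  have "c * width_dir d C g = ip d (fscale c g) (a - b)" by (simp only: ab(3) ip_simps right_diff_distrib)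
  then show ?thesis using width_dir_upper[OF assms(1) ab(1,2)] by simp
qed

text \<open>C contains a segment of length r parallel to every axis, so a bound on the width along y
  bounds all coordinates of y. This leaves only finitely many dual vectors of bounded width.\<close>

lemma width_dir_coord_le:
  assumes "convex_body d C"
  obtains r where "r > 0" "\<And>y i. i < d \<Longrightarrow> r * \<bar>y i\<bar> \<le> width_dir d C y"
proof -
  obtain x r where x: "x \<in> C" "r > 0"
    and cube: "\<And>y. y \<in> Edim d \<Longrightarrow> (\<And>i. i < d \<Longrightarrow> \<bar>y i - x i\<bar> < r) \<Longrightarrow> y \<in> C"
    using convex_body_cubeE[OF assms] by blast
  note C = convex_bodyD[OF assms]
  have "r * \<bar>y i\<bar> \<le> width_dir d C y" if "i < d" for y i
  proof -
    have mem: "x + fscale s (uvec i) \<in> C" if "\<bar>s\<bar> < r" for s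
      using that C x \<open>i < d\<close> by (intro cube) (auto intro!: Edim_add Edim_scale uvec_Edim simp: uvec_apply)
    define s where "s = r / 2 * sgn (y i)"
    have "\<bar>s\<bar> < r" "\<bar>- s\<bar> < r" using x by (auto simp: s_def abs_mult sgn_if)
    note width_dir_upper[OF C(2) mem[OF this(1)] mem[OF this(2)], of d y]
    also have "ip d y (x + fscale s (uvec i) - (x + fscale (- s) (uvec i))) = 2 * s * y i"
      by (simp only: ip_simps ip_uvec[OF that])
    also have "2 * s * y i = r * \<bar>y i\<bar>" by (simp add: s_def abs_sgn mult.commute mult.left_commute)
    finally show ?thesis .
  qed
  then show thesis using that x by blast
qed

lemma width_dir_pos:
  assumes "convex_body d C" "y \<in> Edim d" "y \<noteq> 0"
  shows "0 < width_dir d C y"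
proof -
  obtain i where "i < d" "y i \<noteq> 0" using Edim_nonzero assms by blast
  moreover obtain r where "r > 0" "\<And>y i. i < d \<Longrightarrow> r * \<bar>y i\<bar> \<le> width_dir d C y"
    using width_dir_coord_le[OF assms(1)] by blast
  ultimately show ?thesis by (metis less_le_trans mult_pos_pos zero_less_abs_iff)
qed

lemma finite_small_width:
  assumes "convex_body d C" "fvec.span L = Edim d"
  shows "finite {y \<in> dual_lattice d L. width_dir d C y \<le> R}"
proof -
  obtain r where r: "r > 0" "\<And>y i. i < d \<Longrightarrow> r * \<bar>y i\<bar> \<le> width_dir d C y"
    using width_dir_coord_le[OF assms(1)] by blast
  have "{y \<in> dual_lattice d L. width_dir d C y \<le> R} \<subseteq> {y \<in> dual_lattice d L. \<forall>i<d. \<bar>y i\<bar> \<le> R / r}"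
    using r by (auto simp: pos_le_divide_eq mult.commute intro: order_trans)
  then show ?thesis using finite_dual_lattice_bounded[OF assms(2)] finite_subset by blast
qed

section \<open>Counting width directions\<close>

lemma dual_lattice_subgroup:
  "dual_lattice d L \<subseteq> Edim d" "0 \<in> dual_lattice d L"
  "x \<in> dual_lattice d L \<Longrightarrow> y \<in> dual_lattice d L \<Longrightarrow> x - y \<in> dual_lattice d L"
  by (auto simp: dual_lattice_def ip_simps Edim_diff)

lemma lattice_width_le:
  assumes "convex_body d C" "y \<in> dual_lattice d L" "y \<noteq> 0"
  shows "lattice_width d L C \<le> width_dir d C y"
  unfolding lattice_width_def
proof (rule cInf_lower)
  show "bdd_below (width_dir d C ` (dual_lattice d L - {0}))"
    using width_dir_nonneg convex_bodyD[OF assms(1)] by (intro bdd_belowI[of _ 0]) auto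
qed (use assms in auto)

text \<open>The vector 0, of width 0, can be counted along with the width directions, since its
  differences obey the same estimate 3 w(g) \<le> w(s) + w(t) \<le> 2 l. The resulting extra 1 lets
  the final estimate come out as a clean power of 9.\<close>

lemma card_width_directions:
  assumes C: "convex_body d C" and L: "fvec.span L = Edim d"
  shows "finite (width_directions d L C)"
    and "card (width_directions d L C) + 1 \<le> 3 ^ fvec.dim (width_directions d L C)"
proof -
  note Cb = convex_bodyD[OF C]
  let ?W = "width_directions d L C" and ?w = "width_dir d C" and ?l = "lattice_width d L C"
  have W: "y \<in> dual_lattice d L" "y \<noteq> 0" "?w y = ?l" if "y \<in> ?W" for y
    using that by (auto simp: width_directions_def)
  show fin: "finite ?W"
    by (rule finite_subset[OF _ finite_small_width[OF C L, of ?l]]) (use W in auto)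
  have "card (insert 0 ?W) \<le> 3 ^ fvec.dim ?W"
  proof (rule card_incongruent_mod_3_le[OF dual_lattice_subgroup(1,2)])
    fix s t g assume s: "s \<in> insert 0 ?W" and t: "t \<in> insert 0 ?W" and g: "g \<in> dual_lattice d L"
      and e: "s - t = fscale 3 g"
    show "s = t"
    proof (rule ccontr)
      assume "s \<noteq> t"
      then have g0: "g \<noteq> 0" using e by auto
      \<comment> \<open>Distinct s and t cannot both be 0, so a width direction exists and the
        minimal width is positive.\<close>
      obtain y where "y \<in> ?W" using s t \<open>s \<noteq> t\<close> by auto
      then have pos: "?l > 0" using W width_dir_pos[OF C, of y] dual_lattice_subgroup(1)[THEN subsetD] by metis
      have "?w s \<le> ?l" "?w t \<le> ?l" using s t W pos width_dir_zero[OF Cb(2,4)] by auto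
      moreover have "3 * ?w g \<le> ?w s + ?w t"
        using width_dir_scale_ge[OF Cb(2,4), of 3 d g] width_dir_diff_le[OF Cb(2,4), of d s t] e by simp
      ultimately show False using lattice_width_le[OF C g g0] pos by linarith
    qed
  next
    show "insert 0 ?W \<subseteq> fvec.span ?W" by (auto intro: fvec.span_base fvec.span_zero)
    show "?W \<subseteq> dual_lattice d L" "insert 0 ?W \<subseteq> dual_lattice d L" "finite (insert 0 ?W)"
      using fin W(1) dual_lattice_subgroup(2) by auto
    show "finite {g \<in> dual_lattice d L. \<forall>i<d. \<bar>g i\<bar> \<le> R}" for R
      by (rule finite_dual_lattice_bounded[OF L])
    show "x - y \<in> dual_lattice d L" if "x \<in> dual_lattice d L" "y \<in> dual_lattice d L" for x y
      using that by (rule dual_lattice_subgroup(3))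
  qed
  moreover have "0 \<notin> ?W" using W by blast
  ultimately show "card ?W + 1 \<le> 3 ^ fvec.dim ?W" using fin by simp
qed

text \<open>If P meets both extremal faces of C for every width direction, then moving C slightly
  towards P preserves the lattice width: the widths in the other directions exceed it by a fixed gap.\<close>

lemma lattice_width_mix:
  assumes C: "convex_body d C" and L: "fvec.span L = Edim d"
    and P: "compact P" "convex_set P" "P \<subseteq> C" "P \<noteq> {}"
    and ab: "\<forall>y\<in>width_directions d L C. \<exists>a\<in>P. \<exists>b\<in>P. width_dir d C y = ip d y (a - b)"
  shows "\<exists>e. 0 < e \<and> e < 1 \<and>
    lattice_width d L {fscale (1 - e) x + fscale e p | x p. x \<in> C \<and> p \<in> P} = lattice_width d L C"
proof (cases "dual_lattice d L - {0} = {}")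
  case True
  \<comment> \<open>Both widths are the \<open>Inf\<close> of the same empty set, so any e
    works.\<close>
  show ?thesis by (rule exI[of _ "1/2"]) (unfold lattice_width_def True, simp)
next
  case False
  note Cb = convex_bodyD[OF C]
  let ?W = "width_directions d L C" and ?w = "width_dir d C" and ?l = "lattice_width d L C"
  define M where "M = {y \<in> dual_lattice d L - {0}. ?w y \<le> ?l + 1}"
  have finM: "finite M"
    by (rule finite_subset[OF _ finite_small_width[OF C L, of "?l + 1"]]) (auto simp: M_def)
  \<comment> \<open>The least non-extremal width, capped at \<open>?l + 1\<close>; dual vectors
    outside M exceed the cap.\<close>
  define l' where "l' = Min (insert (?l + 1) (?w ` (M - ?W)))"
  have "?l < ?w y" if "y \<in> M - ?W" for y
    using that lattice_width_le[OF C, of y L] by (auto simp: M_def width_directions_def)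
  then have l': "?l < l'" using finM by (auto simp: l'_def)
  have gap: "l' \<le> ?w y" if "y \<in> dual_lattice d L - {0}" "y \<notin> ?W" for y
  proof (cases "y \<in> M")
    case True
    then show ?thesis using finM that unfolding l'_def by (intro Min_le) auto
  next
    case False
    have "l' \<le> ?l + 1" using finM unfolding l'_def by (intro Min_le) auto
    then show ?thesis using that False by (auto simp: M_def)
  qed
  have l0: "?l \<ge> 0"
    unfolding lattice_width_def using False width_dir_nonneg[OF Cb(2,4)] by (intro cInf_greatest) auto
  \<comment> \<open>Chosen so that (1 - e) l' is the midpoint of \<open>?l\<close> and l': shrinking
    by 1 - e keeps every non-extremal width above \<open>?l\<close>.\<close>
  define e where "e = (1 - ?l / l') / 2"
  have e: "0 < e" "e < 1" using l' l0 by (auto simp: e_def field_simps)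
  have "(1 - e) * l' = (l' + ?l) / 2" using l' l0 by (simp add: e_def field_simps)
  then have el: "?l \<le> (1 - e) * l'" using l' by simp
  define C' where "C' = {fscale (1 - e) x + fscale e p | x p. x \<in> C \<and> p \<in> P}"
  have C': "convex_body d C'" "C' \<subseteq> C"
    unfolding C'_def by (rule convex_mix_body[OF C P less_imp_le[OF e(1)] e(2)])+
  note Cb' = convex_bodyD[OF C'(1)]
  have PC': "p \<in> C'" if "p \<in> P" for p
  proof -
    have "p = fscale (1 - e) p + fscale e p" by (simp add: fun_eq_iff algebra_simps)
    then show ?thesis using that P(3) unfolding C'_def by blast
  qed
  obtain p0 where p0: "p0 \<in> P" using P by blast
  have ge: "?l \<le> width_dir d C' y" if y: "y \<in> dual_lattice d L - {0}" for y
  proof (cases "y \<in> ?W")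
    case True
    then obtain a b where ab: "a \<in> P" "b \<in> P" "?w y = ip d y (a - b)" using ab by blast
    then show ?thesis
      using width_dir_upper[OF Cb'(2) PC'[OF ab(1)] PC'[OF ab(2)], of d y] True
      by (simp add: width_directions_def)
  next
    case False
    obtain a b where ab: "a \<in> C" "b \<in> C" "?w y = ip d y (a - b)"
      using width_dir_attained[OF Cb(2,4), of d y] by blast
    \<comment> \<open>Both endpoints are mixed with the same point p0, so their difference shrinks
      exactly by the factor 1 - e.\<close>
    have m: "fscale (1 - e) a + fscale e p0 \<in> C'" "fscale (1 - e) b + fscale e p0 \<in> C'"
      using ab p0 by (auto simp: C'_def)
    have "?l \<le> (1 - e) * ?w y"
      using el mult_left_mono[OF gap[OF y False], of "1 - e"] e by linarith
    also have "\<dots> = ip d y ((fscale (1 - e) a + fscale e p0) - (fscale (1 - e) b + fscale e p0))"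
      by (simp add: ab(3) ip_simps algebra_simps)
    also have "\<dots> \<le> width_dir d C' y" by (rule width_dir_upper[OF Cb'(2) m])
    finally show ?thesis .
  qed
  have "lattice_width d L C' \<ge> ?l"
    unfolding lattice_width_def[of d L C'] using False ge by (intro cInf_greatest) auto
  moreover have "lattice_width d L C' \<le> ?l"
    unfolding lattice_width_def[of d L C]
  proof (rule cInf_greatest)
    fix s assume "s \<in> ?w ` (dual_lattice d L - {0})"
    then obtain y where y: "y \<in> dual_lattice d L" "y \<noteq> 0" "s = ?w y" by auto
    then show "lattice_width d L C' \<le> s"
      using lattice_width_le[OF C'(1) y(1,2)] width_dir_mono[OF Cb(2) Cb'(2,4) C'(2), of d y] by simp
  qed (use False in auto)
  ultimately have "lattice_width d L C' = ?l" by simp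
  then show ?thesis using e unfolding C'_def by (intro exI[of _ e] conjI)
qed

lemma lattice_reduced_dim_bound:
  assumes L: "fvec.span L = Edim d" and red: "lattice_reduced d L C"
  shows "d \<le> 9 ^ fvec.dim (width_directions d L C)"
proof -
  have C: "convex_body d C" using red by (simp add: lattice_reduced_def)
  note Cb = convex_bodyD[OF C]
  let ?W = "width_directions d L C"
  obtain x0 r where x0: "x0 \<in> C" "r > 0"
    and cube: "\<And>y. y \<in> Edim d \<Longrightarrow> (\<And>i. i < d \<Longrightarrow> \<bar>y i - x0 i\<bar> < r) \<Longrightarrow> y \<in> C"
    using convex_body_cubeE[OF C] by blast
  have fin: "finite ?W" by (rule card_width_directions[OF C L])
  have "\<exists>a\<in>C. \<exists>b\<in>C. width_dir d C y = ip d y (a - b)" for y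
    by (rule width_dir_attained[OF Cb(2,4)])
  then obtain a b where ab: "\<And>y. a y \<in> C" "\<And>y. b y \<in> C"
      "\<And>y. width_dir d C y = ip d y (a y - b y)" by metis
  have "d \<le> 2 * card ?W"
  proof (rule ccontr)
    assume "\<not> d \<le> 2 * card ?W"
    \<comment> \<open>Two points per width direction account for the factor 2. Centring at x0 turns
      orthogonality to F into the statement that f takes the value f(x0) at all chosen maximisers
      and minimisers.\<close>
    define F where "F = (\<lambda>y. a y - x0) ` ?W \<union> (\<lambda>y. b y - x0) ` ?W"
    have "card F \<le> card ?W + card ?W"
      unfolding F_def by (intro card_Un_le[THEN order_trans] add_mono card_image_le fin)
    then have "card F < d" using \<open>\<not> d \<le> 2 * card ?W\<close> by simp
    moreover have "finite F" using fin by (simp add: F_def)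
    ultimately obtain f where f: "f \<in> Edim d" "f \<noteq> 0" "\<And>p. p \<in> F \<Longrightarrow> ip d f p = 0"
      using exists_orthogonal[of F d] by auto
    define P where "P = {p \<in> C. ip d f p = ip d f x0}"
    have "closed {p. ip d f p = ip d f x0}" by (intro closed_Collect_eq continuous_on_vec)
    then have "compact (C \<inter> {p. ip d f p = ip d f x0})" using Cb(2) by (rule compact_Int_closed[rotated])
    moreover have "C \<inter> {p. ip d f p = ip d f x0} = P" by (auto simp: P_def)
    ultimately have P1: "compact P" by simp
    have P2: "convex_set P"
      using Cb(3) by (auto simp: convex_set_def P_def ip_simps algebra_simps)
    have P3: "P \<subseteq> C" "P \<noteq> {}" using x0 by (auto simp: P_def)
    have "a y \<in> P" "b y \<in> P" if "y \<in> ?W" for y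
      using f(3)[of "a y - x0"] f(3)[of "b y - x0"] that ab by (auto simp: P_def F_def ip_simps)
    then have "\<forall>y\<in>?W. \<exists>u\<in>P. \<exists>v\<in>P. width_dir d C y = ip d y (u - v)"
      using ab(3) by (intro ballI bexI)
    from lattice_width_mix[OF C L P1 P2 P3 this] obtain e where e: "0 < e" "e < 1" and
      w: "lattice_width d L {fscale (1 - e) x + fscale e p | x p. x \<in> C \<and> p \<in> P} = lattice_width d L C" by auto
    let ?C' = "{fscale (1 - e) x + fscale e p | x p. x \<in> C \<and> p \<in> P}"
    have "convex_body d ?C'" "?C' \<subseteq> C"
      by (rule convex_mix_body[OF C P1 P2 P3 less_imp_le[OF e(1)] e(2)])+
    then have eq: "?C' = C" using red w unfolding lattice_reduced_def by blast
    \<comment> \<open>As C' = C, a maximiser c of |f - f(x0)| on C is itself a mixture with a point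
      of P, where f - f(x0) vanishes. Its value is thus at most 1 - e times the maximum, so f is
      constant on C, which an interior point excludes.\<close>
    have "continuous_on C (\<lambda>x. \<bar>ip d f (x - x0)\<bar>)"
      by (intro continuous_on_rabs continuous_on_vec)
    then obtain c where c: "c \<in> C" "\<And>x. x \<in> C \<Longrightarrow> \<bar>ip d f (x - x0)\<bar> \<le> \<bar>ip d f (c - x0)\<bar>"
      using continuous_attains_sup[OF Cb(2,4), of "\<lambda>x. \<bar>ip d f (x - x0)\<bar>"] by blast
    then obtain x p where xp: "c = fscale (1 - e) x + fscale e p" "x \<in> C" "p \<in> P" using eq by blast
    have "ip d f (c - x0) = (1 - e) * ip d f (x - x0)"
      using xp(3) unfolding xp(1) by (simp add: P_def ip_simps left_diff_distrib right_diff_distrib)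
    then have "\<bar>ip d f (c - x0)\<bar> = (1 - e) * \<bar>ip d f (x - x0)\<bar>" using e by (simp add: abs_mult)
    also have "\<dots> \<le> (1 - e) * \<bar>ip d f (c - x0)\<bar>" using e c(2)[OF xp(2)] by (intro mult_left_mono) auto
    finally have "e * \<bar>ip d f (c - x0)\<bar> \<le> 0" by (simp add: algebra_simps)
    then have "ip d f (c - x0) = 0" using e by (simp add: mult_le_0_iff)
    then have const: "ip d f (x - x0) = 0" if "x \<in> C" for x using c(2)[OF that] by simp
    obtain i where i: "i < d" "f i \<noteq> 0" using Edim_nonzero f by blast
    have "x0 + fscale (r / 2) (uvec i) \<in> C"
      using x0 i Cb(1) by (intro cube) (auto intro!: Edim_add Edim_scale uvec_Edim simp: uvec_apply)
    from const[OF this] show False using x0 i by (simp add: ip_simps ip_uvec)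
  qed
  then have "d + 2 \<le> 2 * 3 ^ fvec.dim ?W" using card_width_directions(2)[OF C L] by linarith
  \<comment> \<open>Used for t = 3^dim; the summand 1 is absorbed by the 2 added to d.\<close>
  also have "2 * t \<le> t ^ 2 + 1" for t :: nat
  proof -
    have "0 \<le> (int t - 1) ^ 2" by simp
    then have "int (2 * t) \<le> int (t ^ 2 + 1)" by (simp add: power2_eq_square algebra_simps)
    then show ?thesis by (simp only: of_nat_le_iff)
  qed
  also have "(3 ^ fvec.dim ?W) ^ 2 = (9::nat) ^ fvec.dim ?W"
    by (simp flip: power_mult add: mult.commute) (simp add: power_mult)
  finally show ?thesis by simp
qed

section \<open>Lattice lengths and support functionals\<close>

text \<open>In a lattice, such a v generates the lattice points on its line, so a segment with
  difference \<open>fscale s v\<close>, s > 0, has lattice length s.\<close>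

definition primitive :: "(nat \<Rightarrow> real) set \<Rightarrow> (nat \<Rightarrow> real) \<Rightarrow> bool" where
  "primitive L v \<longleftrightarrow> v \<in> L \<and> v \<noteq> 0 \<and> (\<forall>r. fscale r v \<in> L \<longrightarrow> r \<in> \<int>)"

lemma fscale_cancel: "v \<noteq> 0 \<Longrightarrow> fscale r v = fscale s v \<longleftrightarrow> r = s"
  by (metis fvec.scale_cancel_right)

lemma lattice_fscale_int:
  assumes "lattice d L" "v \<in> L" shows "fscale (of_int k) v \<in> L"
  using latticeD(2,3)[OF assms(1)] assms(2) by (rule subgroup_fscale_int)

text \<open>A least t in (0, 1] with t v in \<open>L\<close> exists because bounded sets of lattice
  vectors are finite; division with remainder then shows that t v generates the line.\<close>

lemma primitive_exists:
  assumes L: "lattice d L" and v: "v \<in> L" "v \<noteq> 0"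
  obtains g m where "primitive L g" "m \<ge> (1::int)" "v = fscale (of_int m) g"
proof -
  note Ld = latticeD[OF L]
  define T where "T = {t. 0 < t \<and> t \<le> 1 \<and> fscale t v \<in> L}"
  have "(\<lambda>t. fscale t v) ` T \<subseteq> {g \<in> L. \<forall>i<d. \<bar>g i\<bar> \<le> (\<Sum>j<d. \<bar>v j\<bar>)}"
  proof clarify
    fix t assume t: "t \<in> T"
    have "\<bar>fscale t v i\<bar> \<le> (\<Sum>j<d. \<bar>v j\<bar>)" if "i < d" for i
    proof -
      have "\<bar>fscale t v i\<bar> = \<bar>t\<bar> * \<bar>v i\<bar>" by (simp add: abs_mult)
      also have "\<dots> \<le> 1 * \<bar>v i\<bar>" using t by (intro mult_right_mono) (auto simp: T_def)
      also have "\<dots> \<le> (\<Sum>j<d. \<bar>v j\<bar>)"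
        using that member_le_sum[of i "{..<d}" "\<lambda>j. \<bar>v j\<bar>"] by simp
      finally show ?thesis .
    qed
    then show "fscale t v \<in> L \<and> (\<forall>i<d. \<bar>fscale t v i\<bar> \<le> (\<Sum>j<d. \<bar>v j\<bar>))"
      using t unfolding T_def by blast
  qed
  then have "finite ((\<lambda>t. fscale t v) ` T)" using finite_lattice_bounded[OF L] by (rule finite_subset)
  moreover have "inj_on (\<lambda>t. fscale t v) T" using fscale_cancel[OF v(2)] by (simp add: inj_on_def)
  ultimately have finT: "finite T" by (rule finite_imageD)
  have T1: "1 \<in> T" using v by (simp add: T_def)
  define t where "t = Min T"
  have t: "t \<in> T" "\<And>s. s \<in> T \<Longrightarrow> t \<le> s"
    using finT T1 unfolding t_def by (auto intro: Min_in Min_le)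
  then have t': "0 < t" "t \<le> 1" "fscale t v \<in> L" by (auto simp: T_def)
  have quot: "\<exists>q::int. r = of_int q * t" if "fscale r v \<in> L" for r
  proof -
    define q where "q = \<lfloor>r / t\<rfloor>"
    have q: "of_int q \<le> r / t" "r / t < of_int q + 1" unfolding q_def by linarith+
    have "of_int q * t \<le> r" "r < (of_int q + 1) * t"
      using q t'(1) by (simp_all add: pos_le_divide_eq pos_divide_less_eq)
    then have b: "0 \<le> r - of_int q * t" "r - of_int q * t < t" by (simp_all add: algebra_simps)
    have "fscale r v - fscale (of_int q) (fscale t v) \<in> L"
      by (intro Ld(3) that lattice_fscale_int[OF L] t')
    also have "fscale r v - fscale (of_int q) (fscale t v) = fscale (r - of_int q * t) v"
      by (simp add: fun_eq_iff algebra_simps)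
    finally have mem: "fscale (r - of_int q * t) v \<in> L" .
    have "r - of_int q * t = 0"
    proof (rule ccontr)
      assume "r - of_int q * t \<noteq> 0"
      then have "r - of_int q * t \<in> T" using mem b t' by (simp add: T_def)
      then show False using t(2) b by fastforce
    qed
    then show ?thesis by auto
  qed
  obtain m where m: "1 = of_int m * t" using quot[of 1] v by auto
  have "primitive L (fscale t v)"
    unfolding primitive_def
  proof (intro conjI allI impI)
    fix r assume "fscale r (fscale t v) \<in> L"
    then obtain q where "r * t = of_int q * t" using quot[of "r * t"] by auto
    then show "r \<in> \<int>" using t' by auto
  qed (use t' v in auto)
  moreover have "m \<ge> 1"
  proof -
    have "(of_int m :: real) > 0" using m t' by (metis zero_less_mult_pos2 zero_less_one)
    then show ?thesis by simp
  qed
  moreover have "v = fscale (of_int m) (fscale t v)" using m by simp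
  ultimately show thesis by (rule that)
qed

lemma primitive_inter_span:
  assumes L: "lattice d L" and v: "primitive L v" and s: "s \<noteq> 0"
  shows "L \<inter> fvec.span {fscale s v} = {fscale (of_int k) v | k. True}"
proof
  show "L \<inter> fvec.span {fscale s v} \<subseteq> {fscale (of_int k) v | k. True}"
    using v by (auto simp: fvec.span_singleton primitive_def elim!: Ints_cases)
  show "{fscale (of_int k) v | k. True} \<subseteq> L \<inter> fvec.span {fscale s v}"
  proof clarify
    fix k :: int
    have "fscale (of_int k) v = fscale (of_int k / s) (fscale s v)" using s by simp
    then show "fscale (of_int k) v \<in> L \<inter> fvec.span {fscale s v}"
      using v lattice_fscale_int[OF L] unfolding fvec.span_singleton primitive_def by blast
  qed
qed

text \<open>Evaluates the \<open>THE\<close>: v and any other candidate are integer multiples of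
  each other, so they agree up to sign, and positivity excludes -1.\<close>

lemma pos_generator_eq:
  assumes L: "lattice d L" and v: "primitive L v" and s: "s > 0"
  shows "pos_generator L (fscale s v) = v"
  unfolding pos_generator_def
proof (rule the_equality)
  have "L \<inter> fvec.span {fscale s v} = {fscale (of_int k) v | k. True}"
    using s by (intro primitive_inter_span[OF L v]) simp
  moreover have "\<exists>r>0. v = fscale r (fscale s v)" using s by (intro exI[of _ "1 / s"]) simp
  ultimately show "(\<exists>r>0. v = fscale r (fscale s v)) \<and>
      L \<inter> fvec.span {fscale s v} = {fscale (of_int k) v | k. True}" by blast
next
  fix w
  assume w: "(\<exists>r>0. w = fscale r (fscale s v)) \<and>
      L \<inter> fvec.span {fscale s v} = {fscale (of_int k) w | k. True}"
  then obtain r where r: "r > 0" "w = fscale (r * s) v" by auto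
  have eq: "{fscale (of_int k) v | k. True} = {fscale (of_int k) w | k. True}"
    using w primitive_inter_span[OF L v, of s] s by simp
  have "\<exists>k::int. w = fscale (of_int k) v"
  proof -
    have "fscale (of_int 1) w \<in> {fscale (of_int k) w | k. True}" by blast
    then show ?thesis unfolding eq[symmetric] by auto
  qed
  then obtain k where k: "w = fscale (of_int k) v" by blast
  have "\<exists>l::int. v = fscale (of_int l) w"
  proof -
    have "fscale (of_int 1) v \<in> {fscale (of_int k) v | k. True}" by blast
    then show ?thesis unfolding eq by auto
  qed
  then obtain l where l: "v = fscale (of_int l) w" by blast
  have v0: "v \<noteq> 0" using v by (simp add: primitive_def)
  have "of_int k = r * s" using fscale_cancel[OF v0] k r by metis
  then have "k > 0" using r s by (metis mult_pos_pos of_int_0_less_iff)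
  have "v = fscale (of_int l) (fscale (of_int k) v)" unfolding k[symmetric] by (rule l)
  then have "fscale 1 v = fscale (of_int (l * k)) v"
    by (metis fscale_fscale fscale_one of_int_mult)
  then have "(1::real) = of_int (l * k)" using fscale_cancel[OF v0] by metis
  then have "l * k = 1" by (metis of_int_eq_1_iff)
  then have "k = 1" using \<open>k > 0\<close> by (metis pos_zmult_eq_1_iff mult.commute)
  then show "w = v" using k by simp
qed

lemma lattice_length_eq:
  assumes L: "lattice d L" and v: "primitive L v" and s: "s > 0" and ab: "b - a = fscale s v"
  shows "lattice_length d L a b = s"
proof -
  have "v \<in> Edim d" "v \<noteq> 0" using v latticeD[OF L] by (auto simp: primitive_def)
  then have "enorm d v > 0" by (rule enorm_pos)
  then show ?thesis
    unfolding lattice_length_def ab pos_generator_eq[OF L v s] enorm_scale using s by simp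
qed

lemma lattice_segment_primitive:
  assumes L: "lattice d L" and seg: "lattice_segment L a b"
  obtains v s where "primitive L v" "s > 0" "b - a = fscale s v"
proof -
  obtain w s where w: "w \<in> L" "w \<noteq> 0" "b - a = fscale s w" and "a \<noteq> b"
    using seg by (auto simp: lattice_segment_def)
  then have s: "s \<noteq> 0" by auto
  obtain w' s' where w': "w' \<in> L" "w' \<noteq> 0" "b - a = fscale s' w'" "s' > 0"
  proof (cases "s > 0")
    case True then show ?thesis using w that by blast
  next
    case False
    have "0 - w \<in> L" using latticeD(2,3)[OF L] w(1) by blast
    moreover have "b - a = fscale (- s) (0 - w)" using w(3) by (simp add: fun_eq_iff)
    ultimately show ?thesis using that[of "0 - w" "- s"] w(2) s False by simp
  qed
  obtain g m where g: "primitive L g" "m \<ge> (1::int)" "w' = fscale (of_int m) g"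
    using primitive_exists[OF L w'(1,2)] by metis
  show thesis
  proof (rule that[OF g(1)])
    show "s' * of_int m > 0" using w' g by simp
    show "b - a = fscale (s' * of_int m) g" using w' g by simp
  qed
qed

section \<open>The lattice diameter in terms of the difference body\<close>

definition diff_body :: "(nat \<Rightarrow> real) set \<Rightarrow> (nat \<Rightarrow> real) set" where
  "diff_body C = {x - y | x y. x \<in> C \<and> y \<in> C}"

text \<open>Lattice lengths depend only on differences of endpoints, so segments in C become points
  of the symmetric convex body C - C.\<close>

definition chord_lengths :: "(nat \<Rightarrow> real) set \<Rightarrow> (nat \<Rightarrow> real) set \<Rightarrow> real set" where
  "chord_lengths L C = {s. 0 < s \<and> (\<exists>v. primitive L v \<and> fscale s v \<in> diff_body C)}"

lemma segment_in_iff: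
  assumes "convex_set C"
  shows "segment_in a b C \<longleftrightarrow> a \<in> C \<and> b \<in> C"
proof
  assume seg: "segment_in a b C"
  have "a + fscale 0 (b - a) \<in> C" "a + fscale 1 (b - a) \<in> C"
    using seg unfolding segment_in_def by (metis order_refl zero_le_one)+
  then show "a \<in> C \<and> b \<in> C" by simp
next
  assume ab: "a \<in> C \<and> b \<in> C"
  have "a + fscale t (b - a) = fscale (1 - t) a + fscale t b" for t
    by (simp add: fun_eq_iff algebra_simps)
  then show "segment_in a b C" unfolding segment_in_def using convex_setD[OF assms] ab by metis
qed

lemma lattice_segmentI:
  assumes "primitive L v" "s > 0" "b - a = fscale s v"
  shows "lattice_segment L a b"
  unfolding lattice_segment_def
proof
  show "a \<noteq> b" using assms by (auto simp: primitive_def)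
  show "\<exists>v\<in>L. v \<noteq> 0 \<and> (\<exists>s. b - a = fscale s v)" using assms by (auto simp: primitive_def)
qed

lemma lattice_diam_eq:
  assumes L: "lattice d L" and C: "convex_set C"
  shows "lattice_diam d L C = Sup (chord_lengths L C)"
proof -
  have "{lattice_length d L a b | a b. lattice_segment L a b \<and> segment_in a b C} = chord_lengths L C"
    (is "?A = _")
  proof
    show "?A \<subseteq> chord_lengths L C"
    proof clarify
      fix a b assume seg: "lattice_segment L a b" "segment_in a b C"
      obtain v s where v: "primitive L v" "s > 0" "b - a = fscale s v"
        using lattice_segment_primitive[OF L seg(1)] by metis
      have "fscale s v \<in> diff_body C"
        using seg(2) segment_in_iff[OF C] unfolding v(3)[symmetric] diff_body_def by blast
      then show "lattice_length d L a b \<in> chord_lengths L C"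
        unfolding lattice_length_eq[OF L v] chord_lengths_def using v by blast
    qed
    show "chord_lengths L C \<subseteq> ?A"
    proof
      fix s assume "s \<in> chord_lengths L C"
      then obtain v x y where v: "primitive L v" "s > 0" "x - y = fscale s v" and xy: "x \<in> C" "y \<in> C"
        unfolding chord_lengths_def diff_body_def by force
      have "lattice_length d L y x = s" "lattice_segment L y x" "segment_in y x C"
        using lattice_length_eq[OF L v] lattice_segmentI[OF v] xy segment_in_iff[OF C] by auto
      then show "s \<in> ?A" by blast
    qed
  qed
  then show ?thesis unfolding lattice_diam_def by (rule arg_cong)
qed

text \<open>Excludes arbitrarily short lattice vectors. With boundedness of C - C this bounds the
  chord lengths, so that the \<open>Sup\<close> in the diameter is a genuine supremum.\<close>

lemma lattice_min_coord:
  assumes L: "lattice d L"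
  obtains \<rho> where "\<rho> > 0" "\<And>v. v \<in> L \<Longrightarrow> v \<noteq> 0 \<Longrightarrow> \<exists>i<d. \<rho> \<le> \<bar>v i\<bar>"
proof -
  define S where "S = {v \<in> L. \<forall>i<d. \<bar>v i\<bar> \<le> 1} - {0}"
  have fin: "finite S" unfolding S_def using finite_lattice_bounded[OF L] by blast
  have "\<exists>i<d. v i \<noteq> 0" if "v \<in> L" "v \<noteq> 0" for v
    using Edim_nonzero[of v d] latticeD(1)[OF L] that by blast
  then obtain j where j: "\<And>v. v \<in> L \<Longrightarrow> v \<noteq> 0 \<Longrightarrow> j v < d \<and> v (j v) \<noteq> 0" by metis
  define \<rho> where "\<rho> = Min (insert 1 ((\<lambda>v. \<bar>v (j v)\<bar>) ` S))"
  have pos: "\<rho> > 0" using fin j by (auto simp: \<rho>_def S_def)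
  have "\<exists>i<d. \<rho> \<le> \<bar>v i\<bar>" if v: "v \<in> L" "v \<noteq> 0" for v
  proof (cases "v \<in> S")
    case True
    then have "\<rho> \<le> \<bar>v (j v)\<bar>" unfolding \<rho>_def using fin by (intro Min_le) auto
    then show ?thesis using j v by blast
  next
    case False
    then obtain i where "i < d" "\<bar>v i\<bar> > 1" using v unfolding S_def by force
    moreover have "\<rho> \<le> 1" unfolding \<rho>_def using fin by (intro Min_le) auto
    ultimately show ?thesis by (intro exI[of _ i]) auto
  qed
  then show thesis using that pos by blast
qed

lemma diff_body_bounded:
  assumes "compact C"
  obtains R where "R > 0" "\<And>x i. x \<in> diff_body C \<Longrightarrow> i < d \<Longrightarrow> \<bar>x i\<bar> \<le> R"
proof -
  obtain R where R: "R > 0" "\<And>x i. x \<in> C \<Longrightarrow> i < d \<Longrightarrow> \<bar>x i\<bar> \<le> R"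
    using compact_bounded_coord[OF assms, of d] by blast
  have "\<bar>x i\<bar> \<le> 2 * R" if x: "x \<in> diff_body C" and i: "i < d" for x i
  proof -
    obtain a b where "x = a - b" "a \<in> C" "b \<in> C" using x unfolding diff_body_def by blast
    then show ?thesis using R(2)[of a i] R(2)[of b i] i by simp
  qed
  then show thesis using that[of "2 * R"] R(1) by simp
qed

lemma bdd_above_chord_lengths:
  assumes L: "lattice d L" and C: "compact C"
  shows "bdd_above (chord_lengths L C)"
proof -
  obtain R where R: "R > 0" "\<And>x i. x \<in> diff_body C \<Longrightarrow> i < d \<Longrightarrow> \<bar>x i\<bar> \<le> R"
    using diff_body_bounded[OF C] by metis
  obtain \<rho> where \<rho>: "\<rho> > 0" "\<And>v. v \<in> L \<Longrightarrow> v \<noteq> 0 \<Longrightarrow> \<exists>i<d. \<rho> \<le> \<bar>v i\<bar>"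
    using lattice_min_coord[OF L] by metis
  have "s \<le> R / \<rho>" if s: "s \<in> chord_lengths L C" for s
  proof -
    obtain v where v: "0 < s" "primitive L v" "fscale s v \<in> diff_body C"
      using s unfolding chord_lengths_def by blast
    then obtain i where i: "i < d" "\<rho> \<le> \<bar>v i\<bar>" using \<rho> unfolding primitive_def by blast
    have "s * \<rho> \<le> s * \<bar>v i\<bar>" using i v by (intro mult_left_mono) auto
    also have "\<dots> = \<bar>fscale s v i\<bar>" using v by (simp add: abs_mult)
    also have "\<dots> \<le> R" using R(2) v i by blast
    finally show ?thesis using \<rho> by (simp add: pos_le_divide_eq)
  qed
  then show ?thesis by (intro bdd_aboveI)
qed

lemma le_lattice_diam:
  assumes "lattice d L" "convex_body d C" "primitive L v" "0 < s" "fscale s v \<in> diff_body C"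
  shows "s \<le> lattice_diam d L C"
proof -
  note Cb = convex_bodyD[OF assms(2)]
  have "s \<in> chord_lengths L C" using assms unfolding chord_lengths_def by blast
  then show ?thesis unfolding lattice_diam_eq[OF assms(1) Cb(3)]
    by (intro cSup_upper bdd_above_chord_lengths[OF assms(1) Cb(2)])
qed

lemma diff_body_props:
  assumes C: "convex_body d C"
  shows "diff_body C \<subseteq> Edim d" "compact (diff_body C)" "convex_set (diff_body C)"
    and "x \<in> diff_body C \<Longrightarrow> - x \<in> diff_body C"
    and "\<exists>r>0. \<forall>y\<in>Edim d. (\<forall>i<d. \<bar>y i\<bar> < r) \<longrightarrow> y \<in> diff_body C"
proof -
  note Cb = convex_bodyD[OF C]
  show "diff_body C \<subseteq> Edim d" using Cb(1) unfolding diff_body_def by (auto intro: Edim_diff)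
  have "diff_body C = (\<lambda>z. fst z - snd z) ` (C \<times> C)"
    unfolding diff_body_def by force
  moreover have "compact \<dots>" by (intro compact_continuous_image compact_Times Cb continuous_on_vec)
  ultimately show "compact (diff_body C)" by simp
  show "convex_set (diff_body C)"
    unfolding convex_set_def
  proof (intro ballI allI impI)
    fix p q t assume "p \<in> diff_body C" "q \<in> diff_body C" and t: "0 \<le> t \<and> (t::real) \<le> 1"
    then obtain x y x' y' where p: "p = x - y" "x \<in> C" "y \<in> C" and q: "q = x' - y'" "x' \<in> C" "y' \<in> C"
      unfolding diff_body_def by blast
    have "fscale (1 - t) p + fscale t q
        = (fscale (1 - t) x + fscale t x') - (fscale (1 - t) y + fscale t y')"
      by (simp add: p q fun_eq_iff algebra_simps)
    moreover have "fscale (1 - t) x + fscale t x' \<in> C" "fscale (1 - t) y + fscale t y' \<in> C"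
      using convex_setD[OF Cb(3)] p q t by auto
    ultimately show "fscale (1 - t) p + fscale t q \<in> diff_body C" unfolding diff_body_def by blast
  qed
  show "- x \<in> diff_body C" if x: "x \<in> diff_body C"
  proof -
    obtain a b where "x = a - b" "a \<in> C" "b \<in> C" using x unfolding diff_body_def by blast
    then have "- x = b - a" by simp
    then show ?thesis using \<open>a \<in> C\<close> \<open>b \<in> C\<close> unfolding diff_body_def by blast
  qed
  obtain x r where x: "x \<in> C" "r > 0"
    and cube: "\<And>y. y \<in> Edim d \<Longrightarrow> (\<And>i. i < d \<Longrightarrow> \<bar>y i - x i\<bar> < r) \<Longrightarrow> y \<in> C"
    using convex_body_cubeE[OF C] by blast
  have "y \<in> diff_body C" if "y \<in> Edim d" "\<forall>i<d. \<bar>y i\<bar> < r" for y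
  proof -
    have "y + x \<in> C" using that x Cb(1) by (intro cube) (auto intro: Edim_add)
    moreover have "y = (y + x) - x" by simp
    ultimately show ?thesis using x(1) unfolding diff_body_def by blast
  qed
  then show "\<exists>r>0. \<forall>y\<in>Edim d. (\<forall>i<d. \<bar>y i\<bar> < r) \<longrightarrow> y \<in> diff_body C" using x(2) by blast
qed

section \<open>Separation and support functionals\<close>

lemma convex_set_star:
  assumes "convex_set K" "0 \<in> K" "fscale t x \<in> K" "0 \<le> s" "s \<le> t"
  shows "fscale s x \<in> K"
proof (cases "t = 0")
  case True then show ?thesis using assms by simp
next
  case False
  have "fscale (1 - s / t) 0 + fscale (s / t) (fscale t x) \<in> K"
    using assms False by (intro convex_setD) auto
  then show ?thesis using False by simp
qed

text \<open>u points from the nearest point of K to q. Since 0 lies in K, u is positive at q, which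
  is needed when u is normalised later.\<close>

lemma separation_aux:
  assumes KE: "K \<subseteq> Edim d" and K: "compact K" "convex_set K" "0 \<in> K"
    and q: "q \<in> Edim d" "q \<notin> K"
  obtains u where "u \<in> Edim d" "ip d u q > 0" "\<And>x. x \<in> K \<Longrightarrow> ip d u x \<le> ip d u q"
proof -
  have "continuous_on K (\<lambda>x. ip d (q - x) (q - x))" by (intro continuous_on_vec)
  moreover have "K \<noteq> {}" using K by blast
  ultimately obtain x0 where x0: "x0 \<in> K" "\<And>x. x \<in> K \<Longrightarrow> ip d (q - x0) (q - x0) \<le> ip d (q - x) (q - x)"
    using continuous_attains_inf[OF K(1)] by blast
  define u where "u = q - x0"
  have u: "u \<in> Edim d" "u \<noteq> 0" using q x0(1) KE by (auto simp: u_def Edim_diff)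
  have proj: "ip d u (x - x0) \<le> 0" if "x \<in> K" for x
  proof (rule ccontr)
    define c where "c = ip d u (x - x0)"
    define N where "N = ip d (x - x0) (x - x0)"
    assume "\<not> ip d u (x - x0) \<le> 0"
    then have c: "c > 0" by (simp add: c_def)
    have N: "N \<ge> 0" by (simp add: N_def ip_self_nonneg)
    \<comment> \<open>Moving from x0 towards x by t changes the squared distance to q by t (t N - 2
      c), and this t satisfies t N \<le> c; so x0 would not be nearest.\<close>
    define t where "t = c / (c + N)"
    have t: "0 < t" "t \<le> 1" using c N by (auto simp: t_def)
    have "fscale (1 - t) x0 + fscale t x \<in> K" using t by (intro convex_setD K x0 that) auto
    then have "ip d u u \<le> ip d (q - (fscale (1 - t) x0 + fscale t x)) (q - (fscale (1 - t) x0 + fscale t x))"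
      unfolding u_def by (rule x0(2))
    also have "q - (fscale (1 - t) x0 + fscale t x) = u - fscale t (x - x0)"
      by (simp add: u_def fun_eq_iff algebra_simps)
    also have "ip d (u - fscale t (x - x0)) (u - fscale t (x - x0)) = ip d u u - 2 * t * c + t * t * N"
    proof -
      have "ip d (u - fscale t z) (u - fscale t z) = ip d u u - 2 * t * ip d u z + t * t * ip d z z" for z
        using ip_commute[of d z u] by (simp add: ip_simps algebra_simps)
      then show ?thesis unfolding c_def N_def .
    qed
    finally have "t * (2 * c) \<le> t * (t * N)" by (simp add: algebra_simps)
    then have "2 * c \<le> t * N" using t by simp
    moreover have "t * N \<le> c"
    proof -
      have "t * N = c * (N / (c + N))" by (simp add: t_def)
      also have "\<dots> \<le> c * 1" using c N by (intro mult_left_mono) auto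
      finally show ?thesis by simp
    qed
    ultimately show False using c by linarith
  qed
  have le: "ip d u x \<le> ip d u x0" if "x \<in> K" for x using proj[OF that] by (simp add: ip_simps)
  have "ip d u q = ip d u u + ip d u x0" by (simp add: u_def ip_simps)
  then have gt: "ip d u q > ip d u x0" using ip_self_pos[OF u] by simp
  have "0 \<le> ip d u x0" using le[OF K(3)] by (simp add: ip_simps)
  show thesis
  proof (rule that[OF u(1)])
    show "ip d u q > 0" using gt \<open>0 \<le> ip d u x0\<close> by linarith
    show "ip d u x \<le> ip d u q" if "x \<in> K" for x using le[OF that] gt by linarith
  qed
qed

text \<open>The supporting functional at a boundary point p is a limit of functionals separating sp
  from K as s decreases to 1; these stay bounded because K contains a cube.\<close>

lemma support_functional:
  assumes KE: "K \<subseteq> Edim d" and K: "compact K" "convex_set K"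
    and r: "r > 0" "\<And>y. y \<in> Edim d \<Longrightarrow> (\<And>i. i < d \<Longrightarrow> \<bar>y i\<bar> < r) \<Longrightarrow> y \<in> K"
    and p: "p \<in> Edim d" "\<And>s. s > 1 \<Longrightarrow> fscale s p \<notin> K"
  shows "\<exists>u\<in>Edim d. ip d u p = 1 \<and> (\<forall>x\<in>K. ip d u x \<le> 1)"
proof -
  have K0: "0 \<in> K" using r by (intro r(2)) auto
  have approx: "\<exists>u\<in>Edim d. ip d u p = 1 \<and> (\<forall>x\<in>K. ip d u x \<le> s)" if s: "s > 1" for s
  proof -
    obtain u where u: "u \<in> Edim d" "ip d u (fscale s p) > 0"
      "\<And>x. x \<in> K \<Longrightarrow> ip d u x \<le> ip d u (fscale s p)"
      using separation_aux[OF KE K K0 Edim_scale[OF p(1)] p(2)[OF s]] by metis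
    define c where "c = ip d u p"
    have sc: "ip d u (fscale s p) = s * c" by (simp add: ip_simps c_def)
    then have c: "c > 0" using u(2) s by (simp add: zero_less_mult_iff)
    show ?thesis
    proof (intro bexI[of _ "fscale (1 / c) u"] conjI ballI)
      show "fscale (1 / c) u \<in> Edim d" using u by (intro Edim_scale)
      show "ip d (fscale (1 / c) u) p = 1" using c by (simp add: ip_simps c_def)
      fix x assume "x \<in> K"
      then have "ip d u x \<le> s * c" using u(3) sc by simp
      then show "ip d (fscale (1 / c) u) x \<le> s" using c by (simp add: ip_simps pos_divide_le_eq)
    qed
  qed
  \<comment> \<open>For s \<le> 2, testing u on the points of K at distance r / 2 from 0 along the
    axes bounds its coordinates by 4 / r.\<close>
  define B where "B = {x \<in> Edim d. \<forall>i<d. \<bar>x i\<bar> \<le> 4 / r}"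
  define A where "A s = {u. ip d u p = 1} \<inter> (\<Inter>x\<in>K. {u. ip d u x \<le> s})" for s
  have "B \<inter> (\<Inter>s\<in>{1<..2}. A s) \<noteq> {}"
  proof (rule compact_imp_fip_image)
    show "compact B" unfolding B_def by (rule compact_Edim_box)
    show "closed (A s)" for s
      unfolding A_def
      by (intro closed_Int closed_INT ballI closed_Collect_eq closed_Collect_le continuous_on_vec)
    fix I assume I: "finite I" "I \<subseteq> {1<..2::real}"
    \<comment> \<open>The sets \<open>A s\<close> grow with s, so a functional for the smallest s
      belongs to all of them.\<close>
    define s where "s = Min (insert 2 I)"
    have s: "s > 1" "s \<le> 2" "\<And>t. t \<in> I \<Longrightarrow> s \<le> t" using I by (auto simp: s_def)
    obtain u where u: "u \<in> Edim d" "ip d u p = 1" "\<And>x. x \<in> K \<Longrightarrow> ip d u x \<le> s"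
      using approx[OF s(1)] by blast
    have "\<bar>u i\<bar> \<le> 4 / r" if i: "i < d" for i
    proof -
      have "fscale (r / 2 * sgn (u i)) (uvec i) \<in> K"
        using r(1) i by (intro r(2) Edim_scale uvec_Edim) (auto simp: uvec_apply sgn_if)
      from u(3)[OF this] have "r / 2 * sgn (u i) * u i \<le> 2"
        using s(2) by (simp only: ip_simps ip_uvec[OF i])
      then have "r / 2 * \<bar>u i\<bar> \<le> 2" by (simp add: abs_sgn mult.commute mult.left_commute)
      then show ?thesis using r(1) by (simp add: pos_le_divide_eq mult.commute)
    qed
    then have "u \<in> B" using u by (simp add: B_def)
    moreover have "u \<in> A t" if "t \<in> I" for t
      unfolding A_def using u s(3)[OF that] by (auto intro: order_trans)
    ultimately show "B \<inter> (\<Inter>s\<in>I. A s) \<noteq> {}" by blast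
  qed
  then obtain u where "u \<in> B \<inter> (\<Inter>s\<in>{1<..2}. A s)" by blast
  then have u: "u \<in> B" "\<And>s. 1 < s \<Longrightarrow> s \<le> 2 \<Longrightarrow> u \<in> A s" by auto
  have "ip d u x \<le> 1" if "x \<in> K" for x
  proof (rule ccontr)
    assume "\<not> ip d u x \<le> 1"
    define s where "s = min 2 ((1 + ip d u x) / 2)"
    have "1 < s" "s \<le> 2" "s < ip d u x" using \<open>\<not> ip d u x \<le> 1\<close>
      by (auto simp: s_def min_less_iff_disj)
    moreover from this(1,2) have "ip d u x \<le> s" using u(2) that by (auto simp: A_def)
    ultimately show False by linarith
  qed
  moreover have "ip d u p = 1" using u(2)[of 2] by (simp add: A_def)
  moreover have "u \<in> Edim d" using u by (simp add: B_def)
  ultimately show ?thesis by blast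
qed

section \<open>Complete bodies\<close>

lemma diff_body_mono: "C \<subseteq> C' \<Longrightarrow> diff_body C \<subseteq> diff_body C'"
  unfolding diff_body_def by blast

lemma chord_lengths_nonempty:
  assumes L: "lattice d L" and d: "d \<ge> 1" and C: "convex_body d C"
  shows "chord_lengths L C \<noteq> {}"
proof -
  have "uvec 0 \<in> fvec.span L" using uvec_Edim[of 0 d] d latticeD(4)[OF L] by simp
  moreover have "uvec 0 \<noteq> 0" by (metis uvec_apply zero_fun_apply zero_neq_one)
  ultimately have "\<not> L \<subseteq> {0}" using fvec.span_mono[of L "{0}"] by auto
  then obtain v where v: "v \<in> L" "v \<noteq> 0" by blast
  then obtain g where g: "primitive L g" using primitive_exists[OF L] by metis
  obtain r where r: "r > 0" "\<forall>y\<in>Edim d. (\<forall>i<d. \<bar>y i\<bar> < r) \<longrightarrow> y \<in> diff_body C"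
    using diff_body_props(5)[OF C] by blast
  define M where "M = 1 + (\<Sum>i<d. \<bar>g i\<bar>)"
  have M: "M > 0" by (simp add: M_def sum_nonneg add_pos_nonneg)
  have "fscale (r / M) g \<in> diff_body C"
  proof (rule r(2)[rule_format])
    show "fscale (r / M) g \<in> Edim d" using g latticeD(1)[OF L] by (auto simp: primitive_def intro: Edim_scale)
    fix i assume "i < d"
    then have "\<bar>g i\<bar> < M"
      using member_le_sum[of i "{..<d}" "\<lambda>i. \<bar>g i\<bar>"] by (simp add: M_def)
    then show "\<bar>fscale (r / M) g i\<bar> < r" using r(1) M by (simp add: abs_mult pos_divide_less_eq)
  qed
  moreover have "r / M > 0" using r(1) M by simp
  ultimately have "r / M \<in> chord_lengths L C" using g unfolding chord_lengths_def by blast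
  then show ?thesis by blast
qed

lemma lattice_diam_pos:
  assumes L: "lattice d L" and d: "d \<ge> 1" and C: "convex_body d C"
  shows "lattice_diam d L C > 0"
proof -
  obtain s where s: "s \<in> chord_lengths L C" using chord_lengths_nonempty[OF assms] by blast
  then have "s \<le> lattice_diam d L C" "s > 0"
    using le_lattice_diam[OF L C] unfolding chord_lengths_def by blast+
  then show ?thesis by linarith
qed

text \<open>With v, \<open>diam_directions\<close> contains all nonzero integer multiples of v and
  is therefore infinite once nonempty. Counting requires primitive representatives.\<close>

definition diam_primitive :: "nat \<Rightarrow> (nat \<Rightarrow> real) set \<Rightarrow> (nat \<Rightarrow> real) set \<Rightarrow> (nat \<Rightarrow> real) set" where
  "diam_primitive d L C = {v. primitive L v \<and> fscale (lattice_diam d L C) v \<in> diff_body C}"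

lemma finite_long_chords:
  assumes L: "lattice d L" and C: "convex_body d C" and s: "s > 0"
  shows "finite {v. primitive L v \<and> fscale s v \<in> diff_body C}"
proof -
  obtain R where R: "R > 0" "\<And>x i. x \<in> diff_body C \<Longrightarrow> i < d \<Longrightarrow> \<bar>x i\<bar> \<le> R"
    using diff_body_bounded[OF convex_bodyD(2)[OF C]] by metis
  have "{v. primitive L v \<and> fscale s v \<in> diff_body C} \<subseteq> {v \<in> L. \<forall>i<d. \<bar>v i\<bar> \<le> R / s}"
  proof clarify
    fix v assume v: "primitive L v" "fscale s v \<in> diff_body C"
    have "\<bar>v i\<bar> \<le> R / s" if "i < d" for i
      using R(2)[OF v(2) that] s by (simp add: abs_mult pos_le_divide_eq mult.commute)
    then show "v \<in> L \<and> (\<forall>i<d. \<bar>v i\<bar> \<le> R / s)" using v by (simp add: primitive_def)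
  qed
  then show ?thesis using finite_lattice_bounded[OF L] by (rule finite_subset)
qed

lemma diam_primitive_subset:
  assumes L: "lattice d L" and d: "d \<ge> 1" and C: "convex_body d C"
  shows "diam_primitive d L C \<subseteq> diam_directions d L C"
proof
  fix v assume v: "v \<in> diam_primitive d L C"
  note Cb = convex_bodyD[OF C]
  let ?s = "lattice_diam d L C"
  have s: "?s > 0" by (rule lattice_diam_pos[OF assms])
  have prim: "primitive L v" using v by (simp add: diam_primitive_def)
  obtain x y where xy: "x - y = fscale ?s v" "x \<in> C" "y \<in> C"
    using v unfolding diam_primitive_def diff_body_def by force
  have "lattice_segment L y x" using lattice_segmentI[OF prim s xy(1)] .
  moreover have "segment_in y x C" using segment_in_iff[OF Cb(3)] xy by blast
  moreover have "lattice_length d L y x = ?s" using lattice_length_eq[OF L prim s xy(1)] .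
  moreover have "v \<in> L - {0}" using prim by (auto simp: primitive_def)
  ultimately show "v \<in> diam_directions d L C" unfolding diam_directions_def using xy(1) by blast
qed

text \<open>If v - w = 3g, symmetry and convexity put half the diameter times v - w into C - C. This
  is 3/2 of the diameter times g, a chord that is too long.\<close>

lemma card_diam_primitive:
  assumes L: "lattice d L" and d: "d \<ge> 1" and C: "convex_body d C"
  shows "card (diam_primitive d L C) \<le> 3 ^ fvec.dim (diam_directions d L C)"
proof (rule card_incongruent_mod_3_le)
  let ?s = "lattice_diam d L C" and ?K = "diff_body C"
  note K = diff_body_props[OF C]
  have s: "?s > 0" by (rule lattice_diam_pos[OF assms])
  fix v w g assume v: "v \<in> diam_primitive d L C" and w: "w \<in> diam_primitive d L C"
    and g: "g \<in> L" and e: "v - w = fscale 3 g"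
  show "v = w"
  proof (rule ccontr)
    assume "v \<noteq> w"
    then have "g \<noteq> 0" using e by auto
    then obtain g0 m where g0: "primitive L g0" "m \<ge> (1::int)" "g = fscale (of_int m) g0"
      using primitive_exists[OF L g] by metis
    have "fscale (1 - 1/2) (fscale ?s v) + fscale (1/2) (- fscale ?s w) \<in> ?K"
      using v w K(4) by (intro convex_setD[OF K(3)]) (auto simp: diam_primitive_def)
    also have "fscale (1 - 1/2) (fscale ?s v) + fscale (1/2) (- fscale ?s w) = fscale (?s / 2) (v - w)"
      by (simp add: fun_eq_iff algebra_simps)
    also have "\<dots> = fscale (?s * 3 / 2 * of_int m) g0" unfolding e g0(3) by simp
    finally have mem: "fscale (?s * 3 / 2 * of_int m) g0 \<in> ?K" .
    have "?s * 3 / 2 * of_int m \<le> ?s"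
      using s g0(2) by (intro le_lattice_diam[OF L C g0(1) _ mem]) simp
    moreover have "?s * 3 / 2 * 1 \<le> ?s * 3 / 2 * of_int m" using s g0(2) by (intro mult_left_mono) auto
    ultimately show False using s by linarith
  qed
next
  show "diam_primitive d L C \<subseteq> fvec.span (diam_directions d L C)"
    using diam_primitive_subset[OF assms] fvec.span_superset by blast
  show "diam_primitive d L C \<subseteq> L" by (auto simp: diam_primitive_def primitive_def)
  show "finite (diam_primitive d L C)"
    unfolding diam_primitive_def by (rule finite_long_chords[OF L C lattice_diam_pos[OF assms]])
  show "diam_directions d L C \<subseteq> L" by (auto simp: diam_directions_def)
  show "finite {g \<in> L. \<forall>i<d. \<bar>g i\<bar> \<le> R}" for R by (rule finite_lattice_bounded[OF L])
  show "L \<subseteq> Edim d" "0 \<in> L" using latticeD[OF L] by auto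
  show "x - y \<in> L" if "x \<in> L" "y \<in> L" for x y using that by (rule latticeD(3)[OF L])
qed

text \<open>Closedness of C - C gives a suitable t for each single v. One t serves all of them
  because only finitely many v have half the diameter times v in C - C; for the others any t from
  half the diameter on works.\<close>

lemma diam_gap:
  assumes L: "lattice d L" and d: "d \<ge> 1" and C: "convex_body d C"
  obtains t where "0 < t" "t < lattice_diam d L C"
    "\<And>v. primitive L v \<Longrightarrow> v \<notin> diam_primitive d L C \<Longrightarrow> fscale t v \<notin> diff_body C"
proof -
  let ?s = "lattice_diam d L C" and ?K = "diff_body C"
  note K = diff_body_props[OF C]
  have s: "?s > 0" by (rule lattice_diam_pos[OF assms])
  have K0: "0 \<in> ?K" using K(5) by force
  define V where "V = {v. primitive L v \<and> fscale (?s / 2) v \<in> ?K} - diam_primitive d L C"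
  have finV: "finite V" unfolding V_def using finite_long_chords[OF L C, of "?s / 2"] s by simp
  have "\<exists>t. ?s / 2 \<le> t \<and> t < ?s \<and> fscale t v \<notin> ?K" if "v \<in> V" for v
  proof -
    have "fscale ?s v \<notin> ?K" using that by (auto simp: V_def diam_primitive_def)
    moreover have "continuous_on UNIV (\<lambda>t. fscale t v)" by (intro continuous_on_vec)
    then have "open (- ((\<lambda>t. fscale t v) -` ?K))"
      by (intro open_Compl closed_vimage compact_imp_closed[OF K(2)])
    ultimately obtain e where e: "e > 0" "ball ?s e \<subseteq> - ((\<lambda>t. fscale t v) -` ?K)"
      using openE by (metis ComplI vimageE)
    define t where "t = ?s - min e ?s / 2"
    have "t \<in> ball ?s e" using e(1) s by (auto simp: t_def dist_real_def)
    then have "fscale t v \<notin> ?K" using e(2) by blast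
    moreover have "?s / 2 \<le> t" "t < ?s" using e(1) s by (auto simp: t_def)
    ultimately show ?thesis by blast
  qed
  then obtain f where f: "\<And>v. v \<in> V \<Longrightarrow> ?s / 2 \<le> f v \<and> f v < ?s \<and> fscale (f v) v \<notin> ?K" by metis
  define t where "t = Max (insert (?s / 2) (f ` V))"
  have t: "?s / 2 \<le> t" "\<And>v. v \<in> V \<Longrightarrow> f v \<le> t"
    unfolding t_def by (rule Max_ge; use finV in simp)+
  have "t < ?s" using finV f s unfolding t_def by simp
  show thesis
  proof (rule that[of t])
    show "0 < t" "t < ?s" using t(1) s \<open>t < ?s\<close> by linarith+
    fix v assume v: "primitive L v" "v \<notin> diam_primitive d L C"
    show "fscale t v \<notin> ?K"
    proof
      assume tv: "fscale t v \<in> ?K"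
      then have "fscale (?s / 2) v \<in> ?K" using convex_set_star[OF K(3) K0 tv, of "?s / 2"] t s by simp
      then have V: "v \<in> V" using v by (simp add: V_def)
      then have "fscale (f v) v \<in> ?K" using convex_set_star[OF K(3) K0 tv, of "f v"] t(2)[OF V] f[OF V] s by simp
      then show False using f[OF V] by blast
    qed
  qed
qed

text \<open>The Minkowski sum of C with the segment from 0 to e z, the enlargement used against
  completeness.\<close>

lemma convex_body_sweep:
  assumes C: "convex_body d C" and z: "z \<in> Edim d" and e: "e \<ge> 0"
  defines "C' \<equiv> {x + fscale t z | x t. x \<in> C \<and> 0 \<le> t \<and> t \<le> e}"
  shows "convex_body d C'" "C \<subseteq> C'"
proof -
  note Cb = convex_bodyD[OF C]
  show sub: "C \<subseteq> C'"
  proof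
    fix x assume "x \<in> C"
    moreover have "x = x + fscale 0 z" by simp
    ultimately show "x \<in> C'" unfolding C'_def using e by blast
  qed
  have "C' = (\<lambda>p. fst p + fscale (snd p) z) ` (C \<times> {0..e})"
    unfolding C'_def by force
  moreover have "compact \<dots>"
    by (intro compact_continuous_image compact_Times Cb continuous_on_vec compact_Icc)
  ultimately have "compact C'" by simp
  moreover have "convex_set C'"
    unfolding convex_set_def
  proof (intro ballI allI impI)
    fix p q t assume "p \<in> C'" "q \<in> C'" and t: "0 \<le> t \<and> (t::real) \<le> 1"
    then obtain x a y b where p: "p = x + fscale a z" "x \<in> C" "0 \<le> a" "a \<le> e"
      and q: "q = y + fscale b z" "y \<in> C" "0 \<le> b" "b \<le> e"
      unfolding C'_def by blast
    have "fscale (1 - t) p + fscale t q = (fscale (1 - t) x + fscale t y) + fscale ((1 - t) * a + t * b) z"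
      by (simp add: p q fun_eq_iff algebra_simps)
    moreover have "fscale (1 - t) x + fscale t y \<in> C" using convex_setD[OF Cb(3)] p q t by auto
    moreover have "0 \<le> (1 - t) * a + t * b" using p q t by simp
    moreover have "(1 - t) * a + t * b \<le> e" using p q t by (intro convex_bound_le) auto
    ultimately show "fscale (1 - t) p + fscale t q \<in> C'" unfolding C'_def by blast
  qed
  moreover have "C' \<subseteq> Edim d" using Cb(1) z unfolding C'_def by (auto intro: Edim_add Edim_scale)
  moreover obtain x r where x: "x \<in> C" "r > 0"
    and cube: "\<And>y. y \<in> Edim d \<Longrightarrow> (\<And>i. i < d \<Longrightarrow> \<bar>y i - x i\<bar> < r) \<Longrightarrow> y \<in> C"
    using convex_body_cubeE[OF C] by blast
  then have "\<exists>x\<in>C'. \<exists>r>0. \<forall>y\<in>Edim d. (\<forall>i<d. \<bar>y i - x i\<bar> < r) \<longrightarrow> y \<in> C'"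
    using sub by (intro bexI[of _ x] exI[of _ r]) auto
  ultimately show "convex_body d C'" unfolding convex_body_iff by simp
qed

lemma lattice_complete_dim_bound:
  assumes L: "lattice d L" and d: "d \<ge> 1" and comp: "lattice_complete d L C"
  shows "d \<le> 3 ^ fvec.dim (diam_directions d L C)"
proof -
  have C: "convex_body d C" using comp by (simp add: lattice_complete_def)
  note Cb = convex_bodyD[OF C]
  let ?s = "lattice_diam d L C" and ?K = "diff_body C" and ?D = "diam_primitive d L C"
  note K = diff_body_props[OF C]
  have s: "?s > 0" by (rule lattice_diam_pos[OF L d C])
  have finD: "finite ?D"
    unfolding diam_primitive_def by (rule finite_long_chords[OF L C s])
  obtain r where r: "r > 0" "\<And>y. y \<in> Edim d \<Longrightarrow> (\<And>i. i < d \<Longrightarrow> \<bar>y i\<bar> < r) \<Longrightarrow> y \<in> ?K"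
    using K(5) by blast
  \<comment> \<open>Maximality of the diameter makes \<open>fscale ?s v\<close> a boundary point of
    C - C, so a supporting functional exists there.\<close>
  have "\<exists>u\<in>Edim d. ip d u (fscale ?s v) = 1 \<and> (\<forall>x\<in>?K. ip d u x \<le> 1)" if v: "v \<in> ?D" for v
  proof (rule support_functional[OF K(1-3) r])
    have prim: "primitive L v" using v by (simp add: diam_primitive_def)
    then show "fscale ?s v \<in> Edim d" using latticeD(1)[OF L] by (auto simp: primitive_def intro: Edim_scale)
    fix t :: real assume t: "t > 1"
    show "fscale t (fscale ?s v) \<notin> ?K"
    proof
      assume "fscale t (fscale ?s v) \<in> ?K"
      then have "t * ?s \<le> ?s" using t s by (intro le_lattice_diam[OF L C prim]) auto
      then show False using t s by simp
    qed
  qed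
  then obtain u where u: "\<And>v. v \<in> ?D \<Longrightarrow> ip d (u v) (fscale ?s v) = 1"
      "\<And>v x. v \<in> ?D \<Longrightarrow> x \<in> ?K \<Longrightarrow> ip d (u v) x \<le> 1"
    by metis
  have "d \<le> card ?D"
  proof (rule ccontr)
    assume "\<not> d \<le> card ?D"
    then have "card (u ` ?D) < d" using card_image_le[OF finD, of u] by linarith
    then obtain z where z: "z \<in> Edim d" "z \<noteq> 0" "\<And>v. v \<in> ?D \<Longrightarrow> ip d z (u v) = 0"
      using exists_orthogonal[of "u ` ?D" d] finD by auto
    obtain t where t: "0 < t" "t < ?s"
      "\<And>v. primitive L v \<Longrightarrow> v \<notin> ?D \<Longrightarrow> fscale t v \<notin> ?K"
      using diam_gap[OF L d C] by metis
    \<comment> \<open>Since (1 + \<eta>) t is the diameter, even (1 + \<eta>) (C - C) has no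
      non-extremal chord longer than the diameter.\<close>
    define \<eta> where "\<eta> = ?s / t - 1"
    have \<eta>: "\<eta> > 0" "(1 + \<eta>) * t = ?s" using t by (simp_all add: \<eta>_def)
    define M where "M = 1 + (\<Sum>i<d. \<bar>z i\<bar>)"
    have M: "M > 0" by (simp add: M_def sum_nonneg add_pos_nonneg)
    \<comment> \<open>Small enough that a z lies in \<eta> (C - C) whenever |a| \<le> \<epsilon>;
      hence C' - C' is contained in (1 + \<eta>) (C - C).\<close>
    define \<epsilon> where "\<epsilon> = \<eta> * r / M"
    have \<epsilon>: "\<epsilon> > 0" using \<eta> r M by (simp add: \<epsilon>_def)
    have small: "fscale (a / \<eta>) z \<in> ?K" if a: "\<bar>a\<bar> \<le> \<epsilon>" for a
    proof (rule r(2))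
      show "fscale (a / \<eta>) z \<in> Edim d" by (intro Edim_scale z)
      fix i assume "i < d"
      then have zi: "\<bar>z i\<bar> < M"
        using member_le_sum[of i "{..<d}" "\<lambda>i. \<bar>z i\<bar>"] by (simp add: M_def)
      have "\<bar>a / \<eta>\<bar> \<le> r / M"
        using a \<eta>(1) M by (simp add: \<epsilon>_def pos_divide_le_eq abs_divide mult.commute)
      then have "\<bar>a / \<eta>\<bar> * \<bar>z i\<bar> \<le> r / M * \<bar>z i\<bar>" by (intro mult_right_mono) auto
      also have "\<dots> < r / M * M" using zi r(1) M by (intro mult_strict_left_mono) auto
      finally show "\<bar>fscale (a / \<eta>) z i\<bar> < r" using M by (simp add: abs_mult)
    qed
    define C' where "C' = {x + fscale t z | x t. x \<in> C \<and> 0 \<le> t \<and> t \<le> \<epsilon>}"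
    have C': "convex_body d C'" "C \<subseteq> C'"
      unfolding C'_def by (rule convex_body_sweep[OF C z(1) less_imp_le[OF \<epsilon>]])+
    note Cb' = convex_bodyD[OF C'(1)]
    have le: "c \<le> ?s" if c: "c \<in> chord_lengths L C'" for c
    proof -
      obtain v where v: "c > 0" "primitive L v" "fscale c v \<in> diff_body C'"
        using c unfolding chord_lengths_def by blast
      then obtain x a y b where xy: "fscale c v = (x + fscale a z) - (y + fscale b z)"
        "x \<in> C" "y \<in> C" "0 \<le> a" "a \<le> \<epsilon>" "0 \<le> b" "b \<le> \<epsilon>"
        unfolding diff_body_def C'_def by blast
      define \<kappa> where "\<kappa> = x - y"
      have \<kappa>: "\<kappa> \<in> ?K" using xy unfolding \<kappa>_def diff_body_def by blast
      have cv: "fscale c v = \<kappa> + fscale (a - b) z"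
        by (simp add: xy(1) \<kappa>_def fun_eq_iff algebra_simps)
      show ?thesis
      proof (cases "v \<in> ?D")
        case True
        \<comment> \<open>The sweep along z is invisible to the functional that bounds this extremal
          direction.\<close>
        have "ip d (u v) (fscale c v) = ip d (u v) \<kappa>"
          using z(3)[OF True] by (simp add: cv ip_simps ip_commute[of d "u v" z])
        then have "c * ip d (u v) v \<le> 1" using u(2)[OF True \<kappa>] by (simp add: ip_simps)
        moreover have "ip d (u v) v = 1 / ?s" using u(1)[OF True] s by (simp add: ip_simps field_simps)
        ultimately show ?thesis using s by (simp add: pos_divide_le_eq)
      next
        case False
        show ?thesis
        proof (rule ccontr)
          assume "\<not> c \<le> ?s"
          have "\<bar>a - b\<bar> \<le> \<epsilon>" using xy by linarith
          then have "fscale (1 - \<eta> / (1 + \<eta>)) \<kappa> + fscale (\<eta> / (1 + \<eta>)) (fscale ((a - b) / \<eta>) z) \<in> ?K"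
            using \<eta>(1) \<kappa> by (intro convex_setD[OF K(3)] small) auto
          also have "1 - \<eta> / (1 + \<eta>) = 1 / (1 + \<eta>)" using \<eta>(1) by (simp add: field_simps)
          also have "fscale (1 / (1 + \<eta>)) \<kappa> + fscale (\<eta> / (1 + \<eta>)) (fscale ((a - b) / \<eta>) z)
              = fscale (1 / (1 + \<eta>)) (fscale c v)"
            unfolding cv using \<eta>(1) by (simp add: fun_eq_iff add_divide_distrib)
          finally have "fscale (c / (1 + \<eta>)) v \<in> ?K"
            by (simp only: fscale_fscale times_divide_eq_left mult_1)
          moreover have "t \<le> c / (1 + \<eta>)"
            using \<open>\<not> c \<le> ?s\<close> \<eta> by (simp add: pos_le_divide_eq mult.commute)
          moreover have "0 \<in> ?K" by (rule r(2)) (use r(1) in simp_all)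
          ultimately have "fscale t v \<in> ?K"
            using t(1) convex_set_star[OF K(3), of "c / (1 + \<eta>)" v t] by simp
          then show False using t(3) v(2) False by blast
        qed
      qed
    qed
    have "lattice_diam d L C' \<le> ?s"
      unfolding lattice_diam_eq[OF L Cb'(3)]
      by (rule cSup_least[OF chord_lengths_nonempty[OF L d C'(1)] le])
    moreover have "?s \<le> lattice_diam d L C'"
      unfolding lattice_diam_eq[OF L Cb'(3)] lattice_diam_eq[OF L Cb(3)]
    proof (rule cSup_subset_mono[OF chord_lengths_nonempty[OF L d C] bdd_above_chord_lengths[OF L Cb'(2)]])
      show "chord_lengths L C \<subseteq> chord_lengths L C'"
        using diff_body_mono[OF C'(2)] unfolding chord_lengths_def by blast
    qed
    ultimately have "lattice_diam d L C' = ?s" by simp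
    then have eq: "C' = C" using comp C' unfolding lattice_complete_def by blast
    \<comment> \<open>The sweep really enlarges C: at a maximiser x of z on C, the point x +
      \<epsilon> z exceeds the maximum.\<close>
    have "continuous_on C (ip d z)" by (intro continuous_on_vec)
    then obtain x where x: "x \<in> C" "\<And>y. y \<in> C \<Longrightarrow> ip d z y \<le> ip d z x"
      using continuous_attains_sup[OF Cb(2,4)] by blast
    have "x + fscale \<epsilon> z \<in> C'" using x(1) \<epsilon> unfolding C'_def by force
    then have "ip d z (x + fscale \<epsilon> z) \<le> ip d z x" unfolding eq by (rule x(2))
    then have "\<epsilon> * ip d z z \<le> 0" by (simp add: ip_simps)
    then show False using \<epsilon> ip_self_pos[OF z(1,2)] by (simp add: mult_le_0_iff)
  qed
  then show ?thesis using card_diam_primitive[OF L d C] by linarith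
qed

section \<open>Bodies from dual systems\<close>

definition scaled_lattice :: "nat \<Rightarrow> (nat \<Rightarrow> real) \<Rightarrow> (nat \<Rightarrow> real) set" where
  "scaled_lattice d s = {x \<in> Edim d. \<forall>i<d. \<exists>k::int. x i = of_int k * s i}"

lemma scaled_lattice_uvec: "i < d \<Longrightarrow> fscale (s i) (uvec i) \<in> scaled_lattice d s"
  unfolding scaled_lattice_def
proof (intro CollectI conjI allI impI)
  show "i < d \<Longrightarrow> fscale (s i) (uvec i) \<in> Edim d" by (intro Edim_scale uvec_Edim)
  show "\<exists>k::int. fscale (s i) (uvec i) j = of_int k * s j" for j
    by (rule exI[of _ "if j = i then 1 else 0"]) (simp add: uvec_apply)
qed

lemma lattice_scaled_lattice:
  assumes s: "\<And>i. i < d \<Longrightarrow> s i > 0"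
  shows "lattice d (scaled_lattice d s)"
  unfolding lattice_def
proof (intro conjI ballI)
  let ?L = "scaled_lattice d s"
  show LE: "?L \<subseteq> Edim d" by (auto simp: scaled_lattice_def)
  have "\<exists>k::int. (0::nat \<Rightarrow> real) i = of_int k * s i" for i by (rule exI[of _ 0]) simp
  then show "0 \<in> ?L" unfolding scaled_lattice_def by simp
  show "x - y \<in> ?L" if x: "x \<in> ?L" and y: "y \<in> ?L" for x y
    unfolding scaled_lattice_def
  proof (intro CollectI conjI allI impI)
    show "x - y \<in> Edim d" using x y LE by (blast intro: Edim_diff)
    fix i assume "i < d"
    then obtain a b :: int where "x i = of_int a * s i" "y i = of_int b * s i"
      using x y unfolding scaled_lattice_def by blast
    then show "\<exists>k::int. (x - y) i = of_int k * s i"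
      by (intro exI[of _ "a - b"]) (simp add: algebra_simps)
  qed
  show "\<not> x islimpt ?L" if x: "x \<in> ?L" for x
  proof -
    define T where "T = {y. \<forall>i\<in>{..<d}. y i \<in> ball (x i) (s i)}"
    have "open T" unfolding T_def by (rule product_topology_basis') auto
    moreover have "x \<in> T" using s by (auto simp: T_def)
    moreover have "y = x" if y: "y \<in> ?L" "y \<in> T" for y
    proof (rule Edim_eqI[of _ d])
      show "y \<in> Edim d" "x \<in> Edim d" using x y LE by auto
      fix i assume i: "i < d"
      then obtain a b :: int where ab: "x i = of_int a * s i" "y i = of_int b * s i"
        using x y unfolding scaled_lattice_def by blast
      have "\<bar>x i - y i\<bar> < s i" using y(2) i by (auto simp: T_def dist_real_def)
      also have "x i - y i = of_int (a - b) * s i" by (simp add: ab algebra_simps)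
      finally have "\<bar>of_int (a - b)\<bar> * s i < 1 * s i" using s[OF i] by (simp add: abs_mult)
      then have "\<bar>of_int (a - b) :: real\<bar> < 1" using s[OF i] by (simp only: mult_less_cancel_right_pos)
      then have "a = b" by linarith
      then show "y i = x i" using ab by simp
    qed
    ultimately show ?thesis unfolding islimpt_def by blast
  qed
  show "fvec.span ?L = Edim d"
  proof
    show "fvec.span ?L \<subseteq> Edim d" by (rule fvec.span_minimal[OF LE subspace_Edim])
    have "uvec i \<in> fvec.span ?L" if i: "i < d" for i
    proof -
      have "fscale (1 / s i) (fscale (s i) (uvec i)) \<in> fvec.span ?L"
        by (intro fvec.span_scale fvec.span_base scaled_lattice_uvec i)
      then show ?thesis using s[OF i] by simp
    qed
    then show "Edim d \<subseteq> fvec.span ?L"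
      unfolding span_uvec[symmetric] by (intro fvec.span_minimal fvec.subspace_span) auto
  qed
qed

lemma dual_scaled_lattice:
  assumes s: "\<And>i. i < d \<Longrightarrow> s i > 0"
  shows "dual_lattice d (scaled_lattice d s) = scaled_lattice d (\<lambda>i. 1 / s i)"
proof
  show "dual_lattice d (scaled_lattice d s) \<subseteq> scaled_lattice d (\<lambda>i. 1 / s i)"
  proof
    fix y assume y: "y \<in> dual_lattice d (scaled_lattice d s)"
    have "\<exists>k::int. y i = of_int k * (1 / s i)" if i: "i < d" for i
    proof -
      have "ip d (fscale (s i) (uvec i)) y \<in> \<int>"
        using y scaled_lattice_uvec[OF i] unfolding dual_lattice_def by blast
      then obtain k :: int where "s i * y i = of_int k"
        by (auto simp: ip_simps ip_uvec[OF i] ip_commute[of d "uvec i"] elim: Ints_cases)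
      then show ?thesis using s[OF i] by (intro exI[of _ k]) (simp add: field_simps)
    qed
    then show "y \<in> scaled_lattice d (\<lambda>i. 1 / s i)"
      using y by (simp add: scaled_lattice_def dual_lattice_def)
  qed
  show "scaled_lattice d (\<lambda>i. 1 / s i) \<subseteq> dual_lattice d (scaled_lattice d s)"
  proof
    fix y assume y: "y \<in> scaled_lattice d (\<lambda>i. 1 / s i)"
    have "ip d x y \<in> \<int>" if x: "x \<in> scaled_lattice d s" for x
      unfolding ip_def
    proof (rule Ints_sum)
      fix i assume "i \<in> {..<d}"
      then obtain a b :: int where "x i = of_int a * s i" "y i = of_int b * (1 / s i)" "s i > 0"
        using x y s unfolding scaled_lattice_def by blast
      then have "x i * y i = of_int (a * b)" by simp
      then show "x i * y i \<in> \<int>" by (simp only: Ints_of_int)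
    qed
    then show "y \<in> dual_lattice d (scaled_lattice d s)"
      using y by (simp add: scaled_lattice_def dual_lattice_def)
  qed
qed

text \<open>Collects what both sharpness examples use. \<open>cover\<close> keeps the lattice width
  at least 2 and the lattice diameter at most 2, \<open>diag\<close> makes \<open>Y S\<close> attain
  these values, strictness in \<open>off_diag\<close> makes extremal points unique, and
  \<open>spanning\<close> makes the hull full-dimensional and its polar bounded.\<close>

locale dual_system =
  fixes d k :: nat and J :: "'a set" and U Y :: "'a \<Rightarrow> nat \<Rightarrow> real"
  assumes kd: "k \<le> d" and finJ: "finite J" and J_ne: "J \<noteq> {}"
    and U_Edim: "\<And>S. S \<in> J \<Longrightarrow> U S \<in> Edim d"
    and Y_Edim: "\<And>S. S \<in> J \<Longrightarrow> Y S \<in> Edim k"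
    and Y_int: "\<And>S i. S \<in> J \<Longrightarrow> Y S i \<in> \<int>"
    and diag: "\<And>S. S \<in> J \<Longrightarrow> ip d (U S) (Y S) = 1"
    and off_diag: "\<And>S T. S \<in> J \<Longrightarrow> T \<in> J \<Longrightarrow> T \<noteq> S \<Longrightarrow> \<bar>ip d (U T) (Y S)\<bar> < 1"
    and cover: "\<And>x. x \<in> Edim k \<Longrightarrow> x \<noteq> 0 \<Longrightarrow> (\<And>i. x i \<in> \<int>) \<Longrightarrow> \<exists>S\<in>J. 1 \<le> \<bar>ip d (U S) x\<bar>"
    and spanning: "\<And>i. i < d \<Longrightarrow> uvec i \<in> fvec.span (U ` J)"
begin

lemma inj_U: "inj_on U J"
proof (rule inj_onI, rule ccontr)
  fix S T assume "S \<in> J" "T \<in> J" "U S = U T" "S \<noteq> T"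
  then show False using diag[of S] off_diag[of S T] by simp
qed

definition A :: "nat \<Rightarrow> 'a \<Rightarrow> real" where
  "A i = (SOME a. uvec i = (\<Sum>S\<in>J. fscale (a S) (U S)))"

lemma uvec_A: assumes i: "i < d" shows "uvec i = (\<Sum>S\<in>J. fscale (A i S) (U S))"
proof -
  have "uvec i \<in> range (\<lambda>u. \<Sum>v\<in>U ` J. fscale (u v) v)"
    using spanning[OF i] fvec.span_finite[of "U ` J"] finJ by simp
  then obtain u where "uvec i = (\<Sum>v\<in>U ` J. fscale (u v) v)" by blast
  then have "uvec i = (\<Sum>S\<in>J. fscale (u (U S)) (U S))" by (simp only: sum.reindex[OF inj_U] o_def)
  then have "\<exists>a. uvec i = (\<Sum>S\<in>J. fscale (a S) (U S))" by (rule exI[of _ "\<lambda>S. u (U S)"])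
  then show ?thesis unfolding A_def by (rule someI_ex)
qed

text \<open>Expanding unit vectors in the \<open>U S\<close> bounds each coordinate by \<kappa>
  times the largest value of the functionals. The same expansion puts a cube of radius 1 / \<kappa>
  into the hull.\<close>

definition \<kappa> :: real where "\<kappa> = 1 + (\<Sum>i<d. \<Sum>S\<in>J. \<bar>A i S\<bar>)"

lemma \<kappa>_pos: "\<kappa> > 0"
  unfolding \<kappa>_def by (intro add_pos_nonneg sum_nonneg) auto

lemma coord_bound:
  assumes i: "i < d" and m: "\<And>S. S \<in> J \<Longrightarrow> \<bar>ip d (U S) x\<bar> \<le> m"
  shows "\<bar>x i\<bar> \<le> \<kappa> * m"
proof -
  obtain S0 where "S0 \<in> J" using J_ne by blast
  then have m0: "m \<ge> 0" using m[of S0] by linarith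
  have "x i = ip d (uvec i) x" using ip_uvec[OF i] by (simp add: ip_commute)
  also have "\<dots> = (\<Sum>S\<in>J. A i S * ip d (U S) x)"
    unfolding uvec_A[OF i] ip_sum_left ip_simps ..
  finally have "\<bar>x i\<bar> \<le> (\<Sum>S\<in>J. \<bar>A i S * ip d (U S) x\<bar>)" by (simp only: sum_abs)
  also have "\<dots> \<le> (\<Sum>S\<in>J. \<bar>A i S\<bar> * m)"
    unfolding abs_mult by (intro sum_mono mult_left_mono m) auto
  also have "\<dots> = (\<Sum>S\<in>J. \<bar>A i S\<bar>) * m" by (simp add: sum_distrib_right)
  also have "\<dots> \<le> \<kappa> * m"
  proof (rule mult_right_mono[OF _ m0])
    have "(\<Sum>S\<in>J. \<bar>A i S\<bar>) \<le> (\<Sum>j<d. \<Sum>S\<in>J. \<bar>A j S\<bar>)"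
      using i by (intro member_le_sum[of i _ "\<lambda>i. \<Sum>S\<in>J. \<bar>A i S\<bar>"]) (auto intro: sum_nonneg)
    then show "(\<Sum>S\<in>J. \<bar>A i S\<bar>) \<le> \<kappa>" by (simp add: \<kappa>_def)
  qed
  finally show ?thesis .
qed

text \<open>The spacing \<kappa> + 1 exceeds the bound \<kappa> on the coordinates of a vector on
  which all functionals are at most 1 in absolute value.\<close>

definition scl :: "nat \<Rightarrow> real" where "scl i = (if i < k then 1 else \<kappa> + 1)"

lemma scl_pos: "scl i > 0" using \<kappa>_pos by (simp add: scl_def)

text \<open>Outside the first k coordinates the lattice is so sparse that all its vectors are long.\<close>

lemma scaled_long:
  assumes y: "y \<in> scaled_lattice d scl" "y \<notin> Edim k"
  shows "\<exists>S\<in>J. 1 < \<bar>ip d (U S) y\<bar>"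
proof (rule ccontr)
  assume "\<not> (\<exists>S\<in>J. 1 < \<bar>ip d (U S) y\<bar>)"
  then have b: "\<bar>y i\<bar> \<le> \<kappa>" if "i < d" for i using coord_bound[OF that, of y 1] by force
  have "y i = 0" if i: "i \<ge> k" for i
  proof (cases "i < d")
    case True
    then obtain q :: int where q: "y i = of_int q * scl i" using y(1) unfolding scaled_lattice_def by blast
    have "\<bar>of_int q\<bar> * (\<kappa> + 1) \<le> \<kappa>" using b[OF True] i \<kappa>_pos by (simp add: q scl_def abs_mult)
    also have "\<kappa> < 1 * (\<kappa> + 1)" by simp
    finally have "\<bar>of_int q :: real\<bar> < 1" using \<kappa>_pos by (simp only: mult_less_cancel_right_pos)
    then have "q = 0" by linarith
    then show ?thesis using q by simp
  next
    case False
    then show ?thesis using y(1) by (simp add: scaled_lattice_def Edim_def)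
  qed
  then show False using y(2) by (simp add: Edim_def)
qed

lemma scaled_cover:
  assumes y: "y \<in> scaled_lattice d scl" "y \<noteq> 0"
  shows "\<exists>S\<in>J. 1 \<le> \<bar>ip d (U S) y\<bar>"
proof (cases "y \<in> Edim k")
  case True
  have "y i \<in> \<int>" for i
  proof (cases "i < k")
    case i: True
    then obtain q :: int where "y i = of_int q * scl i"
      using y(1) kd unfolding scaled_lattice_def by (blast dest: less_le_trans)
    then show ?thesis using i by (simp add: scl_def)
  next
    case False
    then show ?thesis using True by (simp add: Edim_def)
  qed
  then show ?thesis using cover[OF True y(2)] by blast
next
  case False
  then show ?thesis using scaled_long[OF y(1)] by force
qed

lemma Edim_k: "Edim k \<subseteq> Edim d"
  using kd by (auto simp: Edim_def)

lemma Y_lattice: assumes S: "S \<in> J" shows "Y S \<in> scaled_lattice d scl" "Y S \<noteq> 0"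
proof -
  show "Y S \<noteq> 0" using diag[OF S] by (auto simp: ip_simps)
  have "\<exists>q::int. Y S i = of_int q * scl i" for i
  proof (cases "i < k")
    case True
    obtain q :: int where "Y S i = of_int q" using Y_int[OF S, of i] by (auto elim: Ints_cases)
    then show ?thesis using True by (intro exI[of _ q]) (simp add: scl_def)
  next
    case False
    then show ?thesis using Y_Edim[OF S] by (intro exI[of _ 0]) (simp add: Edim_def)
  qed
  then show "Y S \<in> scaled_lattice d scl"
    unfolding scaled_lattice_def using Y_Edim[OF S] Edim_k by blast
qed

lemma dim_le_k: "V \<subseteq> Edim k \<Longrightarrow> fvec.dim V \<le> k"
  by (rule dim_Edim_le)

section \<open>The reduced example\<close>

definition comb :: "('a \<Rightarrow> real) \<Rightarrow> nat \<Rightarrow> real" where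
  "comb c = (\<Sum>S\<in>J. fscale (c S) (U S))"

text \<open>The convex hull of all \<open>U S\<close> and \<open>- U S\<close>, written as an image
  of the l1 ball so that compactness and equality cases can be read off from the
  coefficients.\<close>

definition symhull :: "(nat \<Rightarrow> real) set" where
  "symhull = {comb c | c. (\<Sum>S\<in>J. \<bar>c S\<bar>) \<le> 1}"

lemma symhull_single: assumes S: "S \<in> J" and a: "\<bar>a\<bar> \<le> 1" shows "fscale a (U S) \<in> symhull"
proof -
  have "comb (\<lambda>T. if T = S then a else 0) = (\<Sum>T\<in>J. if T = S then fscale a (U S) else 0)"
    unfolding comb_def by (intro sum.cong) auto
  also have "\<dots> = fscale a (U S)" using S finJ by (simp only: sum.delta if_True)
  finally have "fscale a (U S) = comb (\<lambda>T. if T = S then a else 0)" ..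
  moreover have "(\<Sum>T\<in>J. \<bar>if T = S then a else 0\<bar>) \<le> 1"
  proof -
    have "(\<Sum>T\<in>J. \<bar>if T = S then a else 0\<bar>) = (\<Sum>T\<in>J. if T = S then \<bar>a\<bar> else 0)"
      by (intro sum.cong) auto
    then show ?thesis using S finJ a by (simp only: sum.delta if_True)
  qed
  ultimately show ?thesis unfolding symhull_def by blast
qed

lemma ip_comb: "ip d (comb c) y = (\<Sum>S\<in>J. c S * ip d (U S) y)"
  unfolding comb_def ip_sum_left ip_simps ..

lemma symhull_convex_body: "convex_body d symhull"
  unfolding convex_body_iff
proof (intro conjI)
  show "symhull \<subseteq> Edim d"
    unfolding symhull_def comb_def using U_Edim by (auto intro!: Edim_sum Edim_scale)
  \<comment> \<open>Pinning the coefficients to 0 outside J loses no combination and makes the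
    coefficient set compact in the full function space.\<close>
  define B where "B = {c. \<forall>S. c S \<in> {(if S \<in> J then -1 else 0)..(if S \<in> J then 1 else 0::real)}}"
  define N where "N = {c. (\<Sum>S\<in>J. \<bar>c S\<bar>) \<le> (1::real)}"
  have coord: "continuous_on X (\<lambda>c. c S)" for X and S :: 'a
    by (rule continuous_on_subset[OF continuous_on_product_coordinates]) simp
  have "closed N" unfolding N_def
    by (intro closed_Collect_le continuous_on_sum continuous_on_rabs coord continuous_on_const)
  then have "compact (B \<inter> N)"
    unfolding B_def by (intro compact_Int_closed compact_fun_box)
  moreover have "continuous_on (B \<inter> N) comb"
  proof (rule continuous_on_coordinatewise_then_product)
    fix i
    have "comb c i = (\<Sum>S\<in>J. c S * U S i)" for c
      unfolding comb_def sum_fun_eval by simp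
    then show "continuous_on (B \<inter> N) (\<lambda>c. comb c i)"
      by (simp only:) (intro continuous_on_sum continuous_on_mult coord continuous_on_const)
  qed
  ultimately have "compact (comb ` (B \<inter> N))" by (rule compact_continuous_image[rotated])
  moreover have "comb ` (B \<inter> N) = symhull"
  proof
    show "comb ` (B \<inter> N) \<subseteq> symhull" unfolding symhull_def N_def by blast
    show "symhull \<subseteq> comb ` (B \<inter> N)"
    proof
      fix x assume "x \<in> symhull"
      then obtain c where c: "x = comb c" "(\<Sum>S\<in>J. \<bar>c S\<bar>) \<le> 1" unfolding symhull_def by blast
      define c' where "c' S = (if S \<in> J then c S else 0)" for S
      have "\<bar>c S\<bar> \<le> 1" if "S \<in> J" for S
        using member_le_sum[of S J "\<lambda>S. \<bar>c S\<bar>"] that finJ c(2) by simp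
      then have "c' \<in> B" by (auto simp: B_def c'_def abs_le_iff minus_le_iff)
      moreover have "c' \<in> N" using c(2) by (simp add: N_def c'_def)
      moreover have "x = comb c'" unfolding c(1) comb_def c'_def by (intro sum.cong) auto
      ultimately show "x \<in> comb ` (B \<inter> N)" by blast
    qed
  qed
  ultimately show "compact symhull" by simp
  show "convex_set symhull"
    unfolding convex_set_def
  proof (intro ballI allI impI)
    fix p q t assume "p \<in> symhull" "q \<in> symhull" and t: "0 \<le> t \<and> (t::real) \<le> 1"
    then obtain a b where p: "p = comb a" "(\<Sum>S\<in>J. \<bar>a S\<bar>) \<le> 1" and q: "q = comb b" "(\<Sum>S\<in>J. \<bar>b S\<bar>) \<le> 1"
      unfolding symhull_def by blast
    have "fscale (1 - t) p + fscale t q = comb (\<lambda>S. (1 - t) * a S + t * b S)"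
      unfolding p q comb_def fvec.scale_sum_right sum.distrib[symmetric]
      by (intro sum.cong) (auto simp: fun_eq_iff algebra_simps)
    moreover have "(\<Sum>S\<in>J. \<bar>(1 - t) * a S + t * b S\<bar>) \<le> 1"
    proof -
      have "(\<Sum>S\<in>J. \<bar>(1 - t) * a S + t * b S\<bar>) \<le> (\<Sum>S\<in>J. (1 - t) * \<bar>a S\<bar> + t * \<bar>b S\<bar>)"
      proof (rule sum_mono)
        fix S
        have "\<bar>(1 - t) * a S + t * b S\<bar> \<le> \<bar>(1 - t) * a S\<bar> + \<bar>t * b S\<bar>" by (rule abs_triangle_ineq)
        then show "\<bar>(1 - t) * a S + t * b S\<bar> \<le> (1 - t) * \<bar>a S\<bar> + t * \<bar>b S\<bar>"
          using t by (simp add: abs_mult)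
      qed
      also have "\<dots> = (1 - t) * (\<Sum>S\<in>J. \<bar>a S\<bar>) + t * (\<Sum>S\<in>J. \<bar>b S\<bar>)"
        by (simp add: sum.distrib sum_distrib_left)
      also have "\<dots> \<le> 1" using p(2) q(2) t by (intro convex_bound_le) auto
      finally show ?thesis .
    qed
    ultimately show "fscale (1 - t) p + fscale t q \<in> symhull" unfolding symhull_def by blast
  qed
  show "\<exists>x\<in>symhull. \<exists>r>0. \<forall>y\<in>Edim d. (\<forall>i<d. \<bar>y i - x i\<bar> < r) \<longrightarrow> y \<in> symhull"
  proof (intro bexI[of _ 0] exI[of _ "1 / \<kappa>"] conjI ballI impI)
    show "1 / \<kappa> > 0" using \<kappa>_pos by simp
    obtain S where "S \<in> J" using J_ne by blast
    from symhull_single[OF this, of 0] show "0 \<in> symhull" by simp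
    fix y assume y: "y \<in> Edim d" "\<forall>i<d. \<bar>y i - 0 i\<bar> < 1 / \<kappa>"
    have "y = (\<Sum>i<d. fscale (y i) (\<Sum>S\<in>J. fscale (A i S) (U S)))"
      using Edim_sum_uvec[OF y(1)] by (simp add: uvec_A)
    also have "\<dots> = (\<Sum>S\<in>J. \<Sum>i<d. fscale (y i * A i S) (U S))"
      unfolding fvec.scale_sum_right fscale_fscale by (rule sum.swap)
    also have "\<dots> = comb (\<lambda>S. \<Sum>i<d. y i * A i S)"
      unfolding comb_def fvec.scale_sum_left ..
    finally have "y = comb (\<lambda>S. \<Sum>i<d. y i * A i S)" .
    moreover have "(\<Sum>S\<in>J. \<bar>\<Sum>i<d. y i * A i S\<bar>) \<le> 1"
    proof -
      have "(\<Sum>S\<in>J. \<bar>\<Sum>i<d. y i * A i S\<bar>) \<le> (\<Sum>S\<in>J. \<Sum>i<d. 1 / \<kappa> * \<bar>A i S\<bar>)"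
      proof (rule sum_mono)
        fix S
        have "\<bar>\<Sum>i<d. y i * A i S\<bar> \<le> (\<Sum>i<d. \<bar>y i * A i S\<bar>)" by (rule sum_abs)
        also have "\<dots> \<le> (\<Sum>i<d. 1 / \<kappa> * \<bar>A i S\<bar>)"
          unfolding abs_mult using y(2) by (intro sum_mono mult_right_mono) (auto intro: less_imp_le)
        finally show "\<bar>\<Sum>i<d. y i * A i S\<bar> \<le> (\<Sum>i<d. 1 / \<kappa> * \<bar>A i S\<bar>)" .
      qed
      also have "\<dots> = 1 / \<kappa> * (\<Sum>i<d. \<Sum>S\<in>J. \<bar>A i S\<bar>)"
        unfolding sum_distrib_left by (rule sum.swap)
      also have "\<dots> \<le> 1 / \<kappa> * \<kappa>" using \<kappa>_pos by (intro mult_left_mono) (auto simp: \<kappa>_def)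
      also have "\<dots> = 1" using \<kappa>_pos by simp
      finally show ?thesis .
    qed
    ultimately show "y \<in> symhull" unfolding symhull_def by blast
  qed
qed

lemma off_diag_le: "S \<in> J \<Longrightarrow> T \<in> J \<Longrightarrow> \<bar>ip d (U T) (Y S)\<bar> \<le> 1"
  using diag[of S] off_diag[of S T] by (cases "T = S") auto

lemma symhull_ip_le:
  assumes x: "x \<in> symhull" and S: "S \<in> J" shows "\<bar>ip d x (Y S)\<bar> \<le> 1"
proof -
  obtain c where c: "x = comb c" "(\<Sum>S\<in>J. \<bar>c S\<bar>) \<le> 1" using x unfolding symhull_def by blast
  have "\<bar>ip d x (Y S)\<bar> \<le> (\<Sum>T\<in>J. \<bar>c T * ip d (U T) (Y S)\<bar>)" unfolding c(1) ip_comb by (rule sum_abs)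
  also have "\<dots> \<le> (\<Sum>T\<in>J. \<bar>c T\<bar> * 1)"
    unfolding abs_mult by (intro sum_mono mult_left_mono off_diag_le S) auto
  finally show ?thesis using c(2) by simp
qed

text \<open>Equality in the chain sum c_T u_T(y_S) \<le> sum |c_T| \<le> 1 forces c_T = 0 wherever
  |u_T(y_S)| < 1, that is, for all T other than S.\<close>

lemma symhull_ip_eq:
  assumes x: "x \<in> symhull" and S: "S \<in> J" and eq: "ip d x (Y S) = 1"
  shows "x = U S"
proof -
  obtain c where c: "x = comb c" "(\<Sum>S\<in>J. \<bar>c S\<bar>) \<le> 1" using x unfolding symhull_def by blast
  define m where "m T = ip d (U T) (Y S)" for T
  have nonneg: "0 \<le> \<bar>c T\<bar> - c T * m T" if "T \<in> J" for T
  proof -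
    have "c T * m T \<le> \<bar>c T\<bar> * \<bar>m T\<bar>" by (metis abs_ge_self abs_mult)
    also have "\<dots> \<le> \<bar>c T\<bar> * 1" using off_diag_le[OF S that] by (intro mult_left_mono) (auto simp: m_def)
    finally show ?thesis by simp
  qed
  have "(\<Sum>T\<in>J. \<bar>c T\<bar> - c T * m T) = (\<Sum>T\<in>J. \<bar>c T\<bar>) - 1"
    using eq unfolding c(1) ip_comb by (simp add: sum_subtractf m_def)
  then have "(\<Sum>T\<in>J. \<bar>c T\<bar> - c T * m T) = 0"
    using c(2) sum_nonneg[of J "\<lambda>T. \<bar>c T\<bar> - c T * m T"] nonneg by force
  then have z: "\<bar>c T\<bar> = c T * m T" if "T \<in> J" for T
    using sum_nonneg_eq_0_iff[of J "\<lambda>T. \<bar>c T\<bar> - c T * m T"] nonneg finJ that by auto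
  have c0: "c T = 0" if T: "T \<in> J" "T \<noteq> S" for T
  proof (rule ccontr)
    assume "c T \<noteq> 0"
    have "\<bar>c T\<bar> = \<bar>c T\<bar> * \<bar>m T\<bar>" using z[OF T(1)] by (metis abs_mult abs_idempotent)
    then have "\<bar>m T\<bar> = 1" using \<open>c T \<noteq> 0\<close> by simp
    then show False using off_diag[OF S T] by (simp add: m_def)
  qed
  have "ip d x (Y S) = (\<Sum>T\<in>J. if T = S then c S else 0)"
    unfolding c(1) ip_comb using c0 diag[OF S] by (intro sum.cong) auto
  then have "c S = 1" using eq S finJ by simp
  then have "x = (\<Sum>T\<in>J. if T = S then U S else 0)"
    unfolding c(1) comb_def using c0 by (intro sum.cong) auto
  also have "\<dots> = U S" using S finJ by (simp only: sum.delta if_True)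
  finally show ?thesis .
qed

lemma symhull_subset:
  assumes C: "convex_set C" and UC: "\<And>S. S \<in> J \<Longrightarrow> U S \<in> C" "\<And>S. S \<in> J \<Longrightarrow> - U S \<in> C"
  shows "symhull \<subseteq> C"
proof -
  have scaled: "fscale a (U S) \<in> C" if S: "S \<in> J" and a: "\<bar>a\<bar> \<le> 1" for a S
  proof -
    have "fscale (1 - (1 + a) / 2) (- U S) + fscale ((1 + a) / 2) (U S) \<in> C"
      using a by (intro convex_setD[OF C] UC S) auto
    also have "fscale (1 - (1 + a) / 2) (- U S) + fscale ((1 + a) / 2) (U S) = fscale a (U S)"
      by (simp add: fun_eq_iff field_simps)
    finally show ?thesis .
  qed
  have "(\<Sum>S\<in>F. fscale (c S) (U S)) \<in> C" if "finite F" "F \<subseteq> J" "(\<Sum>S\<in>F. \<bar>c S\<bar>) \<le> 1" for F c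
    using that
  proof (induction F arbitrary: c rule: finite_induct)
    case empty
    obtain S where "S \<in> J" using J_ne by blast
    then show ?case using scaled[of S 0] by (simp only: sum.empty fscale_zero_left)
  next
    case (insert x F)
    have x: "x \<in> J" using insert by blast
    have sum_le: "\<bar>c x\<bar> + (\<Sum>S\<in>F. \<bar>c S\<bar>) \<le> 1" using insert by simp
    have F0: "(\<Sum>S\<in>F. \<bar>c S\<bar>) \<ge> 0" by (intro sum_nonneg) auto
    then have cx: "\<bar>c x\<bar> \<le> 1" using sum_le by linarith
    show ?case
    \<comment> \<open>If x carries all the weight, the other coefficients vanish. Otherwise they are
      rescaled by b = 1 - |c x| > 0 before the induction hypothesis is applied.\<close>
    proof (cases "\<bar>c x\<bar> = 1")
      case True
      then have "(\<Sum>S\<in>F. \<bar>c S\<bar>) = 0" using sum_le F0 by linarith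
      then have "\<forall>S\<in>F. c S = 0" using insert.hyps(1) by (simp add: sum_nonneg_eq_0_iff)
      then have "(\<Sum>S\<in>F. fscale (c S) (U S)) = 0" by (intro sum.neutral) auto
      then have "(\<Sum>S\<in>insert x F. fscale (c S) (U S)) = fscale (c x) (U x)"
        unfolding sum.insert[OF insert.hyps] by (simp only: add_0_right)
      then show ?thesis using scaled[OF x cx] by (simp only:)
    next
      case False
      define b where "b = 1 - \<bar>c x\<bar>"
      have b: "0 < b" "b \<le> 1" using False cx by (auto simp: b_def)
      have "(\<Sum>S\<in>F. \<bar>c S / b\<bar>) = (\<Sum>S\<in>F. \<bar>c S\<bar>) / b"
        using b by (simp add: abs_divide sum_divide_distrib)
      also have "\<dots> \<le> 1" using sum_le b by (simp add: b_def)
      finally have le: "(\<Sum>S\<in>F. \<bar>c S / b\<bar>) \<le> 1" .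
      have rest: "(\<Sum>S\<in>F. fscale (c S / b) (U S)) \<in> C"
        by (rule insert.IH[OF _ le]) (use insert.prems in simp)
      have "fscale (sgn (c x)) (U x) \<in> C" by (intro scaled x) (simp add: abs_sgn_eq)
      then have "fscale (1 - b) (fscale (sgn (c x)) (U x)) + fscale b (\<Sum>S\<in>F. fscale (c S / b) (U S)) \<in> C"
        by (rule convex_setD[OF C _ rest]) (use b in simp_all)
      also have "fscale b (\<Sum>S\<in>F. fscale (c S / b) (U S)) = (\<Sum>S\<in>F. fscale (c S) (U S))"
        unfolding fvec.scale_sum_right using b by (intro sum.cong) auto
      also have "fscale (1 - b) (fscale (sgn (c x)) (U x)) = fscale (c x) (U x)"
        by (simp only: fscale_fscale b_def diff_diff_eq2) (simp add: abs_mult_sgn)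
      finally show ?thesis unfolding sum.insert[OF insert.hyps] .
    qed
  qed
  then show ?thesis using finJ unfolding symhull_def comb_def by blast
qed

lemma symhull_width_ge:
  assumes S: "S \<in> J" shows "2 * \<bar>ip d (U S) y\<bar> \<le> width_dir d symhull y"
proof -
  define a where "a = sgn (ip d (U S) y)"
  have a: "\<bar>a\<bar> \<le> 1" "\<bar>- a\<bar> \<le> 1" by (auto simp: a_def sgn_if)
  have "ip d y (fscale a (U S) - fscale (- a) (U S)) \<le> width_dir d symhull y"
    by (intro width_dir_upper convex_bodyD(2)[OF symhull_convex_body] symhull_single S a)
  moreover have "ip d y (fscale a (U S) - fscale (- a) (U S)) = 2 * (a * ip d (U S) y)"
    by (simp only: ip_simps ip_commute[of d y "U S"])
  moreover have "a * ip d (U S) y = \<bar>ip d (U S) y\<bar>" by (simp add: a_def sgn_mult_abs sgn_if abs_if)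
  ultimately show ?thesis by linarith
qed

lemma symhull_width_Y:
  assumes S: "S \<in> J" shows "width_dir d symhull (Y S) = 2"
proof -
  note Cb = convex_bodyD[OF symhull_convex_body]
  obtain a b where ab: "a \<in> symhull" "b \<in> symhull" "width_dir d symhull (Y S) = ip d (Y S) (a - b)"
    using width_dir_attained[OF Cb(2,4), of d "Y S"] by blast
  have "ip d (Y S) (a - b) = ip d a (Y S) - ip d b (Y S)" by (simp only: ip_simps ip_commute[of d "Y S"])
  then have "width_dir d symhull (Y S) \<le> 2"
    using ab symhull_ip_le[OF ab(1) S] symhull_ip_le[OF ab(2) S] by linarith
  moreover have "2 \<le> width_dir d symhull (Y S)" using symhull_width_ge[OF S, of "Y S"] diag[OF S] by simp
  ultimately show ?thesis by linarith
qed

text \<open>Widths are taken over the dual lattice, so the inverse scales appear here and the dual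
  is the sparse lattice.\<close>

definition red_lattice :: "(nat \<Rightarrow> real) set" where
  "red_lattice = scaled_lattice d (\<lambda>i. 1 / scl i)"

lemma red_lattice: "lattice d red_lattice"
  unfolding red_lattice_def by (rule lattice_scaled_lattice) (simp add: scl_pos)

lemma dual_red_lattice: "dual_lattice d red_lattice = scaled_lattice d scl"
  unfolding red_lattice_def by (subst dual_scaled_lattice) (simp_all add: scl_pos)

lemma symhull_lattice_width: "lattice_width d red_lattice symhull = 2"
proof (rule antisym)
  obtain S where S: "S \<in> J" using J_ne by blast
  show "lattice_width d red_lattice symhull \<le> 2"
    using lattice_width_le[OF symhull_convex_body, of "Y S" red_lattice] Y_lattice[OF S]
    by (simp add: dual_red_lattice symhull_width_Y[OF S])
  show "2 \<le> lattice_width d red_lattice symhull"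
    unfolding lattice_width_def dual_red_lattice
  proof (rule cInf_greatest)
    show "width_dir d symhull ` (scaled_lattice d scl - {0}) \<noteq> {}" using Y_lattice[OF S] by blast
    fix w assume "w \<in> width_dir d symhull ` (scaled_lattice d scl - {0})"
    then obtain y where y: "y \<in> scaled_lattice d scl" "y \<noteq> 0" "w = width_dir d symhull y" by blast
    then obtain T where T: "T \<in> J" "1 \<le> \<bar>ip d (U T) y\<bar>" using scaled_cover by blast
    then show "2 \<le> w" using symhull_width_ge[OF T(1), of y] y(3) by linarith
  qed
qed

text \<open>A smaller body of the same lattice width still has width at least 2 along every
  \<open>Y S\<close>, whose values on the hull lie in [-1, 1]. It thus contains the unique points
  \<open>U S\<close> and \<open>- U S\<close> where 1 and -1 are attained, and so the whole
  hull.\<close>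

lemma symhull_reduced: "lattice_reduced d red_lattice symhull"
  unfolding lattice_reduced_def
proof (intro conjI notI symhull_convex_body)
  assume "\<exists>C'. convex_body d C' \<and> C' \<subset> symhull \<and>
      lattice_width d red_lattice C' = lattice_width d red_lattice symhull"
  then obtain C' where C': "convex_body d C'" "C' \<subset> symhull" "lattice_width d red_lattice C' = 2"
    unfolding symhull_lattice_width by blast
  note Cb = convex_bodyD[OF C'(1)]
  have "U S \<in> C' \<and> - U S \<in> C'" if S: "S \<in> J" for S
  proof -
    obtain a b where ab: "a \<in> C'" "b \<in> C'" "width_dir d C' (Y S) = ip d (Y S) (a - b)"
      using width_dir_attained[OF Cb(2,4), of d "Y S"] by blast
    have "2 \<le> width_dir d C' (Y S)"
      using lattice_width_le[OF C'(1), of "Y S" red_lattice] Y_lattice[OF S] C'(3)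
      by (simp add: dual_red_lattice)
    moreover have "ip d (Y S) (a - b) = ip d a (Y S) - ip d b (Y S)"
      by (simp only: ip_simps ip_commute[of d "Y S"])
    moreover have h: "a \<in> symhull" "b \<in> symhull" using ab C'(2) by auto
    moreover note symhull_ip_le[OF h(1) S] symhull_ip_le[OF h(2) S]
    ultimately have a: "ip d a (Y S) = 1" and b: "ip d b (Y S) = - 1" using ab(3) by linarith+
    have "- b \<in> symhull"
    proof -
      obtain c where c: "b = comb c" "(\<Sum>S\<in>J. \<bar>c S\<bar>) \<le> 1" using h(2) unfolding symhull_def by blast
      have "- b = comb (\<lambda>S. - c S)"
        unfolding c(1) comb_def sum_negf[symmetric] by (intro sum.cong) (auto simp: fun_eq_iff)
      then show ?thesis using c(2) unfolding symhull_def by force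
    qed
    then have "- b = U S" by (rule symhull_ip_eq[OF _ S]) (simp add: ip_simps b)
    then have "b = - U S" by (metis minus_minus)
    then show ?thesis using ab symhull_ip_eq[OF h(1) S a] by blast
  qed
  then have "symhull \<subseteq> C'" by (intro symhull_subset Cb(3)) auto
  then show False using C'(2) by blast
qed

lemma symhull_width_directions: "width_directions d red_lattice symhull \<subseteq> Edim k"
proof
  fix y assume "y \<in> width_directions d red_lattice symhull"
  then have y: "y \<in> scaled_lattice d scl" "width_dir d symhull y = 2"
    by (auto simp: width_directions_def dual_red_lattice symhull_lattice_width)
  show "y \<in> Edim k"
  proof (rule ccontr)
    assume "y \<notin> Edim k"
    then obtain S where "S \<in> J" "1 < \<bar>ip d (U S) y\<bar>" using scaled_long[OF y(1)] by blast
    then show False using symhull_width_ge[of S y] y(2) by simp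
  qed
qed

section \<open>The complete example\<close>

definition slab :: "(nat \<Rightarrow> real) set" where
  "slab = {x \<in> Edim d. \<forall>S\<in>J. \<bar>ip d (U S) x\<bar> \<le> 1}"

text \<open>\<open>slab\<close> is the polar of \<open>symhull\<close>; \<open>coord_bound\<close>
  with m = 1 confines it to a compact cube.\<close>

lemma slab_convex_body: "convex_body d slab"
  unfolding convex_body_iff
proof (intro conjI)
  show "slab \<subseteq> Edim d" by (auto simp: slab_def)
  have "closed {x. \<bar>ip d (U S) x\<bar> \<le> 1}" for S
    by (intro closed_Collect_le continuous_on_rabs continuous_on_vec)
  then have "compact ({x \<in> Edim d. \<forall>i<d. \<bar>x i\<bar> \<le> \<kappa> * 1} \<inter> (\<Inter>S\<in>J. {x. \<bar>ip d (U S) x\<bar> \<le> 1}))"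
    by (intro compact_Int_closed compact_Edim_box closed_INT) auto
  moreover have "{x \<in> Edim d. \<forall>i<d. \<bar>x i\<bar> \<le> \<kappa> * 1} \<inter> (\<Inter>S\<in>J. {x. \<bar>ip d (U S) x\<bar> \<le> 1}) = slab"
    using coord_bound[of _ _ 1] unfolding slab_def by blast
  ultimately show "compact slab" by simp
  show "convex_set slab"
    unfolding convex_set_def
  proof (intro ballI allI impI)
    fix x y t assume x: "x \<in> slab" and y: "y \<in> slab" and t: "0 \<le> t \<and> (t::real) \<le> 1"
    have "\<bar>ip d (U S) (fscale (1 - t) x + fscale t y)\<bar> \<le> 1" if S: "S \<in> J" for S
    proof -
      have xy: "\<bar>ip d (U S) x\<bar> \<le> 1" "\<bar>ip d (U S) y\<bar> \<le> 1" using x y S by (auto simp: slab_def)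
      have "\<bar>(1 - t) * ip d (U S) x + t * ip d (U S) y\<bar>
          \<le> (1 - t) * \<bar>ip d (U S) x\<bar> + t * \<bar>ip d (U S) y\<bar>"
        using t abs_triangle_ineq[of "(1 - t) * ip d (U S) x" "t * ip d (U S) y"] by (simp add: abs_mult)
      also have "\<dots> \<le> 1" using xy t by (intro convex_bound_le) auto
      finally show ?thesis by (simp only: ip_simps)
    qed
    then show "fscale (1 - t) x + fscale t y \<in> slab"
      using x y by (auto simp: slab_def intro: Edim_add Edim_scale)
  qed
  define B where "B = 1 + (\<Sum>S\<in>J. \<Sum>i<d. \<bar>U S i\<bar>)"
  have B: "B > 0" unfolding B_def by (intro add_pos_nonneg sum_nonneg) auto
  show "\<exists>x\<in>slab. \<exists>r>0. \<forall>y\<in>Edim d. (\<forall>i<d. \<bar>y i - x i\<bar> < r) \<longrightarrow> y \<in> slab"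
  proof (intro bexI[of _ 0] exI[of _ "1 / B"] conjI ballI impI)
    show "1 / B > 0" using B by simp
    show "0 \<in> slab" by (simp add: slab_def ip_simps)
    fix y assume y: "y \<in> Edim d" "\<forall>i<d. \<bar>y i - 0 i\<bar> < 1 / B"
    have "\<bar>ip d (U S) y\<bar> \<le> 1" if S: "S \<in> J" for S
    proof -
      have "\<bar>ip d (U S) y\<bar> \<le> (\<Sum>i<d. \<bar>U S i * y i\<bar>)" unfolding ip_def by (rule sum_abs)
      also have "\<dots> \<le> (\<Sum>i<d. \<bar>U S i\<bar> * (1 / B))"
        unfolding abs_mult using y(2) by (intro sum_mono mult_left_mono) (auto intro: less_imp_le)
      also have "\<dots> = (\<Sum>i<d. \<bar>U S i\<bar>) * (1 / B)" by (rule sum_distrib_right[symmetric])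
      also have "\<dots> \<le> B * (1 / B)"
      proof (rule mult_right_mono)
        have "(\<Sum>i<d. \<bar>U S i\<bar>) \<le> (\<Sum>S\<in>J. \<Sum>i<d. \<bar>U S i\<bar>)"
          using S finJ by (intro member_le_sum[of S _ "\<lambda>S. \<Sum>i<d. \<bar>U S i\<bar>"]) (auto intro: sum_nonneg)
        then show "(\<Sum>i<d. \<bar>U S i\<bar>) \<le> B" by (simp add: B_def)
      qed (use B in simp)
      finally show ?thesis using B by simp
    qed
    then show "y \<in> slab" using y(1) by (simp add: slab_def)
  qed
qed

abbreviation comp_lattice :: "(nat \<Rightarrow> real) set" where
  "comp_lattice \<equiv> scaled_lattice d scl"

lemma comp_lattice: "lattice d comp_lattice"
  by (rule lattice_scaled_lattice) (rule scl_pos)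

lemma slab_diff:
  assumes "x \<in> diff_body slab" "S \<in> J" shows "\<bar>ip d (U S) x\<bar> \<le> 2"
proof -
  obtain a b where ab: "x = a - b" "a \<in> slab" "b \<in> slab" using assms(1) unfolding diff_body_def by blast
  then have "\<bar>ip d (U S) a\<bar> \<le> 1" "\<bar>ip d (U S) b\<bar> \<le> 1" using assms(2) by (auto simp: slab_def)
  then show ?thesis unfolding ab(1) ip_simps by linarith
qed

text \<open>The strict second claim keeps the diameter directions in the first k coordinates:
  outside, sparseness makes some functional exceed 1 on v.\<close>

lemma slab_chord:
  assumes v: "v \<in> comp_lattice" "v \<noteq> 0" and s: "s > 0" "fscale s v \<in> diff_body slab"
  shows "s \<le> 2" "v \<notin> Edim k \<Longrightarrow> s < 2"
proof -
  have b: "s * \<bar>ip d (U S) v\<bar> \<le> 2" if "S \<in> J" for S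
    using slab_diff[OF s(2) that] s(1) by (simp add: ip_simps abs_mult)
  obtain S where S: "S \<in> J" "1 \<le> \<bar>ip d (U S) v\<bar>" using scaled_cover[OF v] by blast
  have "s * 1 \<le> s * \<bar>ip d (U S) v\<bar>" using S s by (intro mult_left_mono) auto
  then show "s \<le> 2" using b[OF S(1)] by linarith
  assume "v \<notin> Edim k"
  then obtain T where T: "T \<in> J" "1 < \<bar>ip d (U T) v\<bar>" using scaled_long[OF v(1)] by blast
  have "s * 1 < s * \<bar>ip d (U T) v\<bar>" using T s by (intro mult_strict_left_mono) auto
  then show "s < 2" using b[OF T(1)] by linarith
qed

lemma Y_slab: assumes S: "S \<in> J" and a: "\<bar>a\<bar> \<le> 1" shows "fscale a (Y S) \<in> slab"
proof -
  have "\<bar>ip d (U T) (fscale a (Y S))\<bar> \<le> 1" if "T \<in> J" for T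
  proof -
    have "\<bar>a\<bar> * \<bar>ip d (U T) (Y S)\<bar> \<le> 1 * 1" by (intro mult_mono a off_diag_le S that) auto
    then show ?thesis by (simp add: ip_simps abs_mult)
  qed
  then show ?thesis using Y_Edim[OF S] Edim_k by (auto simp: slab_def intro: Edim_scale)
qed

lemma Y_chord: assumes S: "S \<in> J" shows "fscale 2 (Y S) \<in> diff_body slab"
proof -
  have "fscale 2 (Y S) = fscale 1 (Y S) - fscale (-1) (Y S)" by (simp add: fun_eq_iff)
  then show ?thesis using Y_slab[OF S, of 1] Y_slab[OF S, of "-1"] unfolding diff_body_def by force
qed

text \<open>If \<open>Y S\<close> is m times a primitive g, the chord 2 \<open>Y S\<close> has
  length 2m along g. Chords have length at most 2, so m = 1.\<close>

lemma Y_primitive: assumes S: "S \<in> J" shows "primitive comp_lattice (Y S)"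
proof -
  obtain g m where g: "primitive comp_lattice g" "m \<ge> (1::int)" "Y S = fscale (of_int m) g"
    using primitive_exists[OF comp_lattice Y_lattice[OF S]] by metis
  have gL: "g \<in> comp_lattice" "g \<noteq> 0" using g(1) by (auto simp: primitive_def)
  have "fscale (2 * of_int m) g \<in> diff_body slab" using Y_chord[OF S] unfolding g(3) fscale_fscale .
  then have "2 * of_int m \<le> (2::real)" using slab_chord(1)[OF gL, of "2 * of_int m"] g(2) by simp
  then have "m = 1" using g(2) by simp
  then show ?thesis using g by simp
qed

lemma slab_lattice_diam: "lattice_diam d comp_lattice slab = 2"
  unfolding lattice_diam_eq[OF comp_lattice convex_bodyD(3)[OF slab_convex_body]]
proof (rule cSup_eq_maximum)
  obtain S where S: "S \<in> J" using J_ne by blast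
  show "2 \<in> chord_lengths comp_lattice slab"
    using Y_primitive[OF S] Y_chord[OF S] unfolding chord_lengths_def by auto
  show "s \<le> 2" if "s \<in> chord_lengths comp_lattice slab" for s
    using that slab_chord(1) unfolding chord_lengths_def primitive_def by blast
qed

lemma slab_diam_directions: "diam_directions d comp_lattice slab \<subseteq> Edim k"
proof
  fix w assume "w \<in> diam_directions d comp_lattice slab"
  then obtain a b t where w: "w \<noteq> 0" "lattice_segment comp_lattice a b" "segment_in a b slab"
      "b - a = fscale t w" "lattice_length d comp_lattice a b = 2"
    unfolding diam_directions_def slab_lattice_diam by blast
  obtain v s where v: "primitive comp_lattice v" "s > 0" "b - a = fscale s v"
    using lattice_segment_primitive[OF comp_lattice w(2)] by metis
  have s: "s = 2" using lattice_length_eq[OF comp_lattice v] w(5) by simp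
  have "a \<in> slab" "b \<in> slab" using w(3) segment_in_iff[OF convex_bodyD(3)[OF slab_convex_body]] by auto
  then have "fscale s v \<in> diff_body slab" unfolding v(3)[symmetric] diff_body_def by blast
  then have vk: "v \<in> Edim k" using slab_chord(2)[of v s] v s unfolding primitive_def by force
  have eq: "fscale t w = fscale s v" using w(4) v(3) by simp
  have "v \<noteq> 0" using v(1) by (simp add: primitive_def)
  then have "t \<noteq> 0" using eq s by auto
  then have "w = fscale (1 / t) (fscale t w)" by simp
  also have "\<dots> \<in> Edim k" unfolding eq by (intro Edim_scale vk)
  finally show "w \<in> Edim k" .
qed

text \<open>A point outside the slab of S lets the diameter segment in direction Y S grow, because its
  endpoint Y S lies in the relative interior of the facet given by U S.\<close>

lemma slab_complete: "lattice_complete d comp_lattice slab"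
  unfolding lattice_complete_def
proof (intro conjI notI slab_convex_body)
  assume "\<exists>C'. convex_body d C' \<and> slab \<subset> C' \<and>
      lattice_diam d comp_lattice C' = lattice_diam d comp_lattice slab"
  then obtain C' where C': "convex_body d C'" "slab \<subset> C'" "lattice_diam d comp_lattice C' = 2"
    unfolding slab_lattice_diam by blast
  note Cb = convex_bodyD[OF C'(1)]
  obtain x where x: "x \<in> C'" "x \<notin> slab" using C'(2) by blast
  have xE: "x \<in> Edim d" using x Cb by blast
  then obtain S where S: "S \<in> J" "1 < \<bar>ip d (U S) x\<bar>" using x(2) by (auto simp: slab_def not_le)
  define \<sigma> where "\<sigma> = sgn (ip d (U S) x)"
  define a where "a = \<bar>ip d (U S) x\<bar>"
  have \<sigma>: "\<bar>\<sigma>\<bar> = 1" "ip d (U S) x = \<sigma> * a" using S(2) by (auto simp: \<sigma>_def a_def sgn_if abs_if)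
  have a: "a > 1" using S by (simp add: a_def)
  define m where "m T = \<bar>ip d (U T) (Y S)\<bar>" for T
  define X where "X = 1 + (\<Sum>T\<in>J. \<bar>ip d (U T) x\<bar>)"
  have X: "\<bar>ip d (U T) x\<bar> + 1 \<le> X" if "T \<in> J" for T
    using member_le_sum[of T J "\<lambda>T. \<bar>ip d (U T) x\<bar>"] that finJ by (simp add: X_def)
  have X0: "X > 0" unfolding X_def by (intro add_pos_nonneg sum_nonneg) auto
  \<comment> \<open>Small enough for the slack 1 - m T of every other slab to pay for the
    perturbation; 1/2 keeps 1 - t positive and covers the case that S is the only index.\<close>
  define t where "t = Min (insert (1/2) ((\<lambda>T. (1 - m T) / (2 * X)) ` (J - {S})))"
  have "0 < (1 - m T) / (2 * X)" if "T \<in> J - {S}" for T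
    using off_diag[OF S(1), of T] that X0 by (simp add: m_def)
  then have t0: "t > 0" using finJ by (auto simp: t_def)
  have t_half: "t \<le> 1/2"
    unfolding t_def by (intro Min_le insertI1) (use finJ in simp)
  have t_le: "t \<le> (1 - m T) / (2 * X)" if "T \<in> J - {S}" for T
    unfolding t_def by (intro Min_le insertI2 imageI that) (use finJ in simp)
  \<comment> \<open>Exactly the value for which 1 + \<eta> - t a = 1 - t, so that w below lands on
    the boundary of the slab of S.\<close>
  define \<eta> where "\<eta> = t * (a - 1)"
  have \<eta>: "\<eta> > 0" using t0 a by (simp add: \<eta>_def)
  define z where "z = fscale ((1 + \<eta>) * \<sigma>) (Y S)"
  \<comment> \<open>Solves z = (1 - t) w + t x. Once w is known to lie in \<open>slab\<close>,
    convexity puts z into C', and z overshoots \<sigma> \<open>Y S\<close> by the factor 1 +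
    \<eta>.\<close>
  define w where "w = fscale (1 / (1 - t)) (z - fscale t x)"
  have YE: "Y S \<in> Edim d" using Y_Edim[OF S(1)] Edim_k by blast
  have "\<bar>ip d (U T) (z - fscale t x)\<bar> \<le> 1 - t" if T: "T \<in> J" for T
  proof (cases "T = S")
    case True
    have "ip d (U S) (z - fscale t x) = \<sigma> * (1 + \<eta> - t * a)"
      by (simp add: z_def ip_simps diag[OF S(1)] \<sigma>(2) algebra_simps)
    also have "\<dots> = \<sigma> * (1 - t)" by (simp add: \<eta>_def algebra_simps)
    finally show ?thesis using True \<sigma>(1) t_half by (simp add: abs_mult)
  next
    case False
    then have TS: "T \<in> J - {S}" using T by blast
    have m: "0 \<le> m T" "m T \<le> 1" using off_diag_le[OF S(1) T] by (auto simp: m_def)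
    have "\<bar>ip d (U T) (z - fscale t x)\<bar> = \<bar>(1 + \<eta>) * \<sigma> * ip d (U T) (Y S) - t * ip d (U T) x\<bar>"
      by (simp only: z_def ip_simps)
    also have "\<dots> \<le> \<bar>(1 + \<eta>) * \<sigma> * ip d (U T) (Y S)\<bar> + \<bar>t * ip d (U T) x\<bar>" by (rule abs_triangle_ineq4)
    also have "\<dots> = (1 + \<eta>) * m T + t * \<bar>ip d (U T) x\<bar>"
      using \<eta> t0 \<sigma>(1) by (simp add: abs_mult m_def)
    also have "\<dots> \<le> m T + \<eta> + t * \<bar>ip d (U T) x\<bar>"
      using mult_left_mono[OF m(2), of \<eta>] \<eta> by (simp add: algebra_simps)
    also have "\<dots> \<le> 1 - t"
    proof -
      have "\<eta> + t * \<bar>ip d (U T) x\<bar> + t = t * (a + \<bar>ip d (U T) x\<bar>)" by (simp add: \<eta>_def algebra_simps)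
      also have "\<dots> \<le> t * (2 * X)" using X[OF T] X[OF S(1)] t0 by (intro mult_left_mono) (auto simp: a_def)
      also have "\<dots> \<le> 1 - m T" using t_le[OF TS] X0 by (simp add: pos_le_divide_eq)
      finally show ?thesis by linarith
    qed
    finally show ?thesis .
  qed
  then have "\<bar>ip d (U T) w\<bar> \<le> 1" if "T \<in> J" for T
    using that t_half by (simp add: w_def ip_simps(6) abs_mult abs_divide pos_divide_le_eq)
  then have "w \<in> slab"
    using YE xE by (auto simp: slab_def w_def z_def intro!: Edim_scale Edim_diff)
  then have "fscale (1 - t) w + fscale t x \<in> C'"
    using C'(2) x t0 t_half by (intro convex_setD[OF Cb(3)]) auto
  also have "fscale (1 - t) w + fscale t x = z" using t_half by (simp add: w_def)
  finally have "z \<in> C'" .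
  moreover have "fscale (- \<sigma>) (Y S) \<in> C'" using Y_slab[OF S(1), of "- \<sigma>"] \<sigma>(1) C'(2) by auto
  ultimately have "z - fscale (- \<sigma>) (Y S) \<in> diff_body C'" unfolding diff_body_def by blast
  then have d1: "fscale (\<sigma> * (2 + \<eta>)) (Y S) \<in> diff_body C'"
    by (rule back_subst[of "\<lambda>v. v \<in> diff_body C'"]) (simp add: z_def fun_eq_iff algebra_simps)
  have "fscale (2 + \<eta>) (Y S) \<in> diff_body C'"
  proof (cases "\<sigma> = 1")
    case True then show ?thesis using d1 by (simp only: True mult_1)
  next
    case False
    then have "\<sigma> = - 1" using \<sigma>(1) by (auto simp: abs_if split: if_splits)
    then have "fscale (2 + \<eta>) (Y S) = - fscale (\<sigma> * (2 + \<eta>)) (Y S)"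
      by (simp add: fun_eq_iff algebra_simps)
    then show ?thesis using diff_body_props(4)[OF C'(1) d1] by (simp only:)
  qed
  then have "2 + \<eta> \<le> 2"
    using le_lattice_diam[OF comp_lattice C'(1) Y_primitive[OF S(1)], of "2 + \<eta>"] \<eta> C'(3) by simp
  then show False using \<eta> by simp
qed

end

section \<open>The dual system of the Voronoi cell\<close>

definition index_sets :: "nat \<Rightarrow> nat set set" where
  "index_sets k = {S. S \<noteq> {} \<and> S \<subseteq> {..<k}}"

definition indicator_vec :: "nat set \<Rightarrow> nat \<Rightarrow> real" where
  "indicator_vec S i = (if i \<in> S then 1 else 0)"

text \<open>The numerator is the coefficient of x_i in Q(1_S, x), the denominator is Q(1_S, 1_S) =
  |S| (k + 1 - |S|). Each coordinate i from k on is attached to the single set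
  \<open>\<sigma> i\<close>.\<close>

definition facet_vec :: "nat \<Rightarrow> nat \<Rightarrow> (nat \<Rightarrow> nat set) \<Rightarrow> nat set \<Rightarrow> nat \<Rightarrow> real" where
  "facet_vec d k \<sigma> S i =
     (if i < k then (real (k + 1) * indicator_vec S i - real (card S)) / (real (card S) * real (k + 1 - card S))
      else if i < d \<and> \<sigma> i = S then 1 else 0)"

lemma index_setsD:
  assumes "S \<in> index_sets k"
  shows "finite S" "S \<subseteq> {..<k}" "1 \<le> card S" "card S \<le> k"
proof -
  show S: "S \<subseteq> {..<k}" using assms by (simp add: index_sets_def)
  then show fin: "finite S" by (rule finite_subset) simp
  show "1 \<le> card S" using assms fin by (simp add: index_sets_def Suc_le_eq card_gt_0_iff)
  show "card S \<le> k" using card_mono[OF _ S] by simp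
qed

lemma index_sets_denom_pos:
  assumes "S \<in> index_sets k" shows "real (card S) * real (k + 1 - card S) > 0"
proof -
  have "0 < card S" "0 < k + 1 - card S" using index_setsD(3,4)[OF assms] by linarith+
  then show ?thesis by (simp only: of_nat_0_less_iff zero_less_mult_iff) simp
qed

lemma ip_facet_vec:
  assumes kd: "k \<le> d" and x: "x \<in> Edim k" and S: "S \<in> index_sets k"
  shows "ip d (facet_vec d k \<sigma> S) x =
    (real (k + 1) * (\<Sum>i\<in>S. x i) - real (card S) * (\<Sum>i<k. x i)) / (real (card S) * real (k + 1 - card S))"
    (is "_ = _ / ?c")
proof -
  note S = index_setsD[OF S]
  have "ip d (facet_vec d k \<sigma> S) x = (\<Sum>i<k. facet_vec d k \<sigma> S i * x i)"
    unfolding ip_def using kd x by (intro sum.mono_neutral_right) (auto simp: Edim_def)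
  also have "\<dots> = (\<Sum>i<k. (real (k + 1) * (indicator_vec S i * x i) - real (card S) * x i) / ?c)"
    by (intro sum.cong) (auto simp: facet_vec_def left_diff_distrib)
  also have "\<dots> = (real (k + 1) * (\<Sum>i<k. indicator_vec S i * x i) - real (card S) * (\<Sum>i<k. x i)) / ?c"
    by (simp only: sum_divide_distrib[symmetric] sum_subtractf sum_distrib_left[symmetric])
  also have "(\<Sum>i<k. indicator_vec S i * x i) = (\<Sum>i\<in>S. x i)"
    using S by (intro sum.mono_neutral_cong_right) (auto simp: indicator_vec_def)
  finally show ?thesis .
qed

lemma indicator_vec_Edim: "S \<in> index_sets k \<Longrightarrow> indicator_vec S \<in> Edim k"
  by (auto simp: Edim_def indicator_vec_def index_sets_def)

lemma ip_facet_indicator: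
  assumes kd: "k \<le> d" and S: "S \<in> index_sets k" and T: "T \<in> index_sets k"
  shows "ip d (facet_vec d k \<sigma> T) (indicator_vec S) =
    (real (k + 1) * real (card (S \<inter> T)) - real (card T) * real (card S)) / (real (card T) * real (k + 1 - card T))"
proof -
  note S' = index_setsD[OF S] and T' = index_setsD[OF T]
  have "(\<Sum>i\<in>T. indicator_vec S i) = real (card (S \<inter> T))"
    using T'(1) by (simp add: indicator_vec_def sum.If_cases Int_def conj_commute)
  moreover have "(\<Sum>i<k. indicator_vec S i) = real (card S)"
  proof -
    have "{..<k} \<inter> {i. i \<in> S} = S" using S'(2) by blast
    then show ?thesis by (simp add: indicator_vec_def sum.If_cases)
  qed
  ultimately show ?thesis unfolding ip_facet_vec[OF kd indicator_vec_Edim[OF S] T] by simp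
qed

text \<open>To be read with a = |S \<inter> T|, s = |S|, t = |T|, n = k + 1. The upper estimate is
  strict because T differs from S; the lower one uses |S \<union> T| = s + t - a \<le> k.\<close>

lemma facet_off_diag_int:
  fixes a s t n :: int
  assumes "0 \<le> a" "a \<le> s" "a \<le> t" "1 \<le> t" "t < n" "s + t - a < n" "a < t \<or> t < s"
  shows "\<bar>n * a - t * s\<bar> < t * (n - t)"
proof -
  have "n * a - t * s < t * (n - t)"
  proof (cases "t \<le> s")
    case True
    have "0 \<le> n * (t - a)" "0 \<le> t * (s - t)" using assms True by auto
    moreover have "0 < n * (t - a) \<or> 0 < t * (s - t)" using assms by auto
    ultimately have "0 < n * (t - a) + t * (s - t)" by linarith
    then show ?thesis by (simp add: algebra_simps)
  next
    case False
    have "t * (t - s) < n * (t - s)" using assms False by (intro mult_strict_right_mono) auto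
    also have "\<dots> \<le> n * (t - a)" using assms by (intro mult_left_mono) auto
    finally show ?thesis by (simp add: algebra_simps)
  qed
  moreover have "t * s - n * a < t * (n - t)"
  proof -
    have le: "t * (s + t - n) \<le> t * (a - 1)" using assms by (intro mult_left_mono) auto
    have "t * (a - 1) < n * a"
    proof (cases "a = 0")
      case False
      then have "t * (a - 1) \<le> n * (a - 1)" using assms by (intro mult_right_mono) auto
      then show ?thesis using assms by (simp add: algebra_simps)
    qed (use assms in simp)
    with le have "t * (s + t - n) < n * a" by linarith
    then show ?thesis by (simp add: algebra_simps)
  qed
  ultimately show ?thesis by linarith
qed

lemma facet_diag:
  assumes kd: "k \<le> d" and S: "S \<in> index_sets k"
  shows "ip d (facet_vec d k \<sigma> S) (indicator_vec S) = 1"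
proof -
  note S' = index_setsD[OF S]
  have "real (k + 1) * real (card S) - real (card S) * real (card S) = real (card S) * real (k + 1 - card S)"
    using S' by (simp add: of_nat_diff algebra_simps)
  moreover have "real (card S) * real (k + 1 - card S) \<noteq> 0" using index_sets_denom_pos[OF S] by (rule less_imp_neq[symmetric])
  ultimately show ?thesis unfolding ip_facet_indicator[OF kd S S] Int_absorb by (metis divide_self)
qed

lemma facet_off_diag:
  assumes kd: "k \<le> d" and S: "S \<in> index_sets k" and T: "T \<in> index_sets k" and ne: "T \<noteq> S"
  shows "\<bar>ip d (facet_vec d k \<sigma> T) (indicator_vec S)\<bar> < 1"
proof -
  note S' = index_setsD[OF S] and T' = index_setsD[OF T]
  define a s t n where "a = int (card (S \<inter> T))" and "s = int (card S)" and "t = int (card T)"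
    and "n = int (k + 1)"
  have "card (S \<inter> T) \<le> card S" "card (S \<inter> T) \<le> card T"
    using S'(1) T'(1) by (auto intro: card_mono)
  moreover have "card (S \<union> T) \<le> k"
    using card_mono[of "{..<k}" "S \<union> T"] S'(2) T'(2) by simp
  moreover have "card S + card T = card (S \<union> T) + card (S \<inter> T)"
    by (rule card_Un_Int[OF S'(1) T'(1)])
  moreover have "card (S \<inter> T) < card T \<or> card T < card S"
  proof (rule ccontr)
    assume "\<not> ?thesis"
    then have "card (S \<inter> T) = card T" "card S \<le> card T" using calculation(2) by auto
    then have "S \<inter> T = T" using T'(1) by (intro card_subset_eq) auto
    then have "T \<subseteq> S" by blast
    then have "T = S" using \<open>card S \<le> card T\<close> S'(1) by (intro card_seteq)
    then show False using ne by simp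
  qed
  ultimately have "\<bar>n * a - t * s\<bar> < t * (n - t)"
    using T'(3,4) by (intro facet_off_diag_int) (auto simp: a_def s_def t_def n_def)
  then have "real_of_int \<bar>n * a - t * s\<bar> < real_of_int (t * (n - t))" by (simp only: of_int_less_iff)
  moreover have "real_of_int (n * a - t * s) = real (k + 1) * real (card (S \<inter> T)) - real (card T) * real (card S)"
    by (simp add: a_def s_def t_def n_def)
  moreover have c: "real_of_int (t * (n - t)) = real (card T) * real (k + 1 - card T)"
    using T'(4) by (simp add: t_def n_def of_nat_diff)
  ultimately have "\<bar>real (k + 1) * real (card (S \<inter> T)) - real (card T) * real (card S)\<bar>
      < real (card T) * real (k + 1 - card T)"
    by (simp only: of_int_abs)
  moreover have "real (card T) * real (k + 1 - card T) > 0" by (rule index_sets_denom_pos[OF T])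
  ultimately show ?thesis
    unfolding ip_facet_indicator[OF kd S T] abs_divide by (simp only: abs_of_pos pos_divide_less_eq mult_1)
qed

text \<open>The facet that a lattice point x violates is given by its level set at the minimum if x
  has a negative coordinate, and by its support otherwise.\<close>

lemma facet_cover:
  assumes kd: "k \<le> d" and x: "x \<in> Edim k" "x \<noteq> 0" and int: "\<And>i. x i \<in> \<int>"
  shows "\<exists>S\<in>index_sets k. 1 \<le> \<bar>ip d (facet_vec d k \<sigma> S) x\<bar>"
proof -
  have crit: ?thesis if S: "S \<in> index_sets k"
    and big: "real (card S) * real (k + 1 - card S)
      \<le> \<bar>real (k + 1) * (\<Sum>i\<in>S. x i) - real (card S) * (\<Sum>i<k. x i)\<bar>" for S
  proof (rule bexI[OF _ S])
    have "real (card S) * real (k + 1 - card S) > 0" by (rule index_sets_denom_pos[OF S])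
    then show "1 \<le> \<bar>ip d (facet_vec d k \<sigma> S) x\<bar>"
      unfolding ip_facet_vec[OF kd x(1) S] abs_divide using big
      by (simp only: abs_of_pos pos_le_divide_eq mult_1)
  qed
  have intle: "x i + 1 \<le> x j" if "x i < x j" for i j
  proof -
    obtain a b :: int where "x i = of_int a" "x j = of_int b" using int by (metis Ints_cases)
    then show ?thesis using that by simp
  qed
  obtain i0 where i0: "i0 < k" "x i0 \<noteq> 0" using Edim_nonzero x by blast
  have split: "(\<Sum>i<k. x i) = (\<Sum>i\<in>S. x i) + (\<Sum>i\<in>{..<k} - S. x i)" if "S \<subseteq> {..<k}" for S
    using sum.subset_diff[OF that, of x] by simp
  show ?thesis
  proof (cases "\<exists>i<k. x i < 0")
    case True
    define m where "m = Min (x ` {..<k})"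
    have fin: "finite (x ` {..<k})" "x ` {..<k} \<noteq> {}" using i0 by auto
    have m: "m \<in> x ` {..<k}" "\<And>i. i < k \<Longrightarrow> m \<le> x i"
      using Min_in[OF fin] Min_le[OF fin(1)] by (auto simp: m_def)
    obtain j where j: "j < k" "x j = m" using m(1) by auto
    have "m < 0" using True m(2) by force
    \<comment> \<open>Negativity of the minimum enters here: by integrality it is at most -1, so the
      term s (m + 1) below has the right sign.\<close>
    have m1: "m + 1 \<le> 0"
    proof -
      obtain a :: int where "x j = of_int a" using int by (metis Ints_cases)
      then show ?thesis using j \<open>m < 0\<close> by simp
    qed
    define S where "S = {i. i < k \<and> x i = m}"
    have S: "S \<in> index_sets k" using j by (auto simp: S_def index_sets_def)
    note S' = index_setsD[OF S]
    define s where "s = real (card S)"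
    define q where "q = real (k + 1 - card S)"
    have q: "q \<ge> 1" "real (k + 1) = s + q" using S'(4) by (auto simp: q_def s_def of_nat_diff)
    have s: "s \<ge> 1" using S'(3) by (simp add: s_def)
    have sumS: "(\<Sum>i\<in>S. x i) = s * m" by (simp add: S_def s_def)
    have cardD: "real (card ({..<k} - S)) = q - 1"
      using card_Diff_subset[OF S'(1,2)] S'(4) by (simp add: q_def of_nat_diff)
    have "(\<Sum>i\<in>{..<k} - S. x i) \<ge> (\<Sum>i\<in>{..<k} - S. m + 1)"
    proof (rule sum_mono)
      fix i assume "i \<in> {..<k} - S"
      then have "m < x i" using m(2)[of i] by (force simp: S_def)
      then show "m + 1 \<le> x i" using intle[of j i] j by simp
    qed
    also have "(\<Sum>i\<in>{..<k} - S. m + 1) = (q - 1) * (m + 1)" using cardD by simp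
    finally have "s * ((q - 1) * (m + 1)) \<le> s * (\<Sum>i\<in>{..<k} - S. x i)"
      using s by (intro mult_left_mono) auto
    then have "real (k + 1) * (\<Sum>i\<in>S. x i) - s * (\<Sum>i<k. x i) \<le> (s + q) * (s * m) - s * (s * m) - s * ((q - 1) * (m + 1))"
      unfolding split[OF S'(2)] sumS q(2) by (simp add: algebra_simps)
    also have "\<dots> = s * (m + 1) - s * q" by (simp add: algebra_simps)
    also have "\<dots> \<le> - (s * q)" using s m1 by (simp add: mult_nonneg_nonpos)
    finally have "s * q \<le> \<bar>real (k + 1) * (\<Sum>i\<in>S. x i) - s * (\<Sum>i<k. x i)\<bar>" by linarith
    then show ?thesis using crit[OF S] by (simp only: s_def q_def)
  next
    case False
    define S where "S = {i. i < k \<and> x i \<noteq> 0}"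
    have S: "S \<in> index_sets k" using i0 by (auto simp: S_def index_sets_def)
    note S' = index_setsD[OF S]
    define s where "s = real (card S)"
    define q where "q = real (k + 1 - card S)"
    have q: "q \<ge> 1" "real (k + 1) = s + q" using S'(4) by (auto simp: q_def s_def of_nat_diff)
    \<comment> \<open>Without negative entries, the integer entries on the support are at least 1.
      The support also carries the whole sum, so the numerator is q times the sum over S, at least q
      s.\<close>
    have "(\<Sum>i\<in>S. 1) \<le> (\<Sum>i\<in>S. x i)"
    proof (rule sum_mono)
      fix i assume "i \<in> S"
      then have "x i > 0" using False by (force simp: S_def)
      moreover obtain a :: int where "x i = of_int a" using int by (metis Ints_cases)
      ultimately show "1 \<le> x i" by simp
    qed
    then have sumS: "s \<le> (\<Sum>i\<in>S. x i)" by (simp add: s_def)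
    have "(\<Sum>i\<in>{..<k} - S. x i) = 0" by (intro sum.neutral) (auto simp: S_def)
    then have "real (k + 1) * (\<Sum>i\<in>S. x i) - s * (\<Sum>i<k. x i) = q * (\<Sum>i\<in>S. x i)"
      unfolding split[OF S'(2)] q(2) by (simp add: algebra_simps)
    moreover have "q * s \<le> q * (\<Sum>i\<in>S. x i)" using sumS q by (intro mult_left_mono) auto
    ultimately have "s * q \<le> \<bar>real (k + 1) * (\<Sum>i\<in>S. x i) - s * (\<Sum>i<k. x i)\<bar>"
      by (simp add: mult.commute)
    then show ?thesis using crit[OF S] by (simp only: s_def q_def)
  qed
qed

text \<open>The functional of {i} plus the sum over all singletons is (k + 1) / k times the unit
  vector i; singletons have no outer entries because \<sigma> avoids them. For i \<ge> k,
  injectivity of \<sigma> leaves just the unit vector i once the inner part of the functional of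
  \<sigma> i is subtracted.\<close>

lemma facet_spanning:
  assumes k: "1 \<le> k" "k \<le> d" and \<sigma>: "inj_on \<sigma> {k..<d}" "\<And>j. k \<le> j \<Longrightarrow> j < d \<Longrightarrow> \<sigma> j \<in> index_sets k"
    and card: "\<And>j. k \<le> j \<Longrightarrow> j < d \<Longrightarrow> card (\<sigma> j) \<noteq> 1" and i: "i < d"
  shows "uvec i \<in> fvec.span (facet_vec d k \<sigma> ` index_sets k)"
proof -
  let ?U = "facet_vec d k \<sigma>"
  have base: "?U S \<in> fvec.span (?U ` index_sets k)" if "S \<in> index_sets k" for S
    using that by (intro fvec.span_base) simp
  have single: "{j} \<in> index_sets k" if "j < k" for j using that by (simp add: index_sets_def)
  have U1: "?U {j} l = (if l < k then (real (k + 1) * (if l = j then 1 else 0) - 1) / real k else 0)"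
    if "j < k" for j l
    using card[of l] by (auto simp: facet_vec_def indicator_vec_def not_less)
  have low: "uvec i \<in> fvec.span (?U ` index_sets k)" if i: "i < k" for i
  proof -
    have E: "(\<Sum>j<k. ?U {j}) l = (if l < k then 1 / real k else 0)" for l
    proof -
      have "(\<Sum>j<k. ?U {j}) l = (\<Sum>j<k. ?U {j} l)" by (rule sum_fun_eval)
      also have "\<dots> = (\<Sum>j<k. if l < k then (real (k + 1) * (if l = j then 1 else 0) - 1) / real k else 0)"
        by (intro sum.cong refl) (simp add: U1)
      also have "\<dots> = (if l < k then 1 / real k else 0)"
        by (simp add: sum_divide_distrib[symmetric] sum_subtractf sum_distrib_left[symmetric])
      finally show ?thesis .
    qed
    have "uvec i = fscale (real k / real (k + 1)) (?U {i} + (\<Sum>j<k. ?U {j}))"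
    proof
      fix l
      have "fscale (real k / real (k + 1)) (?U {i} + (\<Sum>j<k. ?U {j})) l
          = real k / real (k + 1) * (?U {i} l + (\<Sum>j<k. ?U {j}) l)"
        by (simp only: fscale_apply plus_fun_apply)
      also have "\<dots> = uvec i l"
        unfolding E U1[OF i] using k i by (simp add: uvec_apply field_simps)
      finally show "uvec i l = fscale (real k / real (k + 1)) (?U {i} + (\<Sum>j<k. ?U {j})) l" ..
    qed
    also have "\<dots> \<in> fvec.span (?U ` index_sets k)"
      by (intro fvec.span_scale fvec.span_add fvec.span_sum base single i) simp
    finally show ?thesis .
  qed
  show ?thesis
  proof (cases "i < k")
    case True then show ?thesis by (rule low)
  next
    case False
    have "uvec i = ?U (\<sigma> i) - (\<Sum>j<k. fscale (?U (\<sigma> i) j) (uvec j))"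
    proof
      fix l
      have "(\<Sum>j<k. fscale (?U (\<sigma> i) j) (uvec j)) l = (\<Sum>j<k. if l = j then ?U (\<sigma> i) j else 0)"
        unfolding sum_fun_eval by (intro sum.cong refl) (simp add: uvec_apply)
      also have "\<dots> = (if l < k then ?U (\<sigma> i) l else 0)" by simp
      finally have "(?U (\<sigma> i) - (\<Sum>j<k. fscale (?U (\<sigma> i) j) (uvec j))) l
          = ?U (\<sigma> i) l - (if l < k then ?U (\<sigma> i) l else 0)"
        by (simp only: minus_apply)
      also have "\<dots> = uvec i l"
        using False i inj_onD[OF \<sigma>(1), of l i] by (auto simp: facet_vec_def uvec_apply)
      finally show "uvec i l = (?U (\<sigma> i) - (\<Sum>j<k. fscale (?U (\<sigma> i) j) (uvec j))) l" ..
    qed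
    also have "\<dots> \<in> fvec.span (?U ` index_sets k)"
    proof (intro fvec.span_diff fvec.span_sum fvec.span_scale)
      show "?U (\<sigma> i) \<in> fvec.span (?U ` index_sets k)" using \<sigma>(2)[of i] False i by (intro base) simp
      show "uvec j \<in> fvec.span (?U ` index_sets k)" if "j \<in> {..<k}" for j using low that by simp
    qed
    finally show ?thesis .
  qed
qed

lemma finite_index_sets: "finite (index_sets k)"
  by (rule finite_subset[of _ "Pow {..<k}"]) (auto simp: index_sets_def)

lemma card_index_sets: "card (index_sets k) = 2 ^ k - 1"
proof -
  have "index_sets k = Pow {..<k} - {{}}" by (auto simp: index_sets_def)
  then show ?thesis by (simp add: card_Pow)
qed

lemma dual_system_exists:
  assumes k: "1 \<le> k" "k \<le> d" and d: "d < 2 ^ k"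
  shows "\<exists>U Y :: nat set \<Rightarrow> nat \<Rightarrow> real. dual_system d k (index_sets k) U Y"
proof -
  define N where "N = index_sets k - (\<lambda>j. {j}) ` {..<k}"
  have "card ((\<lambda>j. {j}) ` {..<k}) = k" by (subst card_image) auto
  moreover have "(\<lambda>j. {j}) ` {..<k} \<subseteq> index_sets k" by (auto simp: index_sets_def)
  ultimately have "card N = 2 ^ k - 1 - k"
    unfolding N_def by (subst card_Diff_subset) (auto simp: card_index_sets)
  \<comment> \<open>d < 2^k says precisely that the d - k outer coordinates are at most as many as
    the 2^k - 1 - k non-singletons.\<close>
  then have "card {k..<d} \<le> card N" using d by simp
  moreover have "finite N" by (simp add: N_def finite_index_sets)
  ultimately obtain \<sigma> where \<sigma>: "\<sigma> ` {k..<d} \<subseteq> N" "inj_on \<sigma> {k..<d}"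
    using card_le_inj[of "{k..<d}" N] by auto
  have \<sigma>N: "\<sigma> j \<in> index_sets k" "card (\<sigma> j) \<noteq> 1" if "k \<le> j" "j < d" for j
  proof -
    have mem: "\<sigma> j \<in> N" using \<sigma>(1) that by auto
    then show "\<sigma> j \<in> index_sets k" by (simp add: N_def)
    show "card (\<sigma> j) \<noteq> 1"
    proof
      assume "card (\<sigma> j) = 1"
      then obtain l where "\<sigma> j = {l}" by (auto simp: card_1_singleton_iff)
      then show False using mem by (auto simp: N_def index_sets_def)
    qed
  qed
  have "dual_system d k (index_sets k) (facet_vec d k \<sigma>) indicator_vec"
  proof
    show "k \<le> d" "finite (index_sets k)" by (fact k finite_index_sets)+
    show "index_sets k \<noteq> {}" using k by (auto simp: index_sets_def intro!: exI[of _ "{0}"])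
    show "facet_vec d k \<sigma> S \<in> Edim d" for S using k by (auto simp: facet_vec_def Edim_def)
    show "indicator_vec S i \<in> \<int>" for S i by (simp add: indicator_vec_def)
    show "indicator_vec S \<in> Edim k" if "S \<in> index_sets k" for S
      using that by (rule indicator_vec_Edim)
    show "ip d (facet_vec d k \<sigma> S) (indicator_vec S) = 1" if "S \<in> index_sets k" for S
      using k(2) that by (rule facet_diag)
    show "\<bar>ip d (facet_vec d k \<sigma> T) (indicator_vec S)\<bar> < 1"
      if "S \<in> index_sets k" "T \<in> index_sets k" "T \<noteq> S" for S T
      using k(2) that by (rule facet_off_diag)
    show "\<exists>S\<in>index_sets k. 1 \<le> \<bar>ip d (facet_vec d k \<sigma> S) x\<bar>"
      if "x \<in> Edim k" "x \<noteq> 0" "\<And>i. x i \<in> \<int>" for x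
      using k(2) that by (rule facet_cover)
    show "uvec i \<in> fvec.span (facet_vec d k \<sigma> ` index_sets k)" if "i < d" for i
      using k \<sigma>(2) \<sigma>N that by (rule facet_spanning)
  qed
  then show ?thesis by blast
qed

section \<open>Numerical estimates and conclusion\<close>

lemma log_bound:
  assumes "(2::nat) \<le> d"
  obtains k where "1 \<le> k" "k \<le> d" "d < 2 ^ k" "real k \<le> 2 / ln 2 * ln (real d)"
proof -
  \<comment> \<open>Minimality gives 2^(k-1) \<le> d; the remaining 1 in k is paid for by ln 2 \<le>
    ln d. This is where d \<ge> 2 and the 2 in 2 / ln 2 come from.\<close>
  define k where "k = (LEAST k. d < 2 ^ k)"
  have ex: "d < 2 ^ d" by (rule less_exp)
  have k: "d < 2 ^ k" unfolding k_def by (rule LeastI[of _ d]) (rule ex)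
  have kd: "k \<le> d" unfolding k_def by (rule Least_le) (rule ex)
  have k1: "1 \<le> k" using k assms by (cases k) auto
  have "\<not> d < 2 ^ (k - 1)" unfolding k_def by (rule not_less_Least) (use k1 in \<open>simp add: k_def\<close>)
  then have "(2::real) ^ (k - 1) \<le> real d" by (metis not_less of_nat_le_iff of_nat_numeral of_nat_power)
  then have "ln ((2::real) ^ (k - 1)) \<le> ln (real d)" using assms by (subst ln_le_cancel_iff) auto
  then have "real (k - 1) * ln 2 \<le> ln (real d)" by (simp add: ln_realpow)
  moreover have "ln 2 \<le> ln (real d)" using assms by (subst ln_le_cancel_iff) auto
  ultimately have "real k * ln 2 \<le> 2 * ln (real d)" using k1 by (simp add: of_nat_diff algebra_simps)
  then have "real k \<le> 2 / ln 2 * ln (real d)" by (simp add: field_simps)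
  then show thesis using that k1 kd k by blast
qed

lemma ln_le_of_le_power:
  assumes "1 \<le> d" "d \<le> 9 ^ m" shows "1 / ln 9 * ln (real d) \<le> real m"
proof -
  have "real d \<le> 9 ^ m" using assms(2) by (metis of_nat_le_iff of_nat_numeral of_nat_power)
  then have "ln (real d) \<le> ln (9 ^ m)" using assms(1) by (subst ln_le_cancel_iff) auto
  then have "ln (real d) \<le> real m * ln 9" by (simp add: ln_realpow)
  moreover have "ln (9::real) > 0" by simp
  ultimately show ?thesis by (simp add: field_simps)
qed

theorem theorem1p3:
  shows "(\<exists>c>0. \<forall>d\<ge>1. \<forall>L C. lattice d L \<and> convex_body d C \<longrightarrow>
            (lattice_reduced d L C \<longrightarrow> real (fvec.dim (width_directions d L C)) \<ge> c * ln (real d)) \<and>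
            (lattice_complete d L C \<longrightarrow> real (fvec.dim (diam_directions d L C)) \<ge> c * ln (real d)))
       \<and> (\<exists>c'. \<forall>d\<ge>2.
            (\<exists>L C. lattice d L \<and> lattice_reduced d L C \<and>
                real (fvec.dim (width_directions d L C)) \<le> c' * ln (real d)) \<and>
            (\<exists>L C. lattice d L \<and> lattice_complete d L C \<and>
                real (fvec.dim (diam_directions d L C)) \<le> c' * ln (real d)))"
proof
  have "1 / ln 9 * ln (real d) \<le> real (fvec.dim (width_directions d L C))"
    if "1 \<le> d" "lattice d L" "lattice_reduced d L C" for d L C
    using lattice_reduced_dim_bound[OF latticeD(4)[OF that(2)] that(3)] by (intro ln_le_of_le_power that)
  moreover have "1 / ln 9 * ln (real d) \<le> real (fvec.dim (diam_directions d L C))"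
    if "1 \<le> d" "lattice d L" "lattice_complete d L C" for d L C
  proof (rule ln_le_of_le_power[OF that(1)])
    have "d \<le> 3 ^ fvec.dim (diam_directions d L C)"
      by (rule lattice_complete_dim_bound[OF that(2,1,3)])
    \<comment> \<open>Weakened from 3 to 9 so that the one constant 1 / ln 9 serves both
      statements.\<close>
    also have "\<dots> \<le> 9 ^ fvec.dim (diam_directions d L C)" by (rule power_mono) auto
    finally show "d \<le> 9 ^ fvec.dim (diam_directions d L C)" .
  qed
  moreover have "1 / ln (9::real) > 0" by simp
  ultimately show "\<exists>c>0. \<forall>d\<ge>1. \<forall>L C. lattice d L \<and> convex_body d C \<longrightarrow>
            (lattice_reduced d L C \<longrightarrow> real (fvec.dim (width_directions d L C)) \<ge> c * ln (real d)) \<and>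
            (lattice_complete d L C \<longrightarrow> real (fvec.dim (diam_directions d L C)) \<ge> c * ln (real d))"
    by (intro exI[of _ "1 / ln 9"] conjI allI impI) auto
next
  show "\<exists>c'. \<forall>d\<ge>2.
            (\<exists>L C. lattice d L \<and> lattice_reduced d L C \<and>
                real (fvec.dim (width_directions d L C)) \<le> c' * ln (real d)) \<and>
            (\<exists>L C. lattice d L \<and> lattice_complete d L C \<and>
                real (fvec.dim (diam_directions d L C)) \<le> c' * ln (real d))"
  proof (rule exI[of _ "2 / ln 2"], intro allI impI)
    fix d :: nat assume "2 \<le> d"
    then obtain k where k: "1 \<le> k" "k \<le> d" "d < 2 ^ k" "real k \<le> 2 / ln 2 * ln (real d)"
      by (rule log_bound)
    obtain U Y :: "nat set \<Rightarrow> nat \<Rightarrow> real" where "dual_system d k (index_sets k) U Y"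
      using dual_system_exists[OF k(1-3)] by blast
    then interpret dual_system d k "index_sets k" U Y .
    have "real (fvec.dim (width_directions d red_lattice symhull)) \<le> 2 / ln 2 * ln (real d)"
      using dim_le_k[OF symhull_width_directions] k(4) by linarith
    moreover have "real (fvec.dim (diam_directions d comp_lattice slab)) \<le> 2 / ln 2 * ln (real d)"
      using dim_le_k[OF slab_diam_directions] k(4) by linarith
    ultimately show "(\<exists>L C. lattice d L \<and> lattice_reduced d L C \<and>
                real (fvec.dim (width_directions d L C)) \<le> 2 / ln 2 * ln (real d)) \<and>
            (\<exists>L C. lattice d L \<and> lattice_complete d L C \<and>
                real (fvec.dim (diam_directions d L C)) \<le> 2 / ln 2 * ln (real d))"
      using red_lattice symhull_reduced comp_lattice slab_complete by blast
  qed
qed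

end
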